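(* Let $n\in\mathbb{Z}\setminus\{0\}$, $a\in\mathbb{C}\setminus\{0\}$, $\beta\in\mathbb{C}$, $\alpha\in\mathbb{C}(t)\setminus\mathbb{C}$, and let $\delta:A_{\alpha,\beta}\to A_{\alpha,\beta}$ be a linear map. Then $(A_{\alpha,\beta},\delta)$ is a $1$-differential $(\mathrm{Vir},d_{n,a})$-module if and only if one of the following conditions holds. (1) $n=1$, $a$ is a primitive root of unity of degree $d$, and $$A_{\alpha,\beta}=\mathbb{C}[t^{\pm1},(t-a_ia^j)^{-1},\ i=1,\dots,s;\ j=1,\dots,d]$$ for some $a_1,\dots,a_s\in\mathbb{C}\setminus\{0\}$ such that all $a_ia^j$ are distinct, and $\alpha(t)$ is the sum of $$\alpha_0(t)=\sum_{i=1}^s\sum_{j=1}^{d}a_i(m_{i0}+m_{i1}+\cdots+m_{i,j-1})(a^{-j}t-a_i)^{-1},$$ where $m_{ij}\in\mathbb{Z}$ with $\sum_{j=0}^{d-1}m_{ij}=0$ for all $i=1,\dots,s$, and an element of $\{f\in A_{\alpha,\beta}\mid f(at)-f(t)=0\}$. In this case, for these $m_{ij}$, $$\delta(f)(t)=cf(at)\prod_{i=1}^{s}\prod_{j=0}^{d-1}(t-a_ia^j)^{m_{ij}}-f(t)\quad\text{for all } f\in A_{\alpha,\beta},$$ for some $c\in\mathbb{C}\setminus\{0\}$. (2) $n=-1$ and $$A_{\alpha,\beta}=\mathbb{C}[t^{\pm1},(t-a_i)^{-1},(t-a_i^{-1}a)^{-1},\ i=1,\dots,s]$$ for some $a_1,\dots,a_s\in\mathbb{C}\setminus\{0\}$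 such that all $a_i$ are distinct (possibly $a_i=a_j^{-1}a$), and $\alpha(t)$ is the sum of $$\alpha_0(t)=-\frac{m_0}{2}-\sum_{i=1}^s\frac{m_i}{2}\,\frac{(a_i^2-a)t}{(t-a_i)(a_it-a)},$$ where $m_0,m_1,\dots,m_s\in\mathbb{Z}$, and an element of $A_{\alpha,\beta}$ of the form $$b\,\frac{t^{k}(t^2-a)\prod_{i=1}^l(t-\lambda_i)(\lambda_it-a)}{\prod_{i=1}^{m}(t-\mu_i)(\mu_it-a)},\qquad b\in\mathbb{C},$$ where $k\in\mathbb{Z}$, $m,l\in\mathbb{N}$ with $m=l+k+1$, and $\lambda_i,\mu_i\in\mathbb{C}\setminus\{0\}$ with each $\mu_i=a_j$ or $\mu_i=a_j^{-1}a$ for some $1\le j\le s$. In this case, for these $m_0,\dots,m_s$, $$\delta(f)(t)=cf(at^{-1})\,t^{m_0}\prod_{i=1}^{s}(t-a_i)^{m_i}(t-a_i^{-1}a)^{-m_i}-f(t)\quad\text{for all } f\in A_{\alpha,\beta},$$ for some $c\in\mathbb{C}\setminus\{0\}$.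
   Context: All spaces and algebras are over $\mathbb{C}$ and all linear maps are $\mathbb{C}$-linear; $\mathbb{N}$ is the set of positive integers. For a Lie algebra $\mathcal{L}$, a $1$-differential operator on $\mathcal{L}$ is a linear map $d:\mathcal{L}\to\mathcal{L}$ such that $d[x,y]=[d(x),y]+[x,d(y)]+[d(x),d(y)]$ for all $x,y\in\mathcal{L}$. A $1$-differential module over $(\mathcal{L},d)$ is a pair $(V,\delta)$ where $V$ is an $\mathcal{L}$-module and $\delta:V\to V$ is a linear map with $\delta(xv)=d(x)v+x\delta(v)+d(x)\delta(v)$ for all $x\in\mathcal{L}$, $v\in V$. (The map $\delta=-\mathrm{id}_V$ always satisfies this; it is called the trivial $1$-differential module structure.) The Virasoro algebra $\mathrm{Vir}$ is the complex Lie algebra with basis $\{L_n, C \mid n\in\mathbb{Z}\}$ and brackets $[L_m,L_n]=(n-m)L_{n+m}+\delta_{n,-m}\frac{m^3-m}{12}C$, $[C,L_m]=0$. For $n\in\mathbb{Z}\setminus\{0\}$, $a\in\mathbb{C}\setminus\{0\}$ the $1$-differential operator $d_{n,a}$ on $\mathrm{Vir}$ is given by $d_{n,a}(L_i)=\frac{a^i}{n}\left(L_{ni}-\delta_{i,0}\frac{n^2-1}{24}C\right)-L_i$ and $d_{n,a}(C)=nC-C$. The module $A_{\alpha,\beta}$: let $\alpha\in\mathbb{C}(t)\setminus\mathbb{C}$ and $\beta\in\mathbb{C}$, and let $p_1,\dots,p_r$ ($r\ge0$) be the distinct nonzero poles of $\alpha$, i.e. $\alpha=\alpha_1/\alpha_2$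 with $\alpha_1\in\mathbb{C}[t^{\pm1}]$ and $\alpha_2=(t-p_1)^{l_1}\cdots(t-p_r)^{l_r}$ coprime, $l_i\in\mathbb{N}$. As a vector space $A_{\alpha,\beta}$ is identified with the subalgebra $\mathbb{C}[t^{\pm1},(t-p_1)^{-1},\dots,(t-p_r)^{-1}]$ of $\mathbb{C}(t)$. The $\mathrm{Vir}$-action is $L_if(t)=(\partial+\alpha+i\beta)\left(t^if(t)\right)$, $Cf=0$, for $i\in\mathbb{Z}$, $f\in A_{\alpha,\beta}$, where $\partial=t\frac{d}{dt}$.
   Formalization: The trivial structure δ=-id, always a module structure but excluded by c≠0, is excluded on the left side; in (2), l and m must be positive only if s>0 (for s=0 they may be 0, since otherwise e.g. α=t-a/t, δ(f)=f(a/t)-f would be missed). *)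

theory Defs
  imports
    Complex_Main
    "HOL-Library.Poly_Mapping"
    "HOL-Computational_Algebra.Computational_Algebra"
    "HOL-Computational_Algebra.Field_as_Ring"
begin

subsection \<open>Lie algebras, modules, and 1-differential structures over the complex numbers\<close>

locale lie_algebra = vector_space scale
  for scale :: "complex \<Rightarrow> 'g::ab_group_add \<Rightarrow> 'g" +
  fixes bracket :: "'g \<Rightarrow> 'g \<Rightarrow> 'g"
  assumes bracket_add_left: "bracket (x + y) z = bracket x z + bracket y z"
    and bracket_add_right: "bracket x (y + z) = bracket x y + bracket x z"
    and bracket_scale_left: "bracket (scale c x) y = scale c (bracket x y)"
    and bracket_scale_right: "bracket x (scale c y) = scale c (bracket x y)"
    and bracket_self: "bracket x x = 0"
    and jacobi: "bracket x (bracket y z) + bracket y (bracket z x) + bracket z (bracket x y) = 0"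

(* The module lives on a subspace V of an ambient complex vector space. *)
locale lie_module =
  lie_algebra scale bracket + ambient: vector_space scaleV
  for scale :: "complex \<Rightarrow> 'g::ab_group_add \<Rightarrow> 'g"
    and bracket :: "'g \<Rightarrow> 'g \<Rightarrow> 'g"
    and scaleV :: "complex \<Rightarrow> 'v::ab_group_add \<Rightarrow> 'v" +
  fixes V :: "'v set" and act :: "'g \<Rightarrow> 'v \<Rightarrow> 'v"
  assumes subspace_V: "ambient.subspace V"
    and act_closed: "v \<in> V \<Longrightarrow> act x v \<in> V"
    and act_add_left: "v \<in> V \<Longrightarrow> act (x + y) v = act x v + act y v"
    and act_scale_left: "v \<in> V \<Longrightarrow> act (scale c x) v = scaleV c (act x v)"
    and act_add_right: "v \<in> V \<Longrightarrow> w \<in> V \<Longrightarrow> act x (v + w) = act x v + act x w"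
    and act_scale_right: "v \<in> V \<Longrightarrow> act x (scaleV c v) = scaleV c (act x v)"
    and act_bracket: "v \<in> V \<Longrightarrow> act (bracket x y) v = act x (act y v) - act y (act x v)"

definition linear_endo_on ::
    "(complex \<Rightarrow> 'v::ab_group_add \<Rightarrow> 'v) \<Rightarrow> 'v set \<Rightarrow> ('v \<Rightarrow> 'v) \<Rightarrow> bool" where
  "linear_endo_on s V \<delta> \<longleftrightarrow>
     (\<forall>v\<in>V. \<delta> v \<in> V) \<and>
     (\<forall>v\<in>V. \<forall>w\<in>V. \<delta> (v + w) = \<delta> v + \<delta> w) \<and>
     (\<forall>c. \<forall>v\<in>V. \<delta> (s c v) = s c (\<delta> v))"

definition one_differential_operator ::
    "(complex \<Rightarrow> 'g::ab_group_add \<Rightarrow> 'g) \<Rightarrow> ('g \<Rightarrow> 'g \<Rightarrow> 'g) \<Rightarrow> ('g \<Rightarrow> 'g) \<Rightarrow> bool" where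
  "one_differential_operator s br d \<longleftrightarrow>
     linear_endo_on s UNIV d \<and>
     (\<forall>x y. d (br x y) = br (d x) y + br x (d y) + br (d x) (d y))"

locale one_differential_module = lie_module scale bracket scaleV V act
  for scale :: "complex \<Rightarrow> 'g::ab_group_add \<Rightarrow> 'g"
    and bracket :: "'g \<Rightarrow> 'g \<Rightarrow> 'g"
    and d :: "'g \<Rightarrow> 'g"
    and scaleV :: "complex \<Rightarrow> 'v::ab_group_add \<Rightarrow> 'v"
    and V :: "'v set"
    and act :: "'g \<Rightarrow> 'v \<Rightarrow> 'v"
    and \<delta> :: "'v \<Rightarrow> 'v" +
  assumes d_operator: "one_differential_operator scale bracket d"
    and \<delta>_linear: "linear_endo_on scaleV V \<delta>"
    and \<delta>_act: "v \<in> V \<Longrightarrow> \<delta> (act x v) = act (d x) v + act x (\<delta> v) + act (d x) (\<delta> v)"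


subsection \<open>The Virasoro algebra\<close>

datatype vir_basis = L int | C

type_synonym vir = "vir_basis \<Rightarrow>\<^sub>0 complex"

abbreviation vir_scale :: "complex \<Rightarrow> vir \<Rightarrow> vir" where
  "vir_scale c \<equiv> Poly_Mapping.map ((*) c)"

abbreviation vir_L :: "int \<Rightarrow> vir" where "vir_L i \<equiv> Poly_Mapping.single (L i) 1"
abbreviation vir_C :: vir where "vir_C \<equiv> Poly_Mapping.single C 1"

(* The linear map on Vir with prescribed values g on the basis. *)
definition vir_extend ::
    "(complex \<Rightarrow> 'v \<Rightarrow> 'v) \<Rightarrow> (vir_basis \<Rightarrow> 'v::ab_group_add) \<Rightarrow> vir \<Rightarrow> 'v" where
  "vir_extend s g x = (\<Sum>b\<in>Poly_Mapping.keys x. s (Poly_Mapping.lookup x b) (g b))"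

fun vir_bracket_basis :: "vir_basis \<Rightarrow> vir_basis \<Rightarrow> vir" where
  "vir_bracket_basis (L m) (L n) =
     vir_scale (of_int (n - m)) (vir_L (n + m)) +
     (if n = - m then vir_scale (of_int (m ^ 3 - m) / 12) vir_C else 0)"
| "vir_bracket_basis (L m) C = 0"
| "vir_bracket_basis C b = 0"

definition vir_bracket :: "vir \<Rightarrow> vir \<Rightarrow> vir" where
  "vir_bracket x y =
     vir_extend vir_scale (\<lambda>b. vir_extend vir_scale (vir_bracket_basis b) y) x"

fun vir_d_basis :: "int \<Rightarrow> complex \<Rightarrow> vir_basis \<Rightarrow> vir" where
  "vir_d_basis n a (L i) =
     vir_scale (a powi i / of_int n)
       (vir_L (n * i) - (if i = 0 then vir_scale (of_int (n\<^sup>2 - 1) / 24) vir_C else 0))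
     - vir_L i"
| "vir_d_basis n a C = vir_scale (of_int n) vir_C - vir_C"

definition vir_d :: "int \<Rightarrow> complex \<Rightarrow> vir \<Rightarrow> vir" where
  "vir_d n a = vir_extend vir_scale (vir_d_basis n a)"


subsection \<open>Rational functions in one variable\<close>

type_synonym ratfun = "complex poly fract"

definition rconst :: "complex \<Rightarrow> ratfun" where
  "rconst c = to_fract [:c:]"

definition rX :: ratfun where
  "rX = to_fract [:0, 1:]"

definition rscale :: "complex \<Rightarrow> ratfun \<Rightarrow> ratfun" where
  "rscale c f = rconst c * f"

(* quot_of_fract gives numerator and denominator in lowest terms *)

definition rderiv :: "ratfun \<Rightarrow> ratfun" where
  "rderiv f = (case quot_of_fract f of (p, q) \<Rightarrow>
     to_fract (pderiv p * q - p * pderiv q) / to_fract (q\<^sup>2))"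

definition reuler :: "ratfun \<Rightarrow> ratfun" where
  "reuler f = rX * rderiv f"

definition peval :: "complex poly \<Rightarrow> ratfun \<Rightarrow> ratfun" where
  "peval p r = poly (map_poly rconst p) r"

(* f(r(t)), for nonconstant r *)
definition rsubst :: "ratfun \<Rightarrow> ratfun \<Rightarrow> ratfun" where
  "rsubst f r = (case quot_of_fract f of (p, q) \<Rightarrow> peval p r / peval q r)"

(* The choice of representative in rsubst and rderiv is immaterial: see rsubst_quot, rderiv_quot. *)

lemma quot_of_fract_cases:
  fixes p q :: "complex poly"
  assumes "q \<noteq> 0"
  obtains e where "e \<noteq> 0"
    and "p = fst (quot_of_fract (to_fract p / to_fract q)) * e"
    and "q = snd (quot_of_fract (to_fract p / to_fract q)) * e"
proof -
  have "quot_of_fract (to_fract p / to_fract q) = normalize_quot (p,q)"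
    using quot_of_fract_quot_to_fract[of "(p,q)"] by (simp add: quot_to_fract_def Fract_conv_to_fract)
  then show ?thesis using normalize_quotE[OF assms, of p] that by metis
qed

lemma rconst_hom:
  "rconst (a + b) = rconst a + rconst b"
  "rconst (a * b) = rconst a * rconst b"
  "rconst 0 = 0"
  "rconst 1 = 1"
  unfolding rconst_def by (simp_all flip: to_fract_add to_fract_mult one_pCons)

lemma peval_pCons: "peval (pCons c p) r = rconst c + r * peval p r"
  unfolding peval_def by (simp add: map_poly_pCons rconst_hom)

lemma peval_0: "peval 0 r = 0" by (simp add: peval_def)

lemma peval_add: "peval (p + q) r = peval p r + peval q r"
  by (induction p q rule: poly_induct2) (auto simp: peval_pCons peval_0 rconst_hom algebra_simps)

lemma peval_smult: "peval (smult c q) r = rconst c * peval q r"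
  by (induction q) (auto simp: peval_pCons peval_0 rconst_hom algebra_simps)

lemma peval_mult: "peval (p * q) r = peval p r * peval q r"
  by (induction p) (auto simp: peval_pCons peval_0 rconst_hom algebra_simps peval_add peval_smult)

lemma rsubst_quot:
  assumes "peval q r \<noteq> 0"
  shows "rsubst (to_fract p / to_fract q) r = peval p r / peval q r"
proof -
  have "q \<noteq> 0" using assms by (auto simp: peval_0)
  from quot_of_fract_cases[OF this, of p] obtain e where e: "e \<noteq> 0"
    "p = fst (quot_of_fract (to_fract p / to_fract q)) * e"
    "q = snd (quot_of_fract (to_fract p / to_fract q)) * e" .
  obtain p' q' where pq: "quot_of_fract (to_fract p / to_fract q) = (p',q')" by fastforce
  with e have "p = p' * e" "q = q' * e" by auto
  then show ?thesis using assms pq unfolding rsubst_def by (simp add: peval_mult)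
qed

lemma rderiv_quot:
  assumes "q \<noteq> 0"
  shows "rderiv (to_fract p / to_fract q) = to_fract (pderiv p * q - p * pderiv q) / to_fract (q\<^sup>2)"
proof -
  from quot_of_fract_cases[OF assms, of p] obtain e where e: "e \<noteq> 0"
    "p = fst (quot_of_fract (to_fract p / to_fract q)) * e"
    "q = snd (quot_of_fract (to_fract p / to_fract q)) * e" .
  obtain p' q' where pq: "quot_of_fract (to_fract p / to_fract q) = (p',q')" by fastforce
  with e have "p = p' * e" "q = q' * e" by auto
  then show ?thesis using e(1) assms pq unfolding rderiv_def
    by (simp add: pderiv_mult divide_simps power2_eq_square algebra_simps
        del: to_fract_mult to_fract_add to_fract_diff
        flip: to_fract_mult to_fract_add to_fract_diff)
qed

definition nonzero_poles :: "ratfun \<Rightarrow> complex set" where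
  "nonzero_poles f = {p. p \<noteq> 0 \<and> poly (snd (quot_of_fract f)) p = 0}"

(* The unital complex subalgebra of the rational function field generated by S. *)
inductive_set subalgebra_gen :: "ratfun set \<Rightarrow> ratfun set" for S :: "ratfun set" where
  const: "rconst c \<in> subalgebra_gen S"
| gen: "f \<in> S \<Longrightarrow> f \<in> subalgebra_gen S"
| add: "f \<in> subalgebra_gen S \<Longrightarrow> g \<in> subalgebra_gen S \<Longrightarrow> f + g \<in> subalgebra_gen S"
| mult: "f \<in> subalgebra_gen S \<Longrightarrow> g \<in> subalgebra_gen S \<Longrightarrow> f * g \<in> subalgebra_gen S"

(* Laurent polynomials with the elements 1 / (t - p), p in P, adjoined. *)
definition laurent_adjoin :: "complex set \<Rightarrow> ratfun set" where
  "laurent_adjoin P = subalgebra_gen ({rX, inverse rX} \<union> (\<lambda>p. inverse (rX - rconst p)) ` P)"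


subsection \<open>The Virasoro modules attached to a rational function\<close>

(* The underlying space does not depend on the second parameter of the module. *)
definition A_space :: "ratfun \<Rightarrow> ratfun set" where
  "A_space \<alpha> = laurent_adjoin (nonzero_poles \<alpha>)"

fun A_act_basis :: "ratfun \<Rightarrow> complex \<Rightarrow> ratfun \<Rightarrow> vir_basis \<Rightarrow> ratfun" where
  "A_act_basis \<alpha> \<beta> f (L i) =
     reuler (rX powi i * f) + (\<alpha> + rconst (of_int i * \<beta>)) * (rX powi i * f)"
| "A_act_basis \<alpha> \<beta> f C = 0"

definition A_act :: "ratfun \<Rightarrow> complex \<Rightarrow> vir \<Rightarrow> ratfun \<Rightarrow> ratfun" where
  "A_act \<alpha> \<beta> x f = vir_extend rscale (A_act_basis \<alpha> \<beta> f) x"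

definition primitive_root_of_unity :: "nat \<Rightarrow> complex \<Rightarrow> bool" where
  "primitive_root_of_unity d a \<longleftrightarrow> 0 < d \<and> a ^ d = 1 \<and> (\<forall>k. 0 < k \<and> k < d \<longrightarrow> a ^ k \<noteq> 1)"

end

theory Submission
  imports Defs
begin

text \<open>
  Put \<open>D f = \<delta> f + f\<close>, \<open>E = \<partial> + \<alpha>\<close>, and write the action as \<open>L\<^sub>i = t^i (E + i (\<beta> + 1))\<close>. The pair of
  the module and \<open>\<delta>\<close> is a 1-differential module if and only if
  \<open>D (L\<^sub>i f) = (a^i / n) L\<^bsub>n i\<^esub> (D f)\<close> for all \<open>i\<close>, and \<open>\<delta>\<close> is the trivial structure if and only if
  \<open>D = 0\<close>.

  The first step is to show \<open>D (t^k f) = a^k t^(n k) D f\<close>. For \<open>\<beta>\<close> different from 0 and -1 the second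
  difference of \<open>L\<^bsub>k-m\<^esub> L\<^bsub>m\<^esub>\<close> in \<open>m\<close> is a nonzero multiple of \<open>t^k\<close>; the two exceptional values are treated
  by short separate arguments (\<open>D_shift_generic\<close>, \<open>D_shift_minus_one\<close>, \<open>D_shift_zero\<close>). It follows that
  \<open>D f = f(a t^n) u\<close> with \<open>u = D 1\<close>, and the relation for \<open>L\<^sub>0\<close> becomes the equation
  \<open>n \<alpha>(a t^n) = \<alpha> + \<partial>u/u\<close>. Conversely every nonzero solution \<open>u\<close> for which \<open>D\<close> preserves the module
  gives a structure (\<open>one_differential_module_iff_twist\<close>).

  Because the module contains all powers of \<open>1/(t - p)\<close> for the poles \<open>p\<close> of \<open>\<alpha>\<close>, the set of nonzero poles
  is stable under preimages of \<open>z \<mapsto> a z^n\<close>. Counting preimages gives \<open>\<bar>n\<bar> = 1\<close>; if there are no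
  nonzero poles, this follows from comparing pole orders at 0 and infinity. Moreover \<open>u\<close> is a unit, that is, a
  constant times a product of integral powers of \<open>t\<close> and of the \<open>t - p\<close> (\<open>twist_structure\<close>).

  For \<open>n = 1\<close> the equation is \<open>\<alpha>(a t) - \<alpha>(t) = \<partial>u/u\<close>. Finiteness of the set of poles (or, without poles, a
  comparison of coefficients) makes \<open>a\<close> a root of unity,
  summation over an orbit shows that the exponents in each orbit add up to 0, and summation by parts gives
  a particular solution; the remaining freedom is a function invariant under rotation. For \<open>n = -1\<close> the
  equation is \<open>\<alpha>(t) + \<alpha>(a/t) = - \<partial>u/u\<close>. Its right-hand side is symmetric, so minus the half of \<open>\<partial>u/u\<close> is a particular
  solution, and the remaining freedom is a function \<open>h\<close> with \<open>h(a/t) = - h(t)\<close>. Such a function is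
  \<open>t - a/t\<close> times a rational function of \<open>t + a/t\<close>, and splitting the latter into linear factors gives the stated
  product.
\<close>

section \<open>Substitution and derivation of rational functions\<close>

lemma rconst_hom':
  "rconst (- a) = - rconst a"
  "rconst (a - b) = rconst a - rconst b"
  unfolding rconst_def by (simp_all flip: to_fract_uminus to_fract_diff)

lemma rconst_eq_iff [simp]: "rconst a = rconst b \<longleftrightarrow> a = b"
  by (simp add: rconst_def)

lemma rconst_eq_0_iff [simp]: "rconst a = 0 \<longleftrightarrow> a = 0"
  by (simp add: rconst_def)

lemma rconst_simps [simp]: "rconst 0 = 0" "rconst 1 = 1"
  by (simp_all add: rconst_hom)

lemma rconst_inverse: "rconst (inverse a) = inverse (rconst a)"
proof (cases "a = 0")
  case False
  have "rconst (inverse a) * rconst a = 1"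
    using False by (simp flip: rconst_hom(2))
  then show ?thesis by (metis inverse_unique mult.commute)
qed simp

lemma rconst_divide: "rconst (a / b) = rconst a / rconst b"
  by (simp add: divide_inverse rconst_hom rconst_inverse)

lemma rconst_power: "rconst (a ^ k) = rconst a ^ k"
  by (induction k) (auto simp: rconst_hom)

lemma rconst_powi: "rconst (a powi k) = rconst a powi k"
  by (simp add: power_int_def rconst_power rconst_inverse)

lemma rconst_of_nat: "rconst (of_nat k) = of_nat k"
  by (induction k) (auto simp: rconst_hom)

lemma rconst_of_int: "rconst (of_int k) = of_int k"
  by (cases k) (auto simp: rconst_of_nat rconst_hom' rconst_hom simp del: of_nat_Suc)

lemma of_int_ratfun_eq_0_iff [simp]: "(of_int k :: ratfun) = 0 \<longleftrightarrow> k = 0"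
  by (simp flip: rconst_of_int)

lemma rconst_numeral [simp]: "rconst (numeral k) = numeral k"
  using rconst_of_int[of "numeral k"] by simp

lemma ratfun_cases:
  fixes f :: ratfun
  obtains p q where "f = to_fract p / to_fract q" "q \<noteq> 0" "coprime p q"
    "p = fst (quot_of_fract f)" "q = snd (quot_of_fract f)"
proof -
  have "f = to_fract (fst (quot_of_fract f)) / to_fract (snd (quot_of_fract f))"
    by (metis Fract_conv_to_fract Fract_quot_of_fract)
  then show ?thesis using that coprime_quot_of_fract snd_quot_of_fract_nonzero by blast
qed

lemma numeral_ratfun_neq_0 [simp]: "(numeral k :: ratfun) \<noteq> 0"
  by (simp flip: rconst_numeral)

subsection \<open>Substitution\<close>

lemma peval_const: "peval [:c:] r = rconst c"
  by (simp add: peval_pCons peval_0)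

lemma peval_1 [simp]: "peval 1 r = 1"
  using peval_const[of 1 r] by (simp add: one_pCons)

lemma peval_linear: "peval [:c, 1:] r = rconst c + r"
  by (simp add: peval_pCons peval_0)

lemma peval_prod: "peval (\<Prod>x\<in>A. f x) r = (\<Prod>x\<in>A. peval (f x) r)"
  by (induction A rule: infinite_finite_induct) (auto simp: peval_mult)

lemma peval_power: "peval (p ^ k) r = peval p r ^ k"
  by (induction k) (auto simp: peval_mult)

lemma peval_uminus: "peval (- p) r = - peval p r"
  using peval_smult[of "-1" p r] by (simp add: rconst_hom')

lemma peval_diff: "peval (p - q) r = peval p r - peval q r"
  using peval_add[of p "-q" r] by (simp add: peval_uminus)

lemma peval_rX: "peval p rX = to_fract p"
proof (induction p)
  case (pCons c p)
  have "to_fract (pCons c p) = to_fract ([:c:] + [:0,1:] * p)" by simp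
  then show ?case using pCons by (simp only: to_fract_add to_fract_mult peval_pCons rconst_def rX_def)
qed (simp add: peval_0)

text \<open>Over the complex numbers \<open>p\<close> is a product of linear factors. Evaluating at a rational function
  \<open>r\<close> keeps this product, so vanishing and divisibility questions about \<open>p(r)\<close> reduce to the
  differences \<open>r - c\<close> with \<open>c\<close> a root of \<open>p\<close>.\<close>

lemma peval_split:
  obtains root where
    "\<And>r. peval p r = rconst (lead_coeff p) * (\<Prod>i<degree p. (r - rconst (root i)))"
    "\<And>i. i < degree p \<Longrightarrow> poly p (root i) = 0"
proof -
  obtain root where root: "smult (lead_coeff p) (\<Prod>i<degree p. [:-root i, 1:]) = p"
    by (rule complex_poly_decompose')
  have "peval p r = rconst (lead_coeff p) * (\<Prod>i<degree p. (r - rconst (root i)))" for r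
  proof -
    have "peval p r = peval (smult (lead_coeff p) (\<Prod>i<degree p. [:-root i, 1:])) r"
      by (simp only: root)
    also have "\<dots> = rconst (lead_coeff p) * (\<Prod>i<degree p. (r - rconst (root i)))"
      by (simp only: peval_smult peval_prod peval_linear rconst_hom') simp
    finally show ?thesis .
  qed
  moreover have "poly p (root i) = 0" if "i < degree p" for i
  proof -
    have "poly p (root i) = poly (smult (lead_coeff p) (\<Prod>i<degree p. [:-root i, 1:])) (root i)"
      by (simp only: root)
    also have "\<dots> = 0" using that by (auto simp: poly_prod)
    finally show ?thesis .
  qed
  ultimately show ?thesis using that by blast
qed

text \<open>A nonconstant rational function is transcendental: none of the factors \<open>r - c\<close> vanishes. This is
  what makes substitution of \<open>r\<close> a well-defined field homomorphism.\<close>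

lemma peval_nonzero:
  assumes "r \<notin> range rconst" "p \<noteq> 0"
  shows "peval p r \<noteq> 0"
proof -
  obtain root where "\<And>r. peval p r = rconst (lead_coeff p) * (\<Prod>i<degree p. (r - rconst (root i)))"
    using peval_split[of p] by metis
  then show ?thesis using assms by auto
qed

lemma rsubst_quot':
  assumes "r \<notin> range rconst" "q \<noteq> 0"
  shows "rsubst (to_fract p / to_fract q) r = peval p r / peval q r"
  using rsubst_quot peval_nonzero assms by blast

lemma rsubst_to_fract:
  assumes "r \<notin> range rconst"
  shows "rsubst (to_fract p) r = peval p r"
  using rsubst_quot'[OF assms, of 1 p] by simp

lemma rsubst_rconst [simp]: "rsubst (rconst c) r = rconst c"
  by (simp add: rsubst_def rconst_def peval_const[unfolded rconst_def])

lemma rsubst_0 [simp]: "rsubst 0 r = 0"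
  by (simp add: rsubst_def peval_0)

lemma rsubst_1 [simp]: "rsubst 1 r = 1"
  by (simp add: rsubst_def)

lemma rsubst_rX [simp]: "rsubst rX r = r"
  by (simp add: rsubst_def rX_def peval_linear)

lemma rsubst_ident: "rsubst f rX = f"
proof -
  obtain p q where f: "f = to_fract p / to_fract q" "q \<noteq> 0" by (rule ratfun_cases)
  then show ?thesis by (simp add: rsubst_quot peval_rX)
qed

lemma rsubst_mult:
  assumes "r \<notin> range rconst"
  shows "rsubst (f * g) r = rsubst f r * rsubst g r"
proof -
  obtain p q where f: "f = to_fract p / to_fract q" "q \<noteq> 0" by (rule ratfun_cases)
  obtain p' q' where g: "g = to_fract p' / to_fract q'" "q' \<noteq> 0" by (rule ratfun_cases)
  have fg: "f * g = to_fract (p * p') / to_fract (q * q')" using f g by simp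
  have "rsubst (f * g) r = peval (p * p') r / peval (q * q') r"
    unfolding fg using f g assms by (intro rsubst_quot') auto
  then show ?thesis using f g assms by (simp add: rsubst_quot' peval_mult)
qed

lemma rsubst_add:
  assumes "r \<notin> range rconst"
  shows "rsubst (f + g) r = rsubst f r + rsubst g r"
proof -
  obtain p q where f: "f = to_fract p / to_fract q" "q \<noteq> 0" by (rule ratfun_cases)
  obtain p' q' where g: "g = to_fract p' / to_fract q'" "q' \<noteq> 0" by (rule ratfun_cases)
  have fg: "f + g = to_fract (p * q' + p' * q) / to_fract (q * q')" using f g
    by (simp add: field_simps)
  have "rsubst (f + g) r = peval (p * q' + p' * q) r / peval (q * q') r"
    unfolding fg using f g assms by (intro rsubst_quot') auto
  also have "\<dots> = peval p r / peval q r + peval p' r / peval q' r"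
    using f g peval_nonzero[OF assms] by (simp add: peval_mult peval_add add_divide_distrib)
  finally show ?thesis using f g assms by (simp add: rsubst_quot')
qed

lemma rsubst_uminus:
  assumes "r \<notin> range rconst"
  shows "rsubst (- f) r = - rsubst f r"
  using rsubst_mult[OF assms, of "rconst (-1)" f] rsubst_rconst[of "-1" r]
  by (simp add: rconst_hom' del: rsubst_rconst)

lemma rsubst_diff:
  assumes "r \<notin> range rconst"
  shows "rsubst (f - g) r = rsubst f r - rsubst g r"
  using rsubst_add[OF assms, of f "- g"] by (simp add: rsubst_uminus[OF assms])

lemma rsubst_eq_0_iff:
  assumes "r \<notin> range rconst"
  shows "rsubst f r = 0 \<longleftrightarrow> f = 0"
proof -
  obtain p q where f: "f = to_fract p / to_fract q" "q \<noteq> 0" by (rule ratfun_cases)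
  then show ?thesis using peval_nonzero[OF assms] by (auto simp: rsubst_quot' assms peval_0)
qed

lemma rsubst_inverse:
  assumes "r \<notin> range rconst"
  shows "rsubst (inverse f) r = inverse (rsubst f r)"
proof (cases "f = 0")
  case False
  then have "rsubst f r * rsubst (inverse f) r = 1"
    using rsubst_mult[OF assms, of f "inverse f"] by simp
  then show ?thesis by (metis inverse_unique)
qed auto

lemma rsubst_divide:
  assumes "r \<notin> range rconst"
  shows "rsubst (f / g) r = rsubst f r / rsubst g r"
  by (simp add: divide_inverse rsubst_mult rsubst_inverse assms)

lemma rsubst_power:
  assumes "r \<notin> range rconst"
  shows "rsubst (f ^ k) r = rsubst f r ^ k"
  by (induction k) (auto simp: rsubst_mult assms)

lemma rsubst_powi:
  assumes "r \<notin> range rconst"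
  shows "rsubst (f powi k) r = rsubst f r powi k"
  by (simp add: power_int_def rsubst_power rsubst_inverse assms)

lemma rsubst_sum:
  assumes "r \<notin> range rconst"
  shows "rsubst (sum f A) r = (\<Sum>x\<in>A. rsubst (f x) r)"
  by (induction A rule: infinite_finite_induct) (auto simp: rsubst_add assms)

lemma rsubst_prod:
  assumes "r \<notin> range rconst"
  shows "rsubst (prod f A) r = (\<Prod>x\<in>A. rsubst (f x) r)"
  by (induction A rule: infinite_finite_induct) (auto simp: rsubst_mult assms)

lemmas rsubst_hom =
  rsubst_mult rsubst_add rsubst_uminus rsubst_diff rsubst_inverse rsubst_divide
  rsubst_power rsubst_powi rsubst_sum rsubst_prod

lemma rsubst_peval:
  assumes "s \<notin> range rconst"
  shows "rsubst (peval p r) s = peval p (rsubst r s)"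
  by (induction p) (auto simp: peval_0 peval_pCons rsubst_hom assms)

lemma rsubst_nonconst:
  assumes "r \<notin> range rconst" "s \<notin> range rconst"
  shows "rsubst r s \<notin> range rconst"
proof
  assume "rsubst r s \<in> range rconst"
  then obtain c where "rsubst (r - rconst c) s = 0"
    using rsubst_diff[OF assms(2)] by auto
  then show False using rsubst_eq_0_iff[OF assms(2)] assms(1) by auto
qed

lemma rsubst_rsubst:
  assumes "r \<notin> range rconst" "s \<notin> range rconst"
  shows "rsubst (rsubst f r) s = rsubst f (rsubst r s)"
proof -
  obtain p q where f: "f = to_fract p / to_fract q" "q \<noteq> 0" by (rule ratfun_cases)
  then show ?thesis
    using rsubst_nonconst[OF assms] assms
    by (simp add: rsubst_quot' rsubst_hom rsubst_peval rsubst_to_fract)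
qed

subsection \<open>The Euler derivation\<close>

lemma rderiv_to_fract: "rderiv (to_fract p) = to_fract (pderiv p)"
  using rderiv_quot[of 1 p] by simp

lemma rderiv_add: "rderiv (f + g) = rderiv f + rderiv g"
proof -
  obtain p q where f: "f = to_fract p / to_fract q" "q \<noteq> 0" by (rule ratfun_cases)
  obtain p' q' where g: "g = to_fract p' / to_fract q'" "q' \<noteq> 0" by (rule ratfun_cases)
  have fg: "f + g = to_fract (p * q' + p' * q) / to_fract (q * q')" using f g
    by (simp add: field_simps)
  have nz: "q * q' \<noteq> 0" using f g by simp
  show ?thesis
    unfolding fg rderiv_quot[OF nz] unfolding f(1) g(1) rderiv_quot[OF f(2)] rderiv_quot[OF g(2)]
    using f(2) g(2)
    by (simp add: pderiv_add pderiv_mult divide_simps power2_eq_square) (simp add: algebra_simps)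
qed

lemma rderiv_mult: "rderiv (f * g) = rderiv f * g + f * rderiv g"
proof -
  obtain p q where f: "f = to_fract p / to_fract q" "q \<noteq> 0" by (rule ratfun_cases)
  obtain p' q' where g: "g = to_fract p' / to_fract q'" "q' \<noteq> 0" by (rule ratfun_cases)
  have fg: "f * g = to_fract (p * p') / to_fract (q * q')" using f g by simp
  have nz: "q * q' \<noteq> 0" using f g by simp
  show ?thesis
    unfolding fg rderiv_quot[OF nz] unfolding f(1) g(1) rderiv_quot[OF f(2)] rderiv_quot[OF g(2)]
    using f(2) g(2)
    by (simp add: pderiv_add pderiv_mult divide_simps power2_eq_square) (simp add: algebra_simps)
qed

lemma reuler_add: "reuler (f + g) = reuler f + reuler g"
  by (simp add: reuler_def rderiv_add algebra_simps)

lemma reuler_mult: "reuler (f * g) = reuler f * g + f * reuler g"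
  by (simp add: reuler_def rderiv_mult algebra_simps)

lemma reuler_rconst [simp]: "reuler (rconst c) = 0"
  by (simp add: reuler_def rconst_def rderiv_to_fract)

lemma reuler_0 [simp]: "reuler 0 = 0"
  using reuler_rconst[of 0] by simp

lemma reuler_1 [simp]: "reuler 1 = 0"
  using reuler_rconst[of 1] by simp

lemma reuler_rX [simp]: "reuler rX = rX"
  by (simp add: reuler_def rX_def rderiv_to_fract pderiv_pCons flip: one_pCons)

lemma reuler_uminus: "reuler (- f) = - reuler f"
  using reuler_mult[of "rconst (-1)" f] reuler_rconst[of "-1"]
  by (simp add: rconst_hom' del: reuler_rconst)

lemma reuler_diff: "reuler (f - g) = reuler f - reuler g"
  using reuler_add[of f "- g"] by (simp add: reuler_uminus)

lemma reuler_rconst_mult: "reuler (rconst c * f) = rconst c * reuler f"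
  by (simp add: reuler_mult)

lemma reuler_to_fract: "reuler (to_fract p) = to_fract ([:0,1:] * pderiv p)"
  by (simp only: reuler_def rderiv_to_fract rX_def to_fract_mult)

lemma reuler_divide:
  assumes "g \<noteq> 0"
  shows "reuler (f / g) = (reuler f * g - f * reuler g) / g\<^sup>2"
proof -
  have "reuler f = reuler (f / g * g)" using assms by simp
  also have "\<dots> = reuler (f / g) * g + f / g * reuler g" by (rule reuler_mult)
  finally show ?thesis using assms by (simp add: field_simps power2_eq_square)
qed

lemma reuler_peval:
  assumes "reuler r = rconst c * r"
  shows "reuler (peval p r) = rconst c * r * peval (pderiv p) r"
  by (induction p)
    (auto simp: peval_0 peval_pCons pderiv_pCons peval_add reuler_add reuler_mult assms algebra_simps)

text \<open>The chain rule for \<open>t d/dt\<close>. The condition on \<open>r\<close> says that \<open>r\<close> is a monomial \<open>b t^c\<close>, the only kind of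
  substitution that occurs below.\<close>

lemma reuler_rsubst:
  assumes r: "r \<notin> range rconst" and c: "reuler r = rconst c * r"
  shows "reuler (rsubst f r) = rconst c * rsubst (reuler f) r"
proof -
  obtain p q where f: "f = to_fract p / to_fract q" "q \<noteq> 0" by (rule ratfun_cases)
  have q: "to_fract q \<noteq> 0" using f by simp
  have *: "rsubst f r = peval p r / peval q r" using f r by (simp add: rsubst_quot')
  have q': "peval q r \<noteq> 0" using peval_nonzero f r by blast
  have **: "reuler f = (reuler (to_fract p) * to_fract q - to_fract p * reuler (to_fract q)) / (to_fract q)\<^sup>2"
    unfolding f by (rule reuler_divide[OF q])
  have "rsubst (reuler f) r =
     (r * peval (pderiv p) r * peval q r - peval p r * (r * peval (pderiv q) r)) / (peval q r)\<^sup>2"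
    unfolding ** reuler_to_fract
    by (simp only: rsubst_hom[OF r] rsubst_to_fract[OF r] peval_mult peval_linear) simp
  then have "rconst c * rsubst (reuler f) r =
     rconst c * ((r * peval (pderiv p) r * peval q r - peval p r * (r * peval (pderiv q) r)) / (peval q r)\<^sup>2)"
    by simp
  also have "\<dots> = reuler (rsubst f r)"
    unfolding * reuler_divide[OF q'] reuler_peval[OF c] by (simp add: algebra_simps)
  finally show ?thesis by simp
qed

subsection \<open>Logarithmic derivatives\<close>

definition logder :: "ratfun \<Rightarrow> ratfun" where
  "logder u = reuler u / u"

lemma logder_mult: "u \<noteq> 0 \<Longrightarrow> v \<noteq> 0 \<Longrightarrow> logder (u * v) = logder u + logder v"
  by (simp add: logder_def reuler_mult field_simps)

lemma logder_rconst [simp]: "logder (rconst c) = 0"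
  by (simp add: logder_def)

lemma logder_1 [simp]: "logder 1 = 0"
  by (simp add: logder_def)

lemma rX_nonzero [simp]: "rX \<noteq> 0"
  by (simp add: rX_def)

lemma rX_minus_nonzero [simp]: "rX - rconst p \<noteq> 0"
  by (simp add: rX_def rconst_def flip: to_fract_diff)

lemma rX_minus: "rX - rconst p = to_fract [:-p, 1:]"
  by (simp add: rX_def rconst_def flip: to_fract_diff)

lemma logder_rX [simp]: "logder rX = 1"
  by (simp add: logder_def)

lemma logder_rX_minus: "logder (rX - rconst p) = rX / (rX - rconst p)"
  by (simp add: logder_def reuler_diff)

lemma logder_inverse:
  "logder (inverse u) = - logder u"
proof (cases "u = 0")
  case False
  then show ?thesis using logder_mult[of u "inverse u"] by (simp add: eq_neg_iff_add_eq_0 add.commute)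
qed (simp add: logder_def)

lemma logder_power: "u \<noteq> 0 \<Longrightarrow> logder (u ^ k) = of_nat k * logder u"
  by (induction k) (auto simp: logder_mult algebra_simps)

lemma logder_powi: "u \<noteq> 0 \<Longrightarrow> logder (u powi k) = of_int k * logder u"
  by (simp add: power_int_def logder_power logder_inverse)

lemma logder_prod:
  assumes "finite A" "\<And>x. x \<in> A \<Longrightarrow> f x \<noteq> 0"
  shows "logder (\<Prod>x\<in>A. f x) = (\<Sum>x\<in>A. logder (f x))"
  using assms by (induction A rule: finite_induct) (auto simp: logder_mult)

subsection \<open>Monomial substitutions\<close>

lemma rX_neq_rconst [simp]: "rX \<noteq> rconst c"
  using rX_minus_nonzero[of c] by auto

lemma reuler_powi_rX: "reuler (rX powi k) = of_int k * rX powi k"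
  using logder_powi[of rX k] by (simp add: logder_def field_simps)

lemma reuler_monomial: "reuler (rconst a * rX powi n) = rconst (of_int n) * (rconst a * rX powi n)"
  by (simp add: reuler_rconst_mult reuler_powi_rX rconst_of_int)

text \<open>A constant is killed by the Euler derivation, which multiplies \<open>a t^n\<close> by \<open>n\<close>.\<close>

lemma monomial_nonconst:
  assumes "a \<noteq> 0" "n \<noteq> 0"
  shows "rconst a * rX powi n \<notin> range rconst"
proof
  assume "rconst a * rX powi n \<in> range rconst"
  then have "reuler (rconst a * rX powi n) = 0" by auto
  then show False unfolding reuler_monomial using assms by simp
qed

section \<open>Rational functions with prescribed poles\<close>

lemma
  shows laurent_adjoin_const [simp]: "rconst c \<in> laurent_adjoin P"
    and laurent_adjoin_add: "f \<in> laurent_adjoin P \<Longrightarrow> g \<in> laurent_adjoin P \<Longrightarrow> f + g \<in> laurent_adjoin P"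
    and laurent_adjoin_mult: "f \<in> laurent_adjoin P \<Longrightarrow> g \<in> laurent_adjoin P \<Longrightarrow> f * g \<in> laurent_adjoin P"
    and laurent_adjoin_rX [simp]: "rX \<in> laurent_adjoin P"
    and laurent_adjoin_inverse_rX [simp]: "inverse rX \<in> laurent_adjoin P"
    and laurent_adjoin_inverse_minus: "z \<in> P \<Longrightarrow> inverse (rX - rconst z) \<in> laurent_adjoin P"
  unfolding laurent_adjoin_def by (blast intro: subalgebra_gen.intros)+

lemma laurent_adjoin_1 [simp]: "1 \<in> laurent_adjoin P"
  using laurent_adjoin_const[of 1 P] by simp

lemma laurent_adjoin_0 [simp]: "0 \<in> laurent_adjoin P"
  using laurent_adjoin_const[of 0 P] by simp

lemma laurent_adjoin_uminus: "f \<in> laurent_adjoin P \<Longrightarrow> - f \<in> laurent_adjoin P"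
  using laurent_adjoin_mult[OF laurent_adjoin_const[of "-1"], of f P] by (simp add: rconst_hom')

lemma laurent_adjoin_diff: "f \<in> laurent_adjoin P \<Longrightarrow> g \<in> laurent_adjoin P \<Longrightarrow> f - g \<in> laurent_adjoin P"
  using laurent_adjoin_add[of f P "- g"] laurent_adjoin_uminus[of g P] by simp

lemma laurent_adjoin_sum: "(\<And>x. x \<in> S \<Longrightarrow> f x \<in> laurent_adjoin P) \<Longrightarrow> sum f S \<in> laurent_adjoin P"
  by (induction S rule: infinite_finite_induct) (auto intro: laurent_adjoin_add)

lemma laurent_adjoin_prod: "(\<And>x. x \<in> S \<Longrightarrow> f x \<in> laurent_adjoin P) \<Longrightarrow> prod f S \<in> laurent_adjoin P"
  by (induction S rule: infinite_finite_induct) (auto intro: laurent_adjoin_mult)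

lemma laurent_adjoin_power: "f \<in> laurent_adjoin P \<Longrightarrow> f ^ k \<in> laurent_adjoin P"
  by (induction k) (auto intro: laurent_adjoin_mult)

lemma laurent_adjoin_rX_powi [simp]: "rX powi k \<in> laurent_adjoin P"
  by (simp add: power_int_def laurent_adjoin_power)

lemma laurent_adjoin_to_fract [simp]: "to_fract p \<in> laurent_adjoin P"
proof (induction p)
  case (pCons c p)
  have "to_fract (pCons c p) = rconst c + rX * to_fract p"
    using peval_pCons[of c p rX] by (simp add: peval_rX)
  then show ?case using pCons by (simp add: laurent_adjoin_add laurent_adjoin_mult)
qed simp

text \<open>Sums and products of fractions have the product of the denominators as a denominator, so no new
  pole can arise. Conversely the inverse of a denominator is, up to a constant, a product of the
  adjoined elements \<open>1/(t - z)\<close>.\<close>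

lemma laurent_adjoin_iff:
  "f \<in> laurent_adjoin P \<longleftrightarrow>
     (\<exists>p q. q \<noteq> 0 \<and> f = to_fract p / to_fract q \<and> (\<forall>z. poly q z = 0 \<longrightarrow> z = 0 \<or> z \<in> P))"
  (is "_ \<longleftrightarrow> ?R f")
proof
  have R: "?R f" if "q \<noteq> 0" "f = to_fract p / to_fract q" "\<forall>z. poly q z = 0 \<longrightarrow> z = 0 \<or> z \<in> P" for f p q
    using that by blast
  assume "f \<in> laurent_adjoin P"
  then show "?R f" unfolding laurent_adjoin_def
  proof induction
    case (const c)
    show ?case by (rule R[of 1 _ "[:c:]"]) (auto simp: rconst_def)
  next
    case (gen f)
    then consider "f = rX" | "f = inverse rX" | z where "z \<in> P" "f = inverse (rX - rconst z)"
      by blast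
    then show ?case
    proof cases
      case 1
      show ?thesis by (rule R[of 1 _ "[:0,1:]"]) (auto simp: 1 rX_def)
    next
      case 2
      show ?thesis by (rule R[of "[:0,1:]" _ 1]) (auto simp: 2 rX_def divide_inverse)
    next
      case 3
      show ?thesis by (rule R[of "[:-z,1:]" _ 1]) (use 3 in \<open>auto simp: rX_minus divide_inverse\<close>)
    qed
  next
    case (add f g)
    then obtain p q p' q' where *: "q \<noteq> 0" "f = to_fract p / to_fract q"
      "\<forall>z. poly q z = 0 \<longrightarrow> z = 0 \<or> z \<in> P" "q' \<noteq> 0" "g = to_fract p' / to_fract q'"
      "\<forall>z. poly q' z = 0 \<longrightarrow> z = 0 \<or> z \<in> P" by blast
    show ?case
      by (rule R[of "q * q'" _ "p * q' + p' * q"]) (use * in \<open>auto simp: add_divide_distrib\<close>)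
  next
    case (mult f g)
    then obtain p q p' q' where *: "q \<noteq> 0" "f = to_fract p / to_fract q"
      "\<forall>z. poly q z = 0 \<longrightarrow> z = 0 \<or> z \<in> P" "q' \<noteq> 0" "g = to_fract p' / to_fract q'"
      "\<forall>z. poly q' z = 0 \<longrightarrow> z = 0 \<or> z \<in> P" by blast
    show ?case
      by (rule R[of "q * q'" _ "p * p'"]) (use * in auto)
  qed
next
  assume "?R f"
  then obtain p q where *: "q \<noteq> 0" "f = to_fract p / to_fract q"
      "\<forall>z. poly q z = 0 \<longrightarrow> z = 0 \<or> z \<in> P" by blast
  obtain root where root: "\<And>r. peval q r = rconst (lead_coeff q) * (\<Prod>i<degree q. (r - rconst (root i)))"
    "\<And>i. i < degree q \<Longrightarrow> poly q (root i) = 0" using peval_split[of q] by metis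
  have "inverse (to_fract q) = rconst (inverse (lead_coeff q)) * (\<Prod>i<degree q. inverse (rX - rconst (root i)))"
    using root(1)[of rX] by (simp add: peval_rX rconst_inverse prod_inversef[unfolded o_def])
  also have "\<dots> \<in> laurent_adjoin P"
  proof (intro laurent_adjoin_mult laurent_adjoin_prod laurent_adjoin_const)
    fix i assume "i \<in> {..<degree q}"
    then have "root i = 0 \<or> root i \<in> P" using root(2) *(3) by auto
    then show "inverse (rX - rconst (root i)) \<in> laurent_adjoin P"
      using laurent_adjoin_inverse_minus by auto
  qed
  finally show "f \<in> laurent_adjoin P"
    using *(2) laurent_adjoin_mult by (auto simp: divide_inverse)
qed

text \<open>Compare with a fraction as in the previous lemma, cross-multiply, and evaluate at \<open>z\<close>.\<close>

lemma laurent_adjoin_pole: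
  assumes "to_fract p / to_fract q \<in> laurent_adjoin P" "q \<noteq> 0" "poly q z = 0" "poly p z \<noteq> 0"
  shows "z = 0 \<or> z \<in> P"
proof -
  obtain p' q' where *: "q' \<noteq> 0" "to_fract p / to_fract q = to_fract p' / to_fract q'"
      "\<forall>z. poly q' z = 0 \<longrightarrow> z = 0 \<or> z \<in> P" using assms(1) laurent_adjoin_iff by blast
  then have "to_fract (p * q') = to_fract (p' * q)" using assms(2) by (simp add: frac_eq_eq)
  then have "p * q' = p' * q" by (simp only: to_fract_eq_iff)
  then have "poly (p * q') z = poly (p' * q) z" by simp
  then show ?thesis using assms * by simp
qed

lemma laurent_adjoin_reuler:
  assumes "f \<in> laurent_adjoin P"
  shows "reuler f \<in> laurent_adjoin P"
proof -
  obtain p q where *: "q \<noteq> 0" "f = to_fract p / to_fract q"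
      "\<forall>z. poly q z = 0 \<longrightarrow> z = 0 \<or> z \<in> P" using assms laurent_adjoin_iff by blast
  have "rderiv f \<in> laurent_adjoin P"
    unfolding laurent_adjoin_iff *(2) rderiv_quot[OF *(1)]
    by (rule exI[of _ "pderiv p * q - p * pderiv q"], rule exI[of _ "q\<^sup>2"]) (use * in auto)
  then show ?thesis by (simp add: reuler_def laurent_adjoin_mult)
qed

lemma A_space_self: "\<alpha> \<in> A_space \<alpha>"
proof -
  obtain p q where *: "\<alpha> = to_fract p / to_fract q" "q \<noteq> 0" "q = snd (quot_of_fract \<alpha>)"
    by (rule ratfun_cases)
  show ?thesis unfolding A_space_def laurent_adjoin_iff
    by (rule exI[of _ p], rule exI[of _ q]) (use * in \<open>auto simp: nonzero_poles_def\<close>)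
qed

lemma finite_nonzero_poles: "finite (nonzero_poles \<alpha>)"
  by (rule finite_subset[OF _ poly_roots_finite[of "snd (quot_of_fract \<alpha>)"]])
    (auto simp: nonzero_poles_def)

lemma zero_not_in_nonzero_poles: "0 \<notin> nonzero_poles \<alpha>"
  by (simp add: nonzero_poles_def)

lemma coprime_poly_root:
  fixes p q :: "complex poly"
  assumes "coprime p q" "poly q z = 0"
  shows "poly p z \<noteq> 0"
proof
  assume "poly p z = 0"
  then have "[:-z, 1:] dvd p" "[:-z, 1:] dvd q" using assms by (simp_all add: poly_eq_0_iff_dvd)
  then have "is_unit [:-z, 1:]" using assms(1) coprime_common_divisor by blast
  then show False by (simp add: is_unit_iff_degree)
qed

text \<open>Without adjoined poles the denominator in lowest terms can only vanish at 0, hence is a monomial.\<close>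

lemma laurent_polynomial_quotient:
  assumes "f \<in> laurent_adjoin {}"
  obtains p d k where "f = to_fract p / to_fract (monom d k)" "d \<noteq> 0" "coprime p (monom d k)"
proof -
  obtain p q where pq: "f = to_fract p / to_fract q" "q \<noteq> 0" "coprime p q" by (rule ratfun_cases)
  have rq: "z = 0" if "poly q z = 0" for z
    using laurent_adjoin_pole[of p q "{}" z] assms pq that coprime_poly_root by auto
  have "{z. poly q z = 0} \<subseteq> {0}" using rq by blast
  then have "smult (lead_coeff q) (\<Prod>z\<in>{0}. [:-z, 1:] ^ order z q) =
      smult (lead_coeff q) (\<Prod>z|poly q z = 0. [:-z, 1:] ^ order z q)"
    by (intro arg_cong[of _ _ "smult _"] prod.mono_neutral_right) (auto simp: order_0I)
  also have "\<dots> = q" by (rule complex_poly_decompose)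
  finally have "q = monom (lead_coeff q) (order 0 q)" by (simp add: monom_altdef)
  then show ?thesis using that[of p "lead_coeff q" "order 0 q"] pq by simp
qed

lemma to_fract_monom: "to_fract (monom c k) = rconst c * rX ^ k"
  using peval_rX[of "monom c k"]
  by (simp add: peval_smult peval_power peval_linear monom_altdef peval_rX[symmetric])

lemma peval_to_fract: "peval p (to_fract g) = to_fract (pcompose p g)"
  by (induction p) (auto simp: peval_0 peval_pCons pcompose_pCons rconst_def)

subsection \<open>Units\<close>

text \<open>If \<open>u\<close> had a zero outside the permitted poles, then the logarithmic derivative of \<open>u\<close> would have
  a simple pole there.\<close>

lemma laurent_adjoin_unit_of_logder:
  assumes u: "u \<in> laurent_adjoin P" "u \<noteq> 0" and w: "logder u \<in> laurent_adjoin P"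
  shows "inverse u \<in> laurent_adjoin P"
proof -
  obtain p q where f: "u = to_fract p / to_fract q" "q \<noteq> 0" "coprime p q" by (rule ratfun_cases)
  obtain r s where rs: "s \<noteq> 0" "logder u = to_fract r / to_fract s"
      "\<forall>z. poly s z = 0 \<longrightarrow> z = 0 \<or> z \<in> P" using w laurent_adjoin_iff by blast
  have p0: "p \<noteq> 0" using f u by auto
  have "logder u = rX * (to_fract (pderiv p) * to_fract q - to_fract p * to_fract (pderiv q)) / (to_fract p * to_fract q)"
    unfolding f logder_def reuler_def rderiv_quot[OF f(2)] using p0 f(2) by (simp add: power2_eq_square)
  then have "rX * (to_fract (pderiv p) * to_fract q - to_fract p * to_fract (pderiv q)) * to_fract s
     = to_fract r * (to_fract p * to_fract q)"
    using p0 f(2) rs(1,2) by (simp add: field_simps)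
  then have "to_fract ([:0,1:] * (pderiv p * q - p * pderiv q) * s) = to_fract (r * (p * q))"
    by (simp only: to_fract_mult to_fract_diff rX_def)
  moreover define X :: "complex poly" where "X = [:0,1:]"
  ultimately have eq: "X * (pderiv p * q - p * pderiv q) * s = r * (p * q)"
    by (simp only: to_fract_eq_iff)
  show ?thesis unfolding laurent_adjoin_iff
  proof (intro exI conjI allI impI)
    show "p \<noteq> 0" by fact
    show "inverse u = to_fract q / to_fract p" using f by simp
    fix z assume z: "poly p z = 0"
    show "z = 0 \<or> z \<in> P"
    proof (rule ccontr)
      assume nz: "\<not> (z = 0 \<or> z \<in> P)"
      \<comment> \<open>With \<open>u = p/q\<close>, the \<open>k\<close>-th power of \<open>X - z\<close> divides every term of the cleared equation except
        the one with \<open>pderiv p\<close>, whose order is only \<open>k - 1\<close>.\<close>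
      define k where "k = order z p"
      have k: "k = Suc (order z (pderiv p))" using order_pderiv[OF p0 z] by (simp add: k_def)
      have "[:-z, 1:] ^ k dvd p" by (simp add: k_def order_1)
      moreover have "pderiv p * (X * q * s) = p * (X * pderiv q * s + r * q)"
        using eq by (simp add: algebra_simps)
      ultimately have *: "[:-z, 1:] ^ k dvd pderiv p * (X * q * s)" by simp
      have "poly q z \<noteq> 0" using coprime_poly_root[of q p z] f(3) z by (simp add: coprime_commute)
      then have "poly (X * q * s) z \<noteq> 0" using nz rs(3)[rule_format, of z] by (auto simp: X_def)
      then have o: "order z (X * q * s) = 0" by (rule order_0I)
      have "pderiv p \<noteq> 0"
      proof
        assume "pderiv p = 0"
        then have "degree p = 0" by (simp add: pderiv_eq_0_iff)
        then show False using z p0 by (auto elim!: degree_eq_zeroE)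
      qed
      then have "pderiv p * (X * q * s) \<noteq> 0" using f rs by (simp add: X_def)
      then have "k \<le> order z (pderiv p)" using * o by (simp add: order_divides order_mult)
      then show False using k by simp
    qed
  qed
qed

lemma to_fract_factorization:
  assumes "p \<noteq> 0" "finite S" "\<And>z. poly p z = 0 \<Longrightarrow> z \<in> S"
  shows "to_fract p = rconst (lead_coeff p) * (\<Prod>z\<in>S. (rX - rconst z) ^ order z p)"
proof -
  have "p = smult (lead_coeff p) (\<Prod>z|poly p z = 0. [:-z, 1:] ^ order z p)"
    by (simp add: complex_poly_decompose)
  also have "(\<Prod>z|poly p z = 0. [:-z, 1:] ^ order z p) = (\<Prod>z\<in>S. [:-z, 1:] ^ order z p)"
    using assms by (intro prod.mono_neutral_left) (auto simp: order_0I)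
  finally have "to_fract p = peval (smult (lead_coeff p) (\<Prod>z\<in>S. [:-z, 1:] ^ order z p)) rX"
    by (simp only: peval_rX)
  also have "\<dots> = rconst (lead_coeff p) * (\<Prod>z\<in>S. (rX - rconst z) ^ order z p)"
    by (simp only: peval_smult peval_prod peval_power) (simp only: peval_rX rX_minus)
  finally show ?thesis .
qed

text \<open>The numerator and the denominator of a unit have all their roots in \<open>P\<close> or at 0.\<close>

lemma laurent_adjoin_unit_factorization:
  assumes u: "u \<in> laurent_adjoin P" "inverse u \<in> laurent_adjoin P" "u \<noteq> 0"
    and P: "finite P" "0 \<notin> P"
  obtains c e m where "c \<noteq> 0" "u = rconst c * rX powi e * (\<Prod>z\<in>P. (rX - rconst z) powi m z)"
proof -
  obtain p q where f: "u = to_fract p / to_fract q" "q \<noteq> 0" "coprime p q" by (rule ratfun_cases)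
  have p0: "p \<noteq> 0" using f u by auto
  have rq: "z \<in> insert 0 P" if "poly q z = 0" for z
    using laurent_adjoin_pole[of p q P z] u(1) f that coprime_poly_root by auto
  have "inverse u = to_fract q / to_fract p" using f by simp
  then have rp: "z \<in> insert 0 P" if "poly p z = 0" for z
    using laurent_adjoin_pole[of q p P z] u(2) f that coprime_poly_root p0 coprime_commute by auto
  define c where "c = lead_coeff p / lead_coeff q"
  define m where "m z = int (order z p) - int (order z q)" for z
  have "u = rconst c * (\<Prod>z\<in>insert 0 P. (rX - rconst z) powi m z)"
  proof -
    have "to_fract p = rconst (lead_coeff p) * (\<Prod>z\<in>insert 0 P. (rX - rconst z) ^ order z p)"
      by (rule to_fract_factorization) (use p0 P rp in auto)
    moreover have "to_fract q = rconst (lead_coeff q) * (\<Prod>z\<in>insert 0 P. (rX - rconst z) ^ order z q)"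
      by (rule to_fract_factorization) (use f P rq in auto)
    moreover have "(rX - rconst z) powi m z = (rX - rconst z) ^ order z p / (rX - rconst z) ^ order z q" for z
      by (simp add: m_def power_int_diff)
    ultimately show ?thesis
      unfolding f(1) c_def rconst_divide by (simp only: prod_dividef times_divide_times_eq)
  qed
  also have "\<dots> = rconst c * rX powi m 0 * (\<Prod>z\<in>P. (rX - rconst z) powi m z)"
    using P by (simp add: mult.assoc)
  finally show ?thesis using that[of c "m 0" m] p0 f by (simp add: c_def)
qed

subsection \<open>Partial fractions\<close>

text \<open>Solving the relation for one term exhibits \<open>t/(t - z)\<close>, which has a pole at \<open>z\<close>, as an element
  of the algebra in which only the remaining poles are permitted.\<close>

lemma partial_fractions_independent:
  assumes P: "finite P" "0 \<notin> P"
    and eq: "rconst e + (\<Sum>z\<in>P. rconst (c z) * (rX / (rX - rconst z))) = 0"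
  shows "\<And>z. z \<in> P \<Longrightarrow> c z = 0" and "e = 0"
proof -
  show cz: "c z = 0" if z: "z \<in> P" for z
  proof (rule ccontr)
    assume nz: "c z \<noteq> 0"
    let ?S = "\<Sum>y\<in>P-{z}. rconst (c y) * (rX / (rX - rconst y))"
    have "rconst (c z) * (rX / (rX - rconst z)) = - rconst e - ?S"
      using eq sum.remove[OF P(1) z, of "\<lambda>z. rconst (c z) * (rX / (rX - rconst z))"]
      by (simp add: algebra_simps eq_neg_iff_add_eq_0)
    then have "rconst (inverse (c z)) * (rconst (c z) * (rX / (rX - rconst z)))
        = rconst (inverse (c z)) * (- rconst e - ?S)" by simp
    moreover have "rconst (inverse (c z)) * (rconst (c z) * x) = x" for x
      using nz by (simp add: rconst_inverse)
    ultimately have "to_fract [:0,1:] / to_fract [:-z,1:] = rconst (inverse (c z)) * (- rconst e - ?S)"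
      by (simp only: rX_minus[symmetric] rX_def[symmetric])
    also have "\<dots> \<in> laurent_adjoin (P - {z})"
      by (intro laurent_adjoin_mult laurent_adjoin_diff laurent_adjoin_uminus laurent_adjoin_sum
          laurent_adjoin_const) (auto simp: divide_inverse intro!: laurent_adjoin_mult laurent_adjoin_inverse_minus)
    finally have "z = 0 \<or> z \<in> P - {z}"
      by (rule laurent_adjoin_pole) (use z P in auto)
    then show False using z P by auto
  qed
  then show "e = 0" using eq by simp
qed

section \<open>The Virasoro algebra\<close>

lemma lookup_vir_scale [simp]:
  "Poly_Mapping.lookup (vir_scale c x) b = c * Poly_Mapping.lookup x b"
  by (simp add: Poly_Mapping.map.rep_eq when_def)

lemma vir_scale_single [simp]:
  "vir_scale c (Poly_Mapping.single b x) = Poly_Mapping.single b (c * x)"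
  by (simp add: map_single)

lemma vector_space_vir_scale: "vector_space vir_scale"
  by unfold_locales (auto intro!: poly_mapping_eqI simp: lookup_add algebra_simps)

lemma vector_space_rscale: "vector_space rscale"
  by unfold_locales (auto simp: rscale_def rconst_hom algebra_simps)

interpretation vir: vector_space vir_scale
  by (rule vector_space_vir_scale)

interpretation rat: vector_space rscale
  by (rule vector_space_rscale)

context
  fixes s :: "complex \<Rightarrow> 'v::ab_group_add \<Rightarrow> 'v"
  assumes s: "vector_space s"
begin

interpretation vector_space s by (rule s)

lemma vir_extend_superset:
  assumes "finite K" "Poly_Mapping.keys x \<subseteq> K"
  shows "vir_extend s g x = (\<Sum>b\<in>K. s (Poly_Mapping.lookup x b) (g b))"
  unfolding vir_extend_def
  by (rule sum.mono_neutral_left) (use assms in \<open>auto simp: in_keys_iff\<close>)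

lemma vir_extend_add: "vir_extend s g (x + y) = vir_extend s g x + vir_extend s g y"
proof -
  let ?K = "Poly_Mapping.keys x \<union> Poly_Mapping.keys y"
  have "Poly_Mapping.keys (x + y) \<subseteq> ?K" by (rule Poly_Mapping.keys_add)
  then show ?thesis
    using vir_extend_superset[of ?K x g] vir_extend_superset[of ?K y g]
      vir_extend_superset[of ?K "x + y" g]
    by (simp add: lookup_add scale_left_distrib sum.distrib)
qed

lemma vir_extend_scale: "vir_extend s g (vir_scale c x) = s c (vir_extend s g x)"
proof -
  have "Poly_Mapping.keys (vir_scale c x) \<subseteq> Poly_Mapping.keys x" by (auto simp: in_keys_iff)
  then show ?thesis
    using vir_extend_superset[of "Poly_Mapping.keys x" "vir_scale c x" g]
    by (simp add: vir_extend_def scale_sum_right)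
qed

lemma vir_extend_single: "vir_extend s g (Poly_Mapping.single b c) = s c (g b)"
  using vir_extend_superset[of "{b}" "Poly_Mapping.single b c" g] by (simp add: lookup_single)

lemma vir_extend_fun_add: "vir_extend s (\<lambda>b. f b + g b) x = vir_extend s f x + vir_extend s g x"
  by (simp add: vir_extend_def scale_right_distrib sum.distrib)

lemma vir_extend_fun_scale: "vir_extend s (\<lambda>b. s c (f b)) x = s c (vir_extend s f x)"
  by (simp add: vir_extend_def scale_sum_right mult.commute)

end

text \<open>Multilinear identities on the Virasoro algebra need to be checked on basis vectors only.\<close>

lemma vir_induct [case_names add scale L C]:
  assumes add: "\<And>x y. P x \<Longrightarrow> P y \<Longrightarrow> P (x + y)"
    and scale: "\<And>c x. P x \<Longrightarrow> P (vir_scale c x)"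
    and L: "\<And>i. P (vir_L i)" and C: "P vir_C"
  shows "P x"
proof -
  have basis: "P (Poly_Mapping.single b c)" for b c
  proof -
    have "P (Poly_Mapping.single b 1)" using L C by (cases b) auto
    then have "P (vir_scale c (Poly_Mapping.single b 1))" by (rule scale)
    then show ?thesis by simp
  qed
  have "P 0" using basis[of C 0] by simp
  then have "P (\<Sum>b\<in>K. Poly_Mapping.single b (Poly_Mapping.lookup x b))" for K
    by (induction K rule: infinite_finite_induct) (auto intro: basis add)
  moreover have "(\<Sum>b\<in>Poly_Mapping.keys x. Poly_Mapping.single b (Poly_Mapping.lookup x b)) = x"
    by (rule poly_mapping_eqI) (auto simp: lookup_sum lookup_single when_def in_keys_iff)
  ultimately show ?thesis by metis
qed

lemma vir_bracket_bilinear: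
  "vir_bracket (x + y) z = vir_bracket x z + vir_bracket y z"
  "vir_bracket z (x + y) = vir_bracket z x + vir_bracket z y"
  "vir_bracket (vir_scale c x) z = vir_scale c (vir_bracket x z)"
  "vir_bracket z (vir_scale c x) = vir_scale c (vir_bracket z x)"
  unfolding vir_bracket_def
  by (simp_all add: vir_extend_add[OF vector_space_vir_scale]
      vir_extend_scale[OF vector_space_vir_scale] vir_extend_fun_add[OF vector_space_vir_scale]
      vir_extend_fun_scale[OF vector_space_vir_scale])

lemma vir_bracket_zero [simp]: "vir_bracket 0 x = 0" "vir_bracket x 0 = 0"
  using vir_bracket_bilinear(1)[of 0 0 x] vir_bracket_bilinear(2)[of x 0 0] by auto

lemma vir_bracket_uminus: "vir_bracket (- x) y = - vir_bracket x y" "vir_bracket y (- x) = - vir_bracket y x"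
  using vir_bracket_bilinear(1)[of x "-x" y] vir_bracket_bilinear(2)[of y x "-x"]
  by (auto simp: eq_neg_iff_add_eq_0 add.commute)

lemma vir_bracket_diff:
  "vir_bracket (x - y) z = vir_bracket x z - vir_bracket y z"
  "vir_bracket z (x - y) = vir_bracket z x - vir_bracket z y"
  using vir_bracket_bilinear(1)[of x "-y" z] vir_bracket_bilinear(2)[of z x "-y"]
  by (auto simp: vir_bracket_uminus)

lemma vir_bracket_single:
  "vir_bracket (Poly_Mapping.single b x) (Poly_Mapping.single b' y) = vir_scale (x * y) (vir_bracket_basis b b')"
  by (simp add: vir_bracket_def vir_extend_single[OF vector_space_vir_scale])

lemma vir_bracket_LL:
  "vir_bracket (Poly_Mapping.single (L m) x) (Poly_Mapping.single (L k) y) =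
     Poly_Mapping.single (L (m + k)) (x * y * of_int (k - m)) +
     (if m + k = 0 then Poly_Mapping.single C (x * y * of_int (m ^ 3 - m) / 12) else 0)"
  by (auto simp: vir_bracket_single vir.scale_right_distrib add.commute eq_neg_iff_add_eq_0)

lemma vir_bracket_C [simp]:
  "vir_bracket (Poly_Mapping.single C x) y = 0"
  "vir_bracket y (Poly_Mapping.single C x) = 0"
proof -
  show "vir_bracket (Poly_Mapping.single C x) y = 0"
    by (induction y rule: vir_induct) (auto simp: vir_bracket_bilinear vir_bracket_single)
  show "vir_bracket y (Poly_Mapping.single C x) = 0"
    by (induction y rule: vir_induct) (auto simp: vir_bracket_bilinear vir_bracket_single)
qed

lemma vir_bracket_antisym: "vir_bracket x y = - vir_bracket y x"
proof (induction x rule: vir_induct)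
  case (L i)
  show ?case
  proof (induction y rule: vir_induct)
    case (L j)
    have *: "j = - i" if "i + j = 0" using that by simp
    show ?case
      by (auto simp: vir_bracket_LL add.commute single_uminus[symmetric] algebra_simps
          simp flip: single_uminus single_add add_divide_distrib dest!: *)
  qed (auto simp: vir_bracket_bilinear vir.scale_minus_right)
qed (auto simp: vir_bracket_bilinear vir.scale_minus_right)

text \<open>The noncentral coefficients cancel identically. The central ones cancel because
  \<open>(k - j) (i\<^sup>3 - i) + (i - k) (j\<^sup>3 - j) + (j - i) (k\<^sup>3 - k)\<close> vanishes for \<open>i + j + k = 0\<close>.\<close>

lemma vir_jacobi_LLL:
  "vir_bracket (vir_L i) (vir_bracket (vir_L j) (vir_L k)) +
   vir_bracket (vir_L j) (vir_bracket (vir_L k) (vir_L i)) +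
   vir_bracket (vir_L k) (vir_bracket (vir_L i) (vir_L j)) = 0"
proof -
  have *: "vir_bracket (vir_L i) (vir_bracket (vir_L j) (vir_L k)) =
     Poly_Mapping.single (L (i + j + k)) (of_int ((k - j) * (j + k - i))) +
     Poly_Mapping.single C (if i + j + k = 0 then of_int ((k - j) * (i ^ 3 - i)) / 12 else 0)" for i j k
    by (auto simp: vir_bracket_LL vir_bracket_bilinear add.assoc)
  have perm: "j + k + i = i + j + k" "k + i + j = i + j + k" by simp_all
  have z: "(k - j) * (i ^ 3 - i) + (i - k) * (j ^ 3 - j) + (j - i) * (k ^ 3 - k) = 0"
    if "i + j + k = 0" for i j k :: int
  proof -
    have k: "k = - i - j" using that by simp
    show ?thesis unfolding k by (simp add: power3_eq_cube algebra_simps)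
  qed
  have C: "(if i + j + k = 0 then of_int ((k - j) * (i ^ 3 - i)) / 12 else 0) +
      (if i + j + k = 0 then of_int ((i - k) * (j ^ 3 - j)) / 12 else 0) +
      (if i + j + k = 0 then of_int ((j - i) * (k ^ 3 - k)) / 12 else 0) = (0::complex)"
  proof (cases "i + j + k = 0")
    case True
    from z[OF True] have "(of_int ((k - j) * (i ^ 3 - i) + (i - k) * (j ^ 3 - j) + (j - i) * (k ^ 3 - k)) :: complex) = of_int 0"
      by (rule arg_cong)
    then show ?thesis using True by (simp flip: add_divide_distrib)
  qed simp
  have L: "of_int ((k - j) * (j + k - i)) + of_int ((i - k) * (k + i - j)) +
      of_int ((j - i) * (i + j - k)) = (0::complex)"
    by (simp add: algebra_simps)
  show ?thesis
  proof (rule poly_mapping_eqI)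
    fix b
    show "Poly_Mapping.lookup (vir_bracket (vir_L i) (vir_bracket (vir_L j) (vir_L k)) +
   vir_bracket (vir_L j) (vir_bracket (vir_L k) (vir_L i)) +
   vir_bracket (vir_L k) (vir_bracket (vir_L i) (vir_L j))) b = Poly_Mapping.lookup 0 b"
      unfolding * perm using L C
      by (cases b) (auto simp: lookup_add lookup_single when_def)
  qed
qed

lemma vir_jacobi:
  "vir_bracket x (vir_bracket y z) + vir_bracket y (vir_bracket z x) + vir_bracket z (vir_bracket x y) = 0"
proof -
  have lin: "a + b + (c + d) + (e + f) = 0" if "a + c + e = 0" "b + d + f = 0" for a b c d e f :: vir
  proof -
    have "a + b + (c + d) + (e + f) = (a + c + e) + (b + d + f)" by (simp add: algebra_simps)
    then show ?thesis using that by simp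
  qed
  have sc: "vir_scale c a + vir_scale c b + vir_scale c e = 0" if "a + b + e = 0" for c a b e
    using that by (simp flip: vir.scale_right_distrib)
  show ?thesis
  proof (induction x rule: vir_induct)
    case (L i)
    show ?case
    proof (induction y rule: vir_induct)
      case (L j)
      show ?case
      proof (induction z rule: vir_induct)
        case (L k)
        show ?case by (rule vir_jacobi_LLL)
      qed (auto simp: vir_bracket_bilinear intro: lin sc)
    qed (auto simp: vir_bracket_bilinear intro: lin sc)
  qed (auto simp: vir_bracket_bilinear intro: lin sc)
qed

lemma lie_algebra_vir: "lie_algebra vir_scale vir_bracket"
proof (intro lie_algebra.intro vector_space_vir_scale lie_algebra_axioms.intro)
  fix x
  have "vir_bracket x x = - vir_bracket x x" by (rule vir_bracket_antisym)
  then have "Poly_Mapping.lookup (vir_bracket x x) b = - Poly_Mapping.lookup (vir_bracket x x) b" for b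
    by (metis lookup_uminus)
  then show "vir_bracket x x = 0" by (intro poly_mapping_eqI) simp
qed (simp_all add: vir_bracket_bilinear vir_jacobi)

subsection \<open>The endomorphism attached to the 1-differential operator\<close>

lemma vir_d_linear:
  "vir_d n a (x + y) = vir_d n a x + vir_d n a y"
  "vir_d n a (vir_scale c x) = vir_scale c (vir_d n a x)"
  by (simp_all add: vir_d_def vir_extend_add[OF vector_space_vir_scale]
      vir_extend_scale[OF vector_space_vir_scale])

text \<open>Adding the identity turns the equation of a 1-differential operator into multiplicativity:
  \<open>d\<close> is a 1-differential operator if and only if \<open>x \<mapsto> d x + x\<close> respects brackets. The same shift turns
  1-differential modules into maps that intertwine the action along this endomorphism.\<close>

definition vir_endo :: "int \<Rightarrow> complex \<Rightarrow> vir \<Rightarrow> vir" where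
  "vir_endo n a x = vir_d n a x + x"

lemma vir_endo_linear:
  "vir_endo n a (x + y) = vir_endo n a x + vir_endo n a y"
  "vir_endo n a (vir_scale c x) = vir_scale c (vir_endo n a x)"
  by (simp_all add: vir_endo_def vir_d_linear vir.scale_right_distrib)

lemma vir_endo_zero [simp]: "vir_endo n a 0 = 0"
  using vir_endo_linear(1)[of n a 0 0] by auto

lemma vir_endo_L:
  "vir_endo n a (Poly_Mapping.single (L i) x) =
     Poly_Mapping.single (L (n * i)) (x * a powi i / of_int n) -
     (if i = 0 then Poly_Mapping.single C (x * of_int (n\<^sup>2 - 1) / (24 * of_int n)) else 0)"
  by (auto simp: vir_endo_def vir_d_def vir_extend_single[OF vector_space_vir_scale]
      vir.scale_right_diff_distrib algebra_simps diff_divide_distrib)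

lemma vir_endo_C: "vir_endo n a (Poly_Mapping.single C x) = Poly_Mapping.single C (x * of_int n)"
  by (auto simp: vir_endo_def vir_d_def vir_extend_single[OF vector_space_vir_scale]
      vir.scale_right_diff_distrib algebra_simps)

text \<open>The central correction in the image of \<open>L\<^sub>0\<close> accounts exactly for the difference between
  \<open>(n i)\<^sup>3 - n i\<close> and the multiple \<open>n\<^sup>2 (i\<^sup>3 - i)\<close>.\<close>

lemma vir_endo_hom_LL:
  assumes n: "n \<noteq> 0" and a: "a \<noteq> 0"
  shows "vir_endo n a (vir_bracket (vir_L i) (vir_L j)) = vir_bracket (vir_endo n a (vir_L i)) (vir_endo n a (vir_L j))"
proof -
  have r: "vir_bracket (vir_endo n a (vir_L i)) (vir_endo n a (vir_L j)) =
     vir_bracket (Poly_Mapping.single (L (n * i)) (a powi i / of_int n)) (Poly_Mapping.single (L (n * j)) (a powi j / of_int n))"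
    by (simp add: vir_endo_L vir_bracket_diff)
  show ?thesis
  proof (cases "i + j = 0")
    case False
    then have "n * i + n * j \<noteq> 0" using n by (simp flip: distrib_left)
    then show ?thesis unfolding r using False n a
      by (simp add: vir_bracket_LL vir_endo_L power_int_add distrib_left)
        (rule arg_cong[of _ _ "Poly_Mapping.single _"], simp add: field_simps)
  next
    case True
    then have j: "j = - i" by simp
    have "a powi i * a powi - i = 1" using a by (simp add: power_int_minus)
    then have aa: "a powi i / of_int n * (a powi - i / of_int n) = 1 / (of_int n)\<^sup>2"
      by (simp add: power2_eq_square)
    show ?thesis
      unfolding r unfolding j using n a
      by (simp add: vir_bracket_LL vir_endo_L vir_endo_C vir_endo_linear aa del: times_divide_eq_left times_divide_eq_right)
        (auto intro!: poly_mapping_eqI simp: lookup_add lookup_minus lookup_single when_def field_simps power2_eq_square power3_eq_cube)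
  qed
qed

lemma vir_endo_hom:
  assumes "n \<noteq> 0" "a \<noteq> 0"
  shows "vir_endo n a (vir_bracket x y) = vir_bracket (vir_endo n a x) (vir_endo n a y)"
proof (induction x rule: vir_induct)
  case (L i)
  show ?case
  proof (induction y rule: vir_induct)
    case (L j)
    show ?case using assms by (rule vir_endo_hom_LL)
  qed (auto simp: vir_bracket_bilinear vir_endo_linear vir_endo_C)
qed (auto simp: vir_bracket_bilinear vir_endo_linear vir_endo_C)

lemma one_differential_operator_vir_d:
  assumes "n \<noteq> 0" "a \<noteq> 0"
  shows "one_differential_operator vir_scale vir_bracket (vir_d n a)"
  unfolding one_differential_operator_def linear_endo_on_def
proof (intro conjI allI ballI)
  fix x y
  show "vir_d n a (vir_bracket x y) = vir_bracket (vir_d n a x) y + vir_bracket x (vir_d n a y) +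
      vir_bracket (vir_d n a x) (vir_d n a y)"
    using vir_endo_hom[OF assms, of x y] unfolding vir_endo_def
    by (simp add: vir_bracket_bilinear algebra_simps)
qed (auto simp: vir_d_linear)

section \<open>The Virasoro module of a rational function\<close>

lemma A_act_linear_left:
  "A_act \<alpha> \<beta> (x + y) f = A_act \<alpha> \<beta> x f + A_act \<alpha> \<beta> y f"
  "A_act \<alpha> \<beta> (vir_scale c x) f = rscale c (A_act \<alpha> \<beta> x f)"
  by (simp_all add: A_act_def vir_extend_add[OF vector_space_rscale]
      vir_extend_scale[OF vector_space_rscale])

lemma A_act_single: "A_act \<alpha> \<beta> (Poly_Mapping.single b c) f = rscale c (A_act_basis \<alpha> \<beta> f b)"
  by (simp add: A_act_def vir_extend_single[OF vector_space_rscale])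

lemma A_act_0 [simp]: "A_act \<alpha> \<beta> 0 f = 0"
  by (simp add: A_act_def vir_extend_def)

lemma A_act_uminus: "A_act \<alpha> \<beta> (- x) f = - A_act \<alpha> \<beta> x f"
  using A_act_linear_left(1)[of \<alpha> \<beta> x "- x" f] by (simp add: eq_neg_iff_add_eq_0 add.commute)

lemma A_act_basis_linear:
  "A_act_basis \<alpha> \<beta> (f + g) b = A_act_basis \<alpha> \<beta> f b + A_act_basis \<alpha> \<beta> g b"
  "A_act_basis \<alpha> \<beta> (rscale c f) b = rscale c (A_act_basis \<alpha> \<beta> f b)"
  by (cases b; simp add: rscale_def reuler_add reuler_mult algebra_simps)+

lemma A_act_linear_right:
  "A_act \<alpha> \<beta> x (f + g) = A_act \<alpha> \<beta> x f + A_act \<alpha> \<beta> x g"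
  "A_act \<alpha> \<beta> x (rscale c f) = rscale c (A_act \<alpha> \<beta> x f)"
  unfolding A_act_def A_act_basis_linear
  by (rule vir_extend_fun_add[OF vector_space_rscale] vir_extend_fun_scale[OF vector_space_rscale])+

lemma A_act_basis_closed:
  assumes "f \<in> A_space \<alpha>"
  shows "A_act_basis \<alpha> \<beta> f b \<in> A_space \<alpha>"
  using assms A_space_self[of \<alpha>] unfolding A_space_def
  by (cases b) (auto intro!: laurent_adjoin_add laurent_adjoin_mult laurent_adjoin_reuler)

lemma rscale_closed: "f \<in> A_space \<alpha> \<Longrightarrow> rscale c f \<in> A_space \<alpha>"
  by (simp add: rscale_def A_space_def laurent_adjoin_mult)

lemma A_act_closed:
  assumes "f \<in> A_space \<alpha>"
  shows "A_act \<alpha> \<beta> x f \<in> A_space \<alpha>"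
  using A_act_basis_closed[OF assms] unfolding A_act_def vir_extend_def
  by (unfold A_space_def, intro laurent_adjoin_sum) (auto intro!: rscale_closed[unfolded A_space_def])

text \<open>Moving \<open>t^i\<close> to the left of the Euler derivation: with \<open>E = \<partial> + \<alpha>\<close> the operator \<open>L\<^sub>i\<close> becomes
  \<open>t^i (E + i (\<beta> + 1))\<close>.\<close>

lemma A_act_L:
  "A_act \<alpha> \<beta> (vir_L i) f = rX powi i * (reuler f + \<alpha> * f + rconst (of_int i * (\<beta> + 1)) * f)"
  by (simp add: A_act_single reuler_mult reuler_powi_rX rconst_of_int rconst_hom algebra_simps)

lemma A_act_C [simp]: "A_act \<alpha> \<beta> (Poly_Mapping.single C c) f = 0"
  by (simp add: A_act_single)

text \<open>The product of two such operators, as \<open>t^(i + j)\<close> times a quadratic polynomial in \<open>E\<close>.\<close>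

lemma A_act_L_L:
  "A_act \<alpha> \<beta> (vir_L i) (A_act \<alpha> \<beta> (vir_L j) f) =
     rX powi (i + j) * (reuler (reuler f + \<alpha> * f) + \<alpha> * (reuler f + \<alpha> * f)
       + rconst (of_int j + of_int (i + j) * (\<beta> + 1)) * (reuler f + \<alpha> * f)
       + rconst (of_int j * (\<beta> + 1) * (of_int j + of_int i * (\<beta> + 1))) * f)"
proof -
  define E where "E = reuler f + \<alpha> * f"
  define c where "c = of_int j * (\<beta> + 1)"
  have L: "A_act \<alpha> \<beta> (vir_L k) f = rX powi k * (E + rconst (of_int k * (\<beta> + 1)) * f)" for k
    by (simp add: A_act_L E_def)
  have Lg: "A_act \<alpha> \<beta> (vir_L i) (rX powi j * g) =
      rX powi (i + j) * (reuler g + \<alpha> * g + rconst (of_int j + of_int i * (\<beta> + 1)) * g)" for g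
    unfolding A_act_L
    by (simp add: reuler_mult reuler_powi_rX rconst_of_int rconst_hom power_int_add algebra_simps)
  show ?thesis
    unfolding L Lg E_def[symmetric] c_def[symmetric]
    by (simp add: reuler_add reuler_mult rconst_hom algebra_simps)
      (simp add: E_def c_def rconst_hom algebra_simps)
qed

lemma A_act_bracket_LL:
  "A_act \<alpha> \<beta> (vir_bracket (vir_L i) (vir_L j)) f =
     A_act \<alpha> \<beta> (vir_L i) (A_act \<alpha> \<beta> (vir_L j) f) - A_act \<alpha> \<beta> (vir_L j) (A_act \<alpha> \<beta> (vir_L i) f)"
proof -
  have "A_act \<alpha> \<beta> (vir_bracket (vir_L i) (vir_L j)) f =
     rconst (of_int (j - i)) * A_act \<alpha> \<beta> (vir_L (i + j)) f"
    by (simp add: vir_bracket_LL A_act_linear_left A_act_single rscale_def)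
  also have "\<dots> = A_act \<alpha> \<beta> (vir_L i) (A_act \<alpha> \<beta> (vir_L j) f) - A_act \<alpha> \<beta> (vir_L j) (A_act \<alpha> \<beta> (vir_L i) f)"
    unfolding A_act_L_L unfolding A_act_L
    by (simp add: add.commute[of j i] rconst_of_int rconst_hom rconst_hom' algebra_simps)
  finally show ?thesis .
qed

lemma A_act_bracket:
  "A_act \<alpha> \<beta> (vir_bracket x y) f = A_act \<alpha> \<beta> x (A_act \<alpha> \<beta> y f) - A_act \<alpha> \<beta> y (A_act \<alpha> \<beta> x f)"
proof -
  have z: "A_act \<alpha> \<beta> x 0 = 0" for x using A_act_linear_right(2)[of \<alpha> \<beta> x 0 0] by (simp add: rscale_def)
  show ?thesis
  proof (induction x rule: vir_induct)
    case (L i)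
    show ?case
    proof (induction y rule: vir_induct)
      case (L j)
      show ?case by (rule A_act_bracket_LL)
    qed (simp_all add: vir_bracket_bilinear A_act_linear_left A_act_linear_right z rat.scale_right_diff_distrib)
  qed (simp_all add: vir_bracket_bilinear A_act_linear_left A_act_linear_right z rat.scale_right_diff_distrib)
qed

lemma lie_module_A: "lie_module vir_scale vir_bracket rscale (A_space \<alpha>) (A_act \<alpha> \<beta>)"
proof (intro lie_module.intro lie_algebra_vir vector_space_rscale lie_module_axioms.intro)
  show "rat.subspace (A_space \<alpha>)"
    unfolding rat.subspace_def
    by (auto simp: rscale_closed) (auto simp: A_space_def laurent_adjoin_add)
qed (simp_all add: A_act_closed A_act_linear_left A_act_linear_right A_act_bracket)

section \<open>Reduction to a functional equation\<close>

lemma A_act_rconst_mult: "A_act \<alpha> \<beta> x (rconst c * f) = rconst c * A_act \<alpha> \<beta> x f"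
  using A_act_linear_right(2)[of \<alpha> \<beta> x c f] by (simp add: rscale_def)

lemma A_act_vir_endo_L:
  "A_act \<alpha> \<beta> (vir_endo n a (vir_L i)) f = rconst (a powi i / of_int n) * A_act \<alpha> \<beta> (vir_L (n * i)) f"
proof -
  have diff: "A_act \<alpha> \<beta> (x - y) f = A_act \<alpha> \<beta> x f - A_act \<alpha> \<beta> y f" for x y
    using A_act_linear_left(1)[of \<alpha> \<beta> x "- y" f] by (simp add: A_act_uminus)
  show ?thesis by (simp add: vir_endo_L diff A_act_single rscale_def)
qed

text \<open>With \<open>D f = \<delta> f + f\<close> the defining equation of a 1-differential module reads
  \<open>D (x f) = (d x + x) D f\<close>, which is linear in \<open>x\<close>. The central element acts by zero on both
  sides, so only the equations for the \<open>L\<^sub>i\<close> remain.\<close>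

lemma one_differential_module_iff:
  assumes "n \<noteq> 0" "a \<noteq> 0" and \<delta>: "linear_endo_on rscale (A_space \<alpha>) \<delta>"
  shows "one_differential_module vir_scale vir_bracket (vir_d n a) rscale (A_space \<alpha>) (A_act \<alpha> \<beta>) \<delta> \<longleftrightarrow>
    (\<forall>i. \<forall>f\<in>A_space \<alpha>. \<delta> (A_act \<alpha> \<beta> (vir_L i) f) + A_act \<alpha> \<beta> (vir_L i) f =
       rconst (a powi i / of_int n) * A_act \<alpha> \<beta> (vir_L (n * i)) (\<delta> f + f))"
    (is "?M \<longleftrightarrow> ?R")
proof -
  have key: "\<delta> (A_act \<alpha> \<beta> x f) = A_act \<alpha> \<beta> (vir_d n a x) f + A_act \<alpha> \<beta> x (\<delta> f) + A_act \<alpha> \<beta> (vir_d n a x) (\<delta> f)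
     \<longleftrightarrow> \<delta> (A_act \<alpha> \<beta> x f) + A_act \<alpha> \<beta> x f = A_act \<alpha> \<beta> (vir_endo n a x) (\<delta> f + f)" for x f
    by (auto simp: vir_endo_def A_act_linear_left A_act_linear_right algebra_simps)
  show ?thesis
  proof
    assume ?M
    then interpret one_differential_module vir_scale vir_bracket "vir_d n a" rscale "A_space \<alpha>" "A_act \<alpha> \<beta>" \<delta> .
    show ?R using \<delta>_act[unfolded key] by (auto simp: A_act_vir_endo_L)
  next
    assume R: ?R
    have z: "A_act \<alpha> \<beta> x 0 = 0" for x using A_act_rconst_mult[of \<alpha> \<beta> x 0 0] by simp
    have "\<delta> (A_act \<alpha> \<beta> x f) + A_act \<alpha> \<beta> x f = A_act \<alpha> \<beta> (vir_endo n a x) (\<delta> f + f)"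
      if f: "f \<in> A_space \<alpha>" for x f
    proof (induction x rule: vir_induct)
      case (add x y)
      have "\<delta> (A_act \<alpha> \<beta> x f + A_act \<alpha> \<beta> y f) = \<delta> (A_act \<alpha> \<beta> x f) + \<delta> (A_act \<alpha> \<beta> y f)"
        using \<delta> A_act_closed[OF f] by (simp add: linear_endo_on_def)
      then show ?case using add by (simp add: vir_endo_linear A_act_linear_left algebra_simps)
    next
      case (scale c x)
      have "\<delta> (rscale c (A_act \<alpha> \<beta> x f)) = rscale c (\<delta> (A_act \<alpha> \<beta> x f))"
        using \<delta> A_act_closed[OF f] by (simp add: linear_endo_on_def)
      then show ?case using scale
        by (simp add: vir_endo_linear A_act_linear_left flip: rat.scale_right_distrib)
    next
      case (L i)
      then show ?case using R f by (simp add: A_act_vir_endo_L)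
    next
      case C
      have "\<delta> (rscale 0 f) = rscale 0 (\<delta> f)"
        using \<delta> f unfolding linear_endo_on_def by blast
      then show ?case by (simp add: vir_endo_C rscale_def)
    qed
    then show ?M
      by (intro one_differential_module.intro lie_module_A one_differential_module_axioms.intro
          one_differential_operator_vir_d assms) (simp add: key)
  qed
qed

text \<open>In the product formula for \<open>L\<^bsub>k-m\<^esub> L\<^bsub>m\<^esub>\<close> everything that depends on \<open>E\<close> is affine in \<open>m\<close>. A second
  difference in \<open>m\<close> therefore isolates a multiple of multiplication by \<open>t^k\<close>.\<close>

lemma A_act_second_difference:
  "A_act \<alpha> \<beta> (vir_L (k - m)) (A_act \<alpha> \<beta> (vir_L m) f) - 2 * A_act \<alpha> \<beta> (vir_L k) (A_act \<alpha> \<beta> (vir_L 0) f)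
     + A_act \<alpha> \<beta> (vir_L (k + m)) (A_act \<alpha> \<beta> (vir_L (- m)) f)
   = rconst (of_int (m\<^sup>2) * (- 2 * \<beta> * (\<beta> + 1))) * (rX powi k * f)"
  unfolding A_act_L_L
  by (simp add: rconst_hom rconst_hom' rconst_of_int rconst_power algebra_simps power2_eq_square)

text \<open>Here \<open>D\<close> stands for \<open>\<delta> + id\<close>.\<close>

locale intertwiner =
  fixes n :: int and a \<beta> :: complex and \<alpha> :: ratfun and D :: "ratfun \<Rightarrow> ratfun"
  assumes n: "n \<noteq> 0" and a: "a \<noteq> 0"
    and D_add: "f \<in> A_space \<alpha> \<Longrightarrow> g \<in> A_space \<alpha> \<Longrightarrow> D (f + g) = D f + D g"
    and D_scale: "f \<in> A_space \<alpha> \<Longrightarrow> D (rconst c * f) = rconst c * D f"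
    and D_L: "f \<in> A_space \<alpha> \<Longrightarrow> D (A_act \<alpha> \<beta> (vir_L i) f) =
       rconst (a powi i / of_int n) * A_act \<alpha> \<beta> (vir_L (n * i)) (D f)"
begin

lemma D_diff:
  assumes "f \<in> A_space \<alpha>" "g \<in> A_space \<alpha>"
  shows "D (f - g) = D f - D g"
  using D_add[of f "rconst (-1) * g"] D_scale[of g "-1"] assms rscale_closed[of g \<alpha> "-1"]
  by (simp add: rscale_def rconst_hom')

definition E :: "ratfun \<Rightarrow> ratfun" where
  "E f = reuler f + \<alpha> * f"

lemma L_E: "A_act \<alpha> \<beta> (vir_L i) f = rX powi i * (E f + rconst (of_int i * (\<beta> + 1)) * f)"
  by (simp add: A_act_L E_def)

lemma E_shift: "E (rX powi k * f) = rX powi k * (E f + of_int k * f)"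
  by (simp add: E_def reuler_mult reuler_powi_rX algebra_simps)

lemma closed:
  "f \<in> A_space \<alpha> \<Longrightarrow> rX powi k * f \<in> A_space \<alpha>"
  "f \<in> A_space \<alpha> \<Longrightarrow> E f \<in> A_space \<alpha>"
  using A_space_self[of \<alpha>]
  by (auto simp: A_space_def E_def intro!: laurent_adjoin_add laurent_adjoin_mult laurent_adjoin_reuler)

lemma D_E: "f \<in> A_space \<alpha> \<Longrightarrow> D (E f) = rconst (1 / of_int n) * E (D f)"
  using D_L[of f 0] by (simp add: L_E)

lemma D_L_L:
  assumes "f \<in> A_space \<alpha>"
  shows "D (A_act \<alpha> \<beta> (vir_L i) (A_act \<alpha> \<beta> (vir_L j) f)) =
    rconst (a powi (i + j) / of_int (n\<^sup>2)) * A_act \<alpha> \<beta> (vir_L (n * i)) (A_act \<alpha> \<beta> (vir_L (n * j)) (D f))"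
proof -
  have "D (A_act \<alpha> \<beta> (vir_L i) (A_act \<alpha> \<beta> (vir_L j) f)) =
    rconst (a powi i / of_int n) * (rconst (a powi j / of_int n) *
      A_act \<alpha> \<beta> (vir_L (n * i)) (A_act \<alpha> \<beta> (vir_L (n * j)) (D f)))"
    using assms by (simp only: D_L A_act_closed A_act_rconst_mult)
  also have "\<dots> = rconst (a powi i / of_int n * (a powi j / of_int n)) *
      A_act \<alpha> \<beta> (vir_L (n * i)) (A_act \<alpha> \<beta> (vir_L (n * j)) (D f))"
    by (simp only: rconst_hom mult.assoc)
  also have "a powi i / of_int n * (a powi j / of_int n) = a powi (i + j) / of_int (n\<^sup>2)"
    using a by (simp add: power_int_add power2_eq_square)
  finally show ?thesis .
qed

lemma D_combination:
  assumes "f \<in> A_space \<alpha>" "g \<in> A_space \<alpha>" "h \<in> A_space \<alpha>"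
  shows "D (f - rconst c * g + h) = D f - rconst c * D g + D h"
proof -
  have cg: "rconst c * g \<in> A_space \<alpha>"
    using rscale_closed[OF assms(2), of c] by (simp add: rscale_def)
  then have "f - rconst c * g \<in> A_space \<alpha>"
    using assms(1) by (simp add: A_space_def laurent_adjoin_diff)
  then show ?thesis using cg assms by (simp only: D_add D_diff D_scale)
qed

text \<open>For these \<open>\<beta>\<close> the second difference is a nonzero multiple of \<open>t^k\<close>, so multiplication by \<open>t^k\<close> lies
  in the algebra generated by the action, and its behaviour under \<open>D\<close> can be read off.\<close>

lemma D_shift_generic:
  assumes f: "f \<in> A_space \<alpha>" and \<beta>: "\<beta> \<noteq> 0" "\<beta> \<noteq> - 1"
  shows "D (rX powi k * f) = rconst (a powi k) * rX powi (n * k) * D f"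
proof -
  define c where "c = - 2 * \<beta> * (\<beta> + 1)"
  have "\<beta> + 1 \<noteq> 0" using \<beta>(2) by (simp add: add_eq_0_iff2)
  then have c: "c \<noteq> 0" using \<beta> by (simp add: c_def)
  let ?T = "\<lambda>i. A_act \<alpha> \<beta> (vir_L i)"
  note cl = A_act_closed closed f
  have "rconst c * D (rX powi k * f) = D (rconst c * (rX powi k * f))"
    using cl by (simp add: D_scale)
  also have "rconst c * (rX powi k * f) =
      ?T (k - 1) (?T 1 f) - rconst 2 * ?T k (?T 0 f) + ?T (k + 1) (?T (- 1) f)"
    using A_act_second_difference[of \<alpha> \<beta> k 1 f] by (simp add: c_def)
  also have "D \<dots> = D (?T (k - 1) (?T 1 f)) - rconst 2 * D (?T k (?T 0 f)) + D (?T (k + 1) (?T (- 1) f))"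
    by (intro D_combination A_act_closed f)
  also have "\<dots> = rconst (a powi k / of_int (n\<^sup>2)) *
     (?T (n * k - n) (?T n (D f)) - 2 * ?T (n * k) (?T 0 (D f)) + ?T (n * k + n) (?T (- n) (D f)))"
    using f by (simp add: D_L_L algebra_simps)
  also have "\<dots> = rconst (a powi k / of_int (n\<^sup>2)) * (rconst (of_int (n\<^sup>2) * c) * (rX powi (n * k) * D f))"
    unfolding A_act_second_difference c_def ..
  also have "\<dots> = rconst c * (rconst (a powi k) * rX powi (n * k) * D f)"
    using n by (simp add: rconst_hom rconst_divide)
  finally show ?thesis using c by simp
qed

text \<open>Now \<open>L\<^sub>k = t^k E\<close>, so the claim is clear on the image of \<open>E\<close>. The functions for which it holds
  for all \<open>k\<close> form a space that is stable under multiplication by powers of \<open>t\<close>, and every function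
  lies in it because \<open>f = E f - t E (t\<^sup>-\<^sup>1 f)\<close>.\<close>

lemma D_shift_minus_one:
  assumes f: "f \<in> A_space \<alpha>" and \<beta>: "\<beta> = - 1"
  shows "D (rX powi k * f) = rconst (a powi k) * rX powi (n * k) * D f"
proof -
  define W where "W g \<longleftrightarrow> g \<in> A_space \<alpha> \<and> (\<forall>k. D (rX powi k * g) = rconst (a powi k) * rX powi (n * k) * D g)" for g
  have W_shift: "W (rX powi j * g)" if "W g" for j g
  proof -
    have "D (rX powi k * (rX powi j * g)) = rconst (a powi k) * rX powi (n * k) * D (rX powi j * g)" for k
    proof -
      have D: "D (rX powi i * g) = rconst (a powi i) * rX powi (n * i) * D g" for i
        using that by (simp add: W_def)
      have "D (rX powi k * (rX powi j * g)) = D (rX powi (k + j) * g)"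
        by (simp add: power_int_add mult.assoc)
      also have "\<dots> = rconst (a powi k) * rX powi (n * k) * D (rX powi j * g)"
        unfolding D using a by (simp add: power_int_add distrib_left rconst_hom)
      finally show ?thesis .
    qed
    then show ?thesis using that by (simp add: W_def closed)
  qed
  have W_E: "W (E g)" if g: "g \<in> A_space \<alpha>" for g
  proof -
    have "D (rX powi k * E g) = rconst (a powi k / of_int n) * (rX powi (n * k) * E (D g))" for k
      using D_L[OF g, of k] unfolding L_E by (simp add: \<beta>)
    then show ?thesis using g by (simp add: W_def closed D_E rconst_divide)
  qed
  have "W (E f)" "W (rX powi 1 * E (rX powi (-1) * f))"
    using f by (intro W_E W_shift closed; simp)+
  moreover have "f = E f - rX powi 1 * E (rX powi (-1) * f)"
    unfolding E_shift by (simp add: field_simps power_int_minus)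
  moreover have "W (g - h)" if "W g" "W h" for g h
    using that laurent_adjoin_diff[of g "nonzero_poles \<alpha>" h]
    by (auto simp: W_def right_diff_distrib D_diff closed A_space_def[symmetric])
  ultimately have "W f" by metis
  then show ?thesis by (simp add: W_def)
qed

text \<open>Now \<open>L\<^sub>k = E t^k\<close>, and the intertwining relation only shows that the defect
  \<open>x k f = D (t^k f) - a^k t^(n k) D f\<close> is annihilated by \<open>E\<close>. Shifting by one more power of \<open>t\<close>
  shows that \<open>t^n x k f\<close> is annihilated as well, and \<open>E (t^n x) = t^n (E x + n x)\<close> forces \<open>x = 0\<close>.\<close>

lemma D_shift_zero:
  assumes f: "f \<in> A_space \<alpha>" and \<beta>: "\<beta> = 0"
  shows "D (rX powi k * f) = rconst (a powi k) * rX powi (n * k) * D f"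
proof -
  define x where "x k f = D (rX powi k * f) - rconst (a powi k) * rX powi (n * k) * D f" for k f
  have E_lin: "E (g - h) = E g - E h" "E (g + h) = E g + E h" "E (rconst c * g) = rconst c * E g" for c g h
    by (simp_all add: E_def reuler_diff reuler_add reuler_mult algebra_simps)
  have Ex: "E (x k g) = 0" if g: "g \<in> A_space \<alpha>" for k g
  proof -
    have "rconst (1 / of_int n) * E (D (rX powi k * g)) = D (E (rX powi k * g))"
      using g by (simp add: D_E closed)
    also have "E (rX powi k * g) = A_act \<alpha> \<beta> (vir_L k) g"
      unfolding E_shift L_E by (simp add: \<beta> rconst_of_int)
    also have "D \<dots> = rconst (a powi k / of_int n) * E (rX powi (n * k) * D g)"
      unfolding D_L[OF g, of k] unfolding E_shift L_E by (simp add: \<beta> rconst_of_int rconst_hom)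
    also have "\<dots> = rconst (1 / of_int n) * E (rconst (a powi k) * rX powi (n * k) * D g)"
      by (simp add: E_lin rconst_divide mult.assoc)
    finally show ?thesis using n by (simp add: x_def E_lin)
  qed
  have "x (k + 1) f = x 1 (rX powi k * f) + rconst a * (rX powi n * x k f)"
    by (simp add: x_def power_int_add a rconst_hom distrib_left algebra_simps)
  then have "0 = E (x 1 (rX powi k * f)) + E (rconst a * (rX powi n * x k f))"
    using Ex[OF f, of "k + 1"] by (simp add: E_lin)
  then have "E (rX powi n * x k f) = 0"
    using Ex closed(1)[OF f] a by (simp add: E_lin)
  then have "x k f = 0" using Ex[OF f, of k] n by (simp add: E_shift)
  then show ?thesis by (simp add: x_def)
qed

lemma D_shift:
  "f \<in> A_space \<alpha> \<Longrightarrow> D (rX powi k * f) = rconst (a powi k) * rX powi (n * k) * D f"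
  using D_shift_generic D_shift_minus_one D_shift_zero by metis

text \<open>Multiplication by a polynomial \<open>q(t)\<close> becomes multiplication by \<open>q(a t^n)\<close> under \<open>D\<close>. Applied to a
  denominator \<open>q\<close> of \<open>f\<close> this determines \<open>D f\<close> from \<open>D 1\<close>.\<close>

lemma D_eq_twist:
  assumes f: "f \<in> A_space \<alpha>"
  shows "D f = rsubst f (rconst a * rX powi n) * D 1"
proof -
  define r where "r = rconst a * rX powi n"
  have r: "r \<notin> range rconst" unfolding r_def using a n by (rule monomial_nonconst)
  have cl: "to_fract p * g \<in> A_space \<alpha>" if "g \<in> A_space \<alpha>" for p g
    using that by (simp add: A_space_def laurent_adjoin_mult)
  have poly: "D (to_fract p * g) = peval p r * D g" if g: "g \<in> A_space \<alpha>" for p g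
  proof (induction p)
    case 0
    have "D (rconst 0 * g) = rconst 0 * D g" using g by (rule D_scale)
    then show ?case by (simp add: peval_0)
  next
    case (pCons c p)
    have "to_fract (pCons c p) * g = rconst c * g + rX powi 1 * (to_fract p * g)"
      using peval_pCons[of c p rX] by (simp add: peval_rX algebra_simps)
    also have "D \<dots> = rconst c * D g + r * D (to_fract p * g)"
      using g rscale_closed[OF g, of c] cl[OF g] closed(1)[OF cl[OF g], of 1]
      by (simp only: D_add rscale_def D_scale D_shift) (simp add: r_def)
    finally show ?case using pCons by (simp add: peval_pCons algebra_simps)
  qed
  obtain p q where pq: "f = to_fract p / to_fract q" "q \<noteq> 0" by (rule ratfun_cases)
  have "peval q r * D f = D (to_fract q * f)" using poly f by simp
  also have "to_fract q * f = to_fract p * 1" using pq by simp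
  also have "D \<dots> = peval p r * D 1" by (rule poly) (simp add: A_space_def)
  finally have "D f = peval p r / peval q r * D 1"
    using peval_nonzero[OF r pq(2)] by (simp add: field_simps)
  then show ?thesis unfolding r_def[symmetric] using rsubst_quot'[OF r pq(2), of p]
    by (simp add: pq(1))
qed

text \<open>The relation for \<open>L\<^sub>0\<close>, applied to the constant function 1.\<close>

lemma twist_equation:
  assumes "D 1 \<noteq> 0"
  shows "rconst (of_int n) * rsubst \<alpha> (rconst a * rX powi n) = \<alpha> + logder (D 1)"
proof -
  have "D \<alpha> = rconst (1 / of_int n) * (reuler (D 1) + \<alpha> * D 1)"
    using D_E[of 1] by (simp add: A_space_def E_def)
  then show ?thesis using D_eq_twist[OF A_space_self] assms n
    by (simp add: logder_def rconst_divide field_simps)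
qed

end

text \<open>The nontrivial structures are the weighted substitutions \<open>f \<mapsto> f(a t^n) u - f\<close> whose weight
  solves a first-order functional equation.\<close>

lemma one_differential_module_iff_twist:
  fixes n :: int and a \<beta> :: complex
  assumes n: "n \<noteq> 0" and a: "a \<noteq> 0" and \<delta>: "linear_endo_on rscale (A_space \<alpha>) \<delta>"
  shows "one_differential_module vir_scale vir_bracket (vir_d n a) rscale (A_space \<alpha>) (A_act \<alpha> \<beta>) \<delta>
      \<and> (\<exists>f\<in>A_space \<alpha>. \<delta> f \<noteq> - f) \<longleftrightarrow>
    (\<exists>u. u \<noteq> 0 \<and> (\<forall>f\<in>A_space \<alpha>. \<delta> f = rsubst f (rconst a * rX powi n) * u - f) \<and>
       rconst (of_int n) * rsubst \<alpha> (rconst a * rX powi n) = \<alpha> + logder u)"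
    (is "?M \<and> ?N \<longleftrightarrow> (\<exists>u. ?U u)")
proof
  assume MN: "?M \<and> ?N"
  define D where "D f = \<delta> f + f" for f
  have "intertwiner n a \<beta> \<alpha> D"
  proof
    show "D (f + g) = D f + D g" if "f \<in> A_space \<alpha>" "g \<in> A_space \<alpha>" for f g
      using that \<delta> by (auto simp: D_def linear_endo_on_def)
    show "D (rconst c * f) = rconst c * D f" if "f \<in> A_space \<alpha>" for f c
      using that \<delta> by (auto simp: D_def linear_endo_on_def rscale_def algebra_simps)
    show "D (A_act \<alpha> \<beta> (vir_L i) f) = rconst (a powi i / of_int n) * A_act \<alpha> \<beta> (vir_L (n * i)) (D f)"
      if "f \<in> A_space \<alpha>" for f i
      using that MN unfolding one_differential_module_iff[OF n a \<delta>] D_def by blast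
  qed (fact n a)+
  then interpret intertwiner n a \<beta> \<alpha> D .
  have nz: "D 1 \<noteq> 0"
  proof
    assume "D 1 = 0"
    then have "\<delta> f = - f" if "f \<in> A_space \<alpha>" for f
      using D_eq_twist[OF that] by (simp add: D_def eq_neg_iff_add_eq_0)
    then show False using MN by blast
  qed
  have "?U (D 1)"
    using nz twist_equation[OF nz] D_eq_twist by (auto simp: D_def eq_diff_eq)
  then show "\<exists>u. ?U u" by blast
next
  assume "\<exists>u. ?U u"
  then obtain u where u: "u \<noteq> 0" "\<And>f. f \<in> A_space \<alpha> \<Longrightarrow> \<delta> f + f = rsubst f (rconst a * rX powi n) * u"
    "rconst (of_int n) * rsubst \<alpha> (rconst a * rX powi n) = \<alpha> + logder u" by force
  define r where "r = rconst a * rX powi n"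
  have r: "r \<notin> range rconst" unfolding r_def using a n by (rule monomial_nonconst)
  have rn: "reuler r = rconst (of_int n) * r" unfolding r_def by (rule reuler_monomial)
  have "reuler u = logder u * u" using u(1) by (simp add: logder_def)
  also have "logder u = rconst (of_int n) * rsubst \<alpha> r - \<alpha>" using u(3) by (simp add: r_def)
  finally have ru: "reuler u = (rconst (of_int n) * rsubst \<alpha> r - \<alpha>) * u" .
  have "?M" unfolding one_differential_module_iff[OF n a \<delta>]
  proof (intro allI ballI)
    fix i f assume f: "f \<in> A_space \<alpha>"
    have ri: "r powi i = rconst (a powi i) * rX powi (n * i)"
      by (simp add: r_def power_int_mult_distrib rconst_powi power_int_mult)
    have "\<delta> (A_act \<alpha> \<beta> (vir_L i) f) + A_act \<alpha> \<beta> (vir_L i) f = rsubst (A_act \<alpha> \<beta> (vir_L i) f) r * u"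
      unfolding r_def using f by (intro u(2) A_act_closed)
    also have "\<dots> = rconst (a powi i) * rX powi (n * i) *
        (rsubst (reuler f) r + rsubst \<alpha> r * rsubst f r + rconst (of_int i * (\<beta> + 1)) * rsubst f r) * u"
      unfolding A_act_L by (simp add: rsubst_hom[OF r] ri)
    also have "\<dots> = rconst (a powi i / of_int n) * A_act \<alpha> \<beta> (vir_L (n * i)) (rsubst f r * u)"
      unfolding A_act_L reuler_mult reuler_rsubst[OF r rn] ru using n
      by (simp add: rconst_divide rconst_hom field_simps)
    finally show "\<delta> (A_act \<alpha> \<beta> (vir_L i) f) + A_act \<alpha> \<beta> (vir_L i) f =
       rconst (a powi i / of_int n) * A_act \<alpha> \<beta> (vir_L (n * i)) (\<delta> f + f)"
      using u(2)[OF f] by (simp add: r_def)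
  qed
  moreover have ?N
  proof
    show "1 \<in> A_space \<alpha>" by (simp add: A_space_def)
    then show "\<delta> 1 \<noteq> - 1" using u(2)[of 1] u(1) by (auto simp: eq_neg_iff_add_eq_0)
  qed
  ultimately show "?M \<and> ?N" ..
qed

section \<open>Poles and the degree of the substitution\<close>

text \<open>Up to a power of \<open>t\<close>, the function \<open>a t^n - p\<close> is a polynomial for either sign of \<open>n\<close>; its nonzero
  roots are the preimages of \<open>p\<close>.\<close>

lemma monomial_minus_const:
  assumes "n \<noteq> 0" "a \<noteq> 0"
  obtains e g where "rconst a * rX powi n - rconst p = rX powi e * to_fract g" "g \<noteq> 0"
    "\<And>z. z \<noteq> 0 \<Longrightarrow> poly g z = 0 \<longleftrightarrow> a * z powi n = p"
proof (cases "n > 0")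
  case True
  define g where "g = monom a (nat n) - [:p:]"
  have eq: "rconst a * rX powi n - rconst p = rX powi 0 * to_fract g"
    using True by (simp add: g_def to_fract_monom power_int_def rconst_def)
  moreover have "poly g z = 0 \<longleftrightarrow> a * z powi n = p" if "z \<noteq> 0" for z
    using True by (simp add: g_def poly_monom power_int_def)
  moreover have "g \<noteq> 0" using eq monomial_nonconst[OF assms(2,1)] by auto
  ultimately show ?thesis using that by blast
next
  case False
  define g where "g = [:a:] - monom p (nat (- n))"
  have eq: "rconst a * rX powi n - rconst p = rX powi n * to_fract g"
    using False by (simp add: g_def to_fract_monom power_int_def rconst_def[symmetric] field_simps)
  moreover have "poly g z = 0 \<longleftrightarrow> a * z powi n = p" if "z \<noteq> 0" for z
    using False that by (auto simp add: g_def poly_monom power_int_def field_simps)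
  moreover have "g \<noteq> 0" using eq monomial_nonconst[OF assms(2,1)] by auto
  ultimately show ?thesis using that by blast
qed

text \<open>The poles of \<open>f(a t^n)\<close> are preimages of poles of \<open>f\<close>.\<close>

lemma rsubst_laurent_adjoin:
  assumes f: "f \<in> laurent_adjoin P" and n: "n \<noteq> 0" and a: "a \<noteq> 0"
    and P: "\<And>z. z \<noteq> 0 \<Longrightarrow> a * z powi n \<in> P \<Longrightarrow> z \<in> P"
  shows "rsubst f (rconst a * rX powi n) \<in> laurent_adjoin P"
proof -
  define r where "r = rconst a * rX powi n"
  have r: "r \<notin> range rconst" unfolding r_def using a n by (rule monomial_nonconst)
  have rP: "r \<in> laurent_adjoin P" "inverse r \<in> laurent_adjoin P"
    by (auto simp: r_def rconst_inverse[symmetric] power_int_minus[symmetric] intro!: laurent_adjoin_mult)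
  have "rsubst f r \<in> laurent_adjoin P"
    using f unfolding laurent_adjoin_def[of P]
  proof induction
    case (gen f)
    then consider "f = rX" | "f = inverse rX" | p where "p \<in> P" "f = inverse (rX - rconst p)"
      by blast
    then have "rsubst f r \<in> laurent_adjoin P"
    proof cases
      case (3 p)
      obtain e g where g: "rconst a * rX powi n - rconst p = rX powi e * to_fract g" "g \<noteq> 0"
        "\<And>z. z \<noteq> 0 \<Longrightarrow> poly g z = 0 \<longleftrightarrow> a * z powi n = p"
        using monomial_minus_const[OF n a, of p] by metis
      have "rsubst f r = inverse (rX powi e * to_fract g)"
        unfolding 3(2) g(1)[symmetric] by (simp add: rsubst_hom[OF r]) (simp add: r_def)
      also have "\<dots> = rX powi (- e) * (to_fract 1 / to_fract g)"
        by (simp add: power_int_minus divide_inverse)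
      also have "\<dots> \<in> laurent_adjoin P"
      proof (intro laurent_adjoin_mult laurent_adjoin_rX_powi)
        show "to_fract 1 / to_fract g \<in> laurent_adjoin P"
          unfolding laurent_adjoin_iff using g(2,3) 3(1) P by metis
      qed
      finally show ?thesis .
    qed (use rP in \<open>auto simp: rsubst_hom[OF r]\<close>)
    then show ?case by (simp add: laurent_adjoin_def)
  qed (auto simp: rsubst_hom[OF r] intro: subalgebra_gen.intros)
  then show ?thesis by (simp add: r_def)
qed

text \<open>The numerator of \<open>u\<close> vanishes at \<open>q\<close> to a finite order \<open>k\<close>, so \<open>u / g^(k + 1)\<close> has a pole at \<open>q\<close>.\<close>

lemma pole_of_all_powers:
  assumes u: "u \<noteq> 0" and g: "poly g q = 0" "g \<noteq> 0"
    and all: "\<And>N. u / to_fract g ^ N \<in> laurent_adjoin P"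
  shows "q = 0 \<or> q \<in> P"
proof -
  obtain s t where st: "u = to_fract s / to_fract t" "t \<noteq> 0" by (rule ratfun_cases)
  have s0: "s \<noteq> 0" using u st by auto
  define k where "k = order q s"
  obtain s' where s': "s = [:-q, 1:] ^ k * s'" "\<not> [:-q, 1:] dvd s'"
    using order_decomp[OF s0, of q] k_def by blast
  obtain g' where g': "g = [:-q, 1:] * g'" using g(1) by (auto simp: poly_eq_0_iff_dvd)
  have g'0: "g' \<noteq> 0" using g g' by auto
  define X where "X = to_fract [:-q, 1:]"
  have X: "X \<noteq> 0" by (simp add: X_def)
  have "u / to_fract g ^ (k + 1) * to_fract t * to_fract g' ^ (k + 1) \<in> laurent_adjoin P"
    by (intro laurent_adjoin_mult all laurent_adjoin_power laurent_adjoin_to_fract)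
  also have "to_fract g = X * to_fract g'" unfolding g' X_def by (rule to_fract_mult)
  also have "u / (X * to_fract g') ^ (k + 1) * to_fract t * to_fract g' ^ (k + 1)
     = u * to_fract t / X ^ (k + 1)"
    using g'0 X by (simp add: power_mult_distrib)
  also have "u * to_fract t = to_fract s" using st by simp
  also have "to_fract s = X ^ k * to_fract s'"
    unfolding s'(1) to_fract_mult X_def
    by (metis peval_rX peval_power)
  also have "X ^ k * to_fract s' / X ^ (k + 1) = to_fract s' / to_fract [:-q, 1:]"
    using X by (simp add: X_def)
  finally show ?thesis
    by (rule laurent_adjoin_pole) (use s' in \<open>auto simp: poly_eq_0_iff_dvd\<close>)
qed

text \<open>Substituting \<open>b t^N\<close> multiplies the order of the pole at 0 and the order of the pole at infinity by \<open>N\<close>,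
  but adding a constant changes neither. A nonconstant Laurent polynomial has at least one of these poles.\<close>

lemma degree_one_of_self_similar:
  assumes eq: "rconst A * rsubst \<alpha> (rconst b * rX ^ N) = \<alpha> + rconst c"
    and \<alpha>: "\<alpha> \<in> laurent_adjoin {}" "\<alpha> \<notin> range rconst"
    and A: "A \<noteq> 0" and b: "b \<noteq> 0" and N: "N > 0"
  shows "N = 1"
proof (rule ccontr)
  assume "N \<noteq> 1"
  then have N2: "N > 1" using N by simp
  obtain p d k where pdk: "\<alpha> = to_fract p / to_fract (monom d k)" "d \<noteq> 0" "coprime p (monom d k)"
    by (rule laurent_polynomial_quotient[OF \<alpha>(1)])
  define q where "q = monom d k"
  have qm: "q = monom d k" and d: "d \<noteq> 0" using pdk by (simp_all add: q_def)
  have pq: "\<alpha> = to_fract p / to_fract q" "q \<noteq> 0" "coprime p q" using pdk by (simp_all add: q_def)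
  have bN: "rconst b * rX powi (int N) \<notin> range rconst" using N b by (intro monomial_nonconst) auto
  have bN': "rconst b * rX ^ N = to_fract (monom b N)" by (simp add: to_fract_monom)
  have "rsubst \<alpha> (rconst b * rX ^ N) = peval p (to_fract (monom b N)) / peval q (to_fract (monom b N))"
    using rsubst_quot'[OF bN pq(2), of p] unfolding pq(1)[symmetric] by (simp add: bN')
  then have "rconst A * (to_fract (pcompose p (monom b N)) / to_fract (pcompose q (monom b N)))
      = to_fract p / to_fract q + rconst c"
    using eq pq(1) by (simp add: peval_to_fract)
  moreover have "to_fract (pcompose q (monom b N)) \<noteq> 0"
    using pq(2) N b by (simp add: pcompose_eq_0_iff degree_monom_eq)
  ultimately have "rconst A * to_fract (pcompose p (monom b N)) * to_fract q =
     to_fract p * to_fract (pcompose q (monom b N)) + rconst c * to_fract q * to_fract (pcompose q (monom b N))"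
    using pq(2) by (simp add: field_simps)
  then have "to_fract ([:A:] * pcompose p (monom b N) * q) =
     to_fract (p * pcompose q (monom b N) + [:c:] * q * pcompose q (monom b N))"
    by (simp only: to_fract_mult to_fract_add rconst_def)
  then have P: "[:A:] * pcompose p (monom b N) * q = (p + [:c:] * q) * pcompose q (monom b N)"
    by (simp only: to_fract_eq_iff distrib_right)
  have qc: "pcompose q (monom b N) = monom (d * b ^ k) (k * N)"
  proof -
    have "to_fract (pcompose q (monom b N)) = rconst d * to_fract (monom b N) ^ k"
      unfolding peval_to_fract[symmetric] qm by (simp add: monom_altdef peval_smult peval_power peval_pCons peval_0)
    also have "\<dots> = to_fract (monom (d * b ^ k) (k * N))"
      by (simp add: to_fract_monom rconst_hom rconst_power power_mult_distrib power_mult[symmetric] mult.commute[of N])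
    finally show ?thesis by (simp only: to_fract_eq_iff)
  qed
  \<comment> \<open>Here \<open>k\<close> is the order of the pole at 0. If there is none, \<open>\<alpha>\<close> is a polynomial and its degree,
    the order of the pole at infinity, is compared.\<close>
  show False
  proof (cases "k = 0")
    case True
    then have q1: "q = [:d:]" by (simp add: qm monom_0)
    have dp: "degree p > 0"
    proof (rule ccontr)
      assume "\<not> degree p > 0"
      then obtain y where "p = [:y:]" by (auto elim: degree_eq_zeroE)
      then have "\<alpha> = rconst (y / d)" using pq(1) q1 by (simp add: rconst_divide) (simp add: rconst_def)
      then show False using \<alpha>(2) by auto
    qed
    have "smult (A * d) (pcompose p (monom b N)) = smult d (p + [:c * d:])"
      using P by (simp add: q1 smult_add_right ac_simps)
    then have "degree (smult (A * d) (pcompose p (monom b N))) = degree (smult d (p + [:c * d:]))" by simp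
    then have "degree p * N = degree (p + [:c * d:])"
      using A d b by (simp add: degree_pcompose degree_monom_eq)
    also have "\<dots> = degree p" using dp by (intro degree_add_eq_left) simp
    finally show False using dp N2 by simp
  next
    case False
    then have "poly q 0 = 0" by (simp add: qm poly_monom)
    then have p0: "poly p 0 \<noteq> 0" using coprime_poly_root pq(3) by blast
    have "k * N = k + k * (N - 1)" using N by (simp add: algebra_simps)
    then have "monom (d * b ^ k) (k * N) = q * monom (b ^ k) (k * (N - 1))"
      by (simp add: qm mult_monom)
    then have "q * ([:A:] * pcompose p (monom b N)) = q * ((p + [:c:] * q) * monom (b ^ k) (k * (N - 1)))"
      using P unfolding qc by (simp add: algebra_simps)
    then have "[:A:] * pcompose p (monom b N) = (p + [:c:] * q) * monom (b ^ k) (k * (N - 1))"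
      using pq(2) mult_left_cancel by blast
    then have "poly ([:A:] * pcompose p (monom b N)) 0 = poly ((p + [:c:] * q) * monom (b ^ k) (k * (N - 1))) 0"
      by simp
    then show False using A p0 False N2 N by (simp add: poly_pcompose poly_monom power_0_left)
  qed
qed

lemma card_preimages:
  assumes "n \<noteq> 0" "a \<noteq> 0" "p \<noteq> (0::complex)"
  shows "card {q. q \<noteq> 0 \<and> a * q powi n = p} = nat \<bar>n\<bar>"
proof -
  define c where "c = (if n > 0 then p / a else a / p)"
  have "{q. q \<noteq> 0 \<and> a * q powi n = p} = {q. q ^ nat \<bar>n\<bar> = c}"
    using assms by (auto simp: c_def power_int_def field_simps)
  also have "card \<dots> = nat \<bar>n\<bar>"
    by (rule card_nth_roots) (use assms in \<open>auto simp: c_def\<close>)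
  finally show ?thesis .
qed

text \<open>Since \<open>f \<mapsto> f(a t^n) u\<close> preserves the module and the module contains all powers of \<open>1/(t - p)\<close> for a pole \<open>p\<close>, the
  preimages of poles under \<open>z \<mapsto> a z^n\<close> are poles again. Each pole has \<open>\<bar>n\<bar>\<close> preimages, so a nonempty finite set of
  poles forces \<open>\<bar>n\<bar> = 1\<close>. Without nonzero poles \<open>\<alpha>\<close> is a Laurent polynomial, and the previous
  lemma applies. In both cases the logarithmic derivative of \<open>u\<close> lies in the module,
  so \<open>u\<close> is a unit of it.\<close>

lemma twist_structure:
  fixes n :: int and a :: complex
  defines "r \<equiv> rconst a * rX powi n"
  assumes n: "n \<noteq> 0" and a: "a \<noteq> 0" and \<alpha>: "\<alpha> \<notin> range rconst"
    and u: "u \<noteq> 0" and uA: "\<And>f. f \<in> A_space \<alpha> \<Longrightarrow> rsubst f r * u \<in> A_space \<alpha>"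
    and eq: "rconst (of_int n) * rsubst \<alpha> r = \<alpha> + logder u"
  obtains c e m where "n = 1 \<or> n = - 1"
    and "\<And>z. z \<noteq> 0 \<Longrightarrow> a * z powi n \<in> nonzero_poles \<alpha> \<Longrightarrow> z \<in> nonzero_poles \<alpha>"
    and "c \<noteq> 0" and "u = rconst c * rX powi e * (\<Prod>z\<in>nonzero_poles \<alpha>. (rX - rconst z) powi m z)"
proof -
  let ?P = "nonzero_poles \<alpha>"
  have r: "r \<notin> range rconst" unfolding r_def using a n by (rule monomial_nonconst)
  have closed: "z \<in> ?P" if z: "z \<noteq> 0" and p: "a * z powi n \<in> ?P" for z
  proof -
    obtain e g where g: "rconst a * rX powi n - rconst (a * z powi n) = rX powi e * to_fract g" "g \<noteq> 0"
      "\<And>y. y \<noteq> 0 \<Longrightarrow> poly g y = 0 \<longleftrightarrow> a * y powi n = a * z powi n"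
      using monomial_minus_const[OF n a, of "a * z powi n"] by metis
    have "u / to_fract g ^ N \<in> laurent_adjoin ?P" for N
    proof -
      have "inverse (rX - rconst (a * z powi n)) ^ N \<in> A_space \<alpha>"
        unfolding A_space_def by (intro laurent_adjoin_power laurent_adjoin_inverse_minus p)
      from uA[OF this] have *: "inverse (r - rconst (a * z powi n)) ^ N * u \<in> laurent_adjoin ?P"
        by (simp add: rsubst_hom[OF r] A_space_def)
      have "u / to_fract g ^ N = (rX powi e) ^ N * (inverse (rX powi e * to_fract g) ^ N * u)"
        by (simp add: divide_inverse power_mult_distrib power_inverse)
      then show ?thesis using *
        unfolding r_def g(1) by (simp add: laurent_adjoin_mult laurent_adjoin_power)
    qed
    then show ?thesis using pole_of_all_powers[of u g z ?P] u g z by auto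
  qed
  have uP: "u \<in> laurent_adjoin ?P" using uA[of 1] by (simp add: A_space_def)
  have "rsubst \<alpha> r \<in> laurent_adjoin ?P"
    unfolding r_def using A_space_self[unfolded A_space_def] n a closed by (rule rsubst_laurent_adjoin)
  then have "rconst (of_int n) * rsubst \<alpha> r - \<alpha> \<in> laurent_adjoin ?P"
    using A_space_self[of \<alpha>] by (intro laurent_adjoin_diff laurent_adjoin_mult) (auto simp: A_space_def)
  then have "logder u \<in> laurent_adjoin ?P" unfolding eq by simp
  then have "inverse u \<in> laurent_adjoin ?P" using laurent_adjoin_unit_of_logder uP u by blast
  then obtain c e m where u_eq: "c \<noteq> 0" "u = rconst c * rX powi e * (\<Prod>z\<in>?P. (rX - rconst z) powi m z)"
    using laurent_adjoin_unit_factorization[OF uP _ u finite_nonzero_poles zero_not_in_nonzero_poles] by blast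
  have "nat \<bar>n\<bar> = 1"
  proof (cases "?P = {}")
    case True
    then have "logder u = rconst (of_int e)"
      using u_eq by (simp add: logder_mult logder_powi rconst_of_int)
    note eq' = eq[unfolded this]
    \<comment> \<open>Iterating the equation replaces \<open>n\<close> by the positive exponent \<open>n\<^sup>2\<close>, which spares the case of negative \<open>n\<close>.\<close>
    have rr: "rsubst r r = rconst (a * a powi n) * rX ^ nat (n\<^sup>2)"
    proof -
      have "rsubst r r = rconst a * r powi n"
        unfolding r_def by (simp only: rsubst_hom[OF r[unfolded r_def]] rsubst_rconst rsubst_rX)
      also have "r powi n = rconst (a powi n) * rX powi (n * n)"
        by (simp add: r_def power_int_mult_distrib rconst_powi power_int_mult)
      also have "rX powi (n * n) = rX ^ nat (n\<^sup>2)"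
        by (simp add: power_int_def power2_eq_square)
      finally show ?thesis by (simp add: rconst_hom)
    qed
    have "rconst (of_int (n\<^sup>2)) * rsubst \<alpha> (rsubst r r) = rconst (of_int n) * rsubst (rconst (of_int n) * rsubst \<alpha> r) r"
      by (simp add: rsubst_hom[OF r] rsubst_rsubst[OF r r] rconst_hom power2_eq_square)
    also have "\<dots> = \<alpha> + rconst (of_int e) + rconst (of_int n) * rconst (of_int e)"
      unfolding eq' by (simp add: rsubst_hom[OF r] distrib_left eq')
    finally have "rconst (of_int (n\<^sup>2)) * rsubst \<alpha> (rconst (a * a powi n) * rX ^ nat (n\<^sup>2)) =
        \<alpha> + rconst (of_int e + of_int n * of_int e)"
      by (simp add: rr rconst_hom)
    then have "nat (n\<^sup>2) = 1"
      by (rule degree_one_of_self_similar) (use \<alpha> A_space_self[of \<alpha>] True n a in \<open>auto simp: A_space_def\<close>)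
    then have "n\<^sup>2 = 1" by simp
    then show ?thesis by (auto simp: power2_eq_1_iff)
  next
    case False
    let ?Q = "\<lambda>p. {q. q \<noteq> 0 \<and> a * q powi n = p}"
    have p0: "p \<noteq> 0" if "p \<in> ?P" for p using that zero_not_in_nonzero_poles by metis
    have cQ: "card (?Q p) = nat \<bar>n\<bar>" if "p \<in> ?P" for p
      using card_preimages[OF n a p0[OF that]] .
    have fQ: "finite (?Q p)" if "p \<in> ?P" for p
      using cQ[OF that] n by (intro card_ge_0_finite) simp
    have "card (\<Union>p\<in>?P. ?Q p) = (\<Sum>p\<in>?P. card (?Q p))"
      by (rule card_UN_disjoint) (use finite_nonzero_poles fQ in auto)
    also have "\<dots> = card ?P * nat \<bar>n\<bar>" using cQ by simp
    finally have "card ?P * nat \<bar>n\<bar> = card (\<Union>p\<in>?P. ?Q p)" ..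
    also have "\<dots> \<le> card ?P" by (rule card_mono) (use closed finite_nonzero_poles in auto)
    finally have "card ?P * nat \<bar>n\<bar> \<le> card ?P * 1" by simp
    moreover have "card ?P > 0" using False finite_nonzero_poles by (simp add: card_gt_0_iff)
    ultimately have "nat \<bar>n\<bar> \<le> 1" by simp
    then show ?thesis using n by simp
  qed
  then have "n = 1 \<or> n = - 1" by linarith
  then show ?thesis using that closed u_eq by blast
qed

section \<open>The case of a rotation\<close>

lemma rotation_nonconst: "a \<noteq> 0 \<Longrightarrow> rconst a * rX \<notin> range rconst"
  using monomial_nonconst[of a 1] by simp

lemma primitive_root_power_eq:
  assumes "primitive_root_of_unity d a" "a ^ i = a ^ j"
  shows "i mod d = j mod d"
proof -
  have d: "0 < d" "a ^ d = 1" and min: "\<And>k. 0 < k \<Longrightarrow> k < d \<Longrightarrow> a ^ k \<noteq> 1"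
    using assms(1) by (auto simp: primitive_root_of_unity_def)
  have a: "a \<noteq> 0" using d by (auto simp: power_0_left)
  have red: "a ^ k = a ^ (k mod d)" for k
  proof -
    have "a ^ k = a ^ (d * (k div d) + k mod d)" by simp
    also have "\<dots> = a ^ (k mod d)" using d(2) by (simp only: power_add power_mult) simp
    finally show ?thesis .
  qed
  have wlog: "x = y" if xy: "x \<le> y" "y < d" "a ^ x = a ^ y" for x y
  proof (rule ccontr)
    assume "x \<noteq> y"
    have "a ^ x * a ^ (y - x) = a ^ y" using xy(1) by (simp flip: power_add)
    then have "a ^ (y - x) = 1" using xy(3) a by simp
    then show False using min[of "y - x"] \<open>x \<noteq> y\<close> xy by auto
  qed
  have "a ^ (i mod d) = a ^ (j mod d)" using assms(2) red by metis
  then show ?thesis using wlog[of "i mod d" "j mod d"] wlog[of "j mod d" "i mod d"] d(1)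
    by (metis linear mod_less_divisor)
qed

text \<open>Remove one orbit at a time. All orbits of multiplication by \<open>a\<close> on nonzero numbers have exactly
  \<open>d\<close> elements.\<close>

lemma orbit_representatives:
  assumes root: "primitive_root_of_unity d a"
    and P: "finite P" "0 \<notin> P" "\<And>z. z \<in> P \<Longrightarrow> z * a \<in> P"
  obtains s :: nat and p :: "nat \<Rightarrow> complex"
  where "inj_on (\<lambda>(i, j). p i * a ^ j) ({1..s} \<times> {1..d})"
    and "(\<lambda>(i, j). p i * a ^ j) ` ({1..s} \<times> {1..d}) = P"
proof -
  have d: "0 < d" "a ^ d = 1" using root by (auto simp: primitive_root_of_unity_def)
  have "\<exists>(s::nat) p. inj_on (\<lambda>(i, j). p i * a ^ j) ({1..s} \<times> {1..d}) \<and>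
      (\<lambda>(i, j). p i * a ^ j) ` ({1..s} \<times> {1..d}) = P"
    using P
  proof (induction P rule: finite_psubset_induct)
    case (psubset P)
    show ?case
    proof (cases "P = {}")
      case True
      then show ?thesis by (intro exI[of _ 0]) auto
    next
      case False
      then obtain z where z: "z \<in> P" by blast
      then have z0: "z \<noteq> 0" using psubset.prems by auto
      define Q where "Q = (\<lambda>j. z * a ^ j) ` {1..d}"
      have Q_all: "z * a ^ j \<in> Q" for j
      proof -
        define i where "i = (if j mod d = 0 then d else j mod d)"
        have "i \<in> {1..d}" using d(1) by (auto simp: i_def)
        moreover have "a ^ j = a ^ (d * (j div d) + j mod d)" by simp
        then have "a ^ j = a ^ i" using d(2) by (simp only: power_add power_mult) (simp add: i_def)
        ultimately show ?thesis by (auto simp: Q_def)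
      qed
      have zP: "z * a ^ j \<in> P" for j
      proof (induction j)
        case (Suc j)
        then show ?case using psubset.prems(2)[OF Suc] by (simp add: mult_ac)
      qed (use z in simp)
      have "P - Q \<subset> P" using z Q_all[of 0] by auto
      moreover have "w * a \<in> P - Q" if w: "w \<in> P - Q" for w
      proof -
        have "w * a \<notin> Q"
        proof
          assume "w * a \<in> Q"
          then obtain j where "w * a = z * a ^ j" by (auto simp: Q_def)
          then have "w * a * a ^ (d - 1) = z * a ^ j * a ^ (d - 1)" by simp
          moreover have "w * a * a ^ (d - 1) = w" using d by (simp add: mult.assoc flip: power_Suc)
          ultimately have "w = z * a ^ (j + (d - 1))" by (simp only: power_add mult.assoc)
          then show False using Q_all w by auto
        qed
        then show ?thesis using psubset.prems(2) w by auto
      qed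
      moreover have "0 \<notin> P - Q" using psubset.prems by auto
      ultimately obtain s :: nat and p where sp: "inj_on (\<lambda>(i, j). p i * a ^ j) ({1..s} \<times> {1..d})"
        "(\<lambda>(i, j). p i * a ^ j) ` ({1..s} \<times> {1..d}) = P - Q"
        using psubset.IH by meson
      define p' where "p' = p(Suc s := z)"
      have split: "{1..Suc s} \<times> {1..d} = {1..s} \<times> {1..d} \<union> {Suc s} \<times> {1..d}"
        by auto
      have 1: "(\<lambda>(i, j). p' i * a ^ j) ` ({1..s} \<times> {1..d}) = P - Q"
        unfolding sp(2)[symmetric] by (rule image_cong) (auto simp: p'_def)
      have 2: "(\<lambda>(i, j). p' i * a ^ j) ` ({Suc s} \<times> {1..d}) = Q"
      proof -
        have "{Suc s} \<times> {1..d} = Pair (Suc s) ` {1..d}" by auto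
        then show ?thesis by (simp only: image_image p'_def Q_def) simp
      qed
      have "inj_on (\<lambda>(i, j). p' i * a ^ j) ({1..s} \<times> {1..d})"
        using sp(1) by (rule inj_on_cong[THEN iffD1, rotated]) (auto simp: p'_def)
      moreover have "inj_on (\<lambda>(i, j). p' i * a ^ j) ({Suc s} \<times> {1..d})"
      proof (rule inj_onI, clarsimp simp: p'_def z0)
        fix i j assume ij: "Suc 0 \<le> i" "i \<le> d" "Suc 0 \<le> j" "j \<le> d" "a ^ i = a ^ j"
        then have "i mod d = j mod d" using primitive_root_power_eq[OF root] by blast
        then show "i = j" using ij by (cases "i = d"; cases "j = d") auto
      qed
      ultimately have "inj_on (\<lambda>(i, j). p' i * a ^ j) ({1..Suc s} \<times> {1..d})"
        unfolding split inj_on_Un using 1 2 by blast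
      moreover have "(\<lambda>(i, j). p' i * a ^ j) ` ({1..Suc s} \<times> {1..d}) = P"
        unfolding split image_Un 1 2 using zP by (auto simp: Q_def)
      ultimately show ?thesis by blast
    qed
  qed
  then show ?thesis using that by blast
qed

text \<open>Rotation by \<open>a\<close> moves the \<open>j\<close>-th summand of \<open>\<alpha>0\<close> to the pole of its predecessor, so that the partial sums in
  the coefficients leave their increments \<open>m j\<close>. The conversion of \<open>1/(t - z)\<close> into \<open>t/(t - z)\<close>
  costs a constant that vanishes because the \<open>m j\<close> add up to 0.\<close>

lemma orbit_telescope:
  fixes m :: "nat \<Rightarrow> int" and p :: complex
  assumes d: "0 < d" "a ^ d = 1" and m: "(\<Sum>j<d. m j) = 0"
  defines "\<alpha>0 \<equiv> \<Sum>j=1..d. rconst (p * of_int (\<Sum>k<j. m k)) *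
                  inverse (rconst (a powi (- int j)) * rX - rconst p)"
  shows "rsubst \<alpha>0 (rconst a * rX) - \<alpha>0 = (\<Sum>j<d. of_int (m j) * (rX / (rX - rconst (p * a ^ j))))"
proof -
  have a: "a \<noteq> 0" using d by (auto simp: power_0_left)
  note r = rotation_nonconst[OF a]
  define F where "F j = rconst p * inverse (rconst (a powi (- int j)) * rX - rconst p)" for j
  define M where "M j = (\<Sum>k<j. m k)" for j
  have \<alpha>0: "\<alpha>0 = (\<Sum>j=1..d. of_int (M j) * F j)"
    unfolding \<alpha>0_def F_def M_def by (rule sum.cong) (simp_all only: rconst_hom rconst_of_int mult_ac)
  have F_shift: "rsubst (F (Suc j)) (rconst a * rX) = F j" for j
  proof -
    have "rsubst (F (Suc j)) (rconst a * rX) =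
        rconst p * inverse (rconst (a powi (- int (Suc j)) * a) * rX - rconst p)"
      by (simp add: F_def rsubst_hom[OF r] rconst_hom mult.assoc)
    also have "a powi (- int (Suc j)) * a = a powi (- int j)"
      using a power_int_add_1[of a "- int (Suc j)"] by simp
    finally show ?thesis by (simp add: F_def)
  qed
  have F0: "F d = F 0" using d by (simp add: F_def power_int_minus)
  have M0: "M 0 = 0" "M d = 0" using m by (simp_all add: M_def)
  \<comment> \<open>The index ranges \<open>1..d\<close> and \<open>0..<d\<close> describe the same orbit.\<close>
  have cyc: "(\<Sum>j=1..d. g j) = (\<Sum>j<d. g j)" if "g d = g 0" for g :: "nat \<Rightarrow> ratfun"
  proof -
    obtain k where k: "d = Suc k" using d(1) by (cases d) auto
    have "(\<Sum>j=1..d. g j) = (\<Sum>j<k. g (Suc j)) + g (Suc k)"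
      unfolding k by (simp add: sum.shift_bounds_Suc_ivl sum.atLeast1_atMost_eq)
    then show ?thesis using that by (simp add: k sum.lessThan_Suc_shift del: sum.lessThan_Suc)
  qed
  have "rsubst \<alpha>0 (rconst a * rX) = (\<Sum>j=1..d. of_int (M j) * rsubst (F j) (rconst a * rX))"
    unfolding \<alpha>0 by (simp add: rsubst_hom[OF r] flip: rconst_of_int)
  also have "\<dots> = (\<Sum>j<d. of_int (M (Suc j)) * F j)"
    by (simp add: sum.atLeast1_atMost_eq F_shift)
  finally have "rsubst \<alpha>0 (rconst a * rX) - \<alpha>0 = (\<Sum>j<d. of_int (M (Suc j)) * F j) - (\<Sum>j<d. of_int (M j) * F j)"
    unfolding \<alpha>0 by (subst (2) cyc) (simp_all add: M0)
  also have "\<dots> = (\<Sum>j<d. of_int (m j) * F j)"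
    by (simp add: sum_subtractf[symmetric] M_def algebra_simps)
  also have "\<dots> = (\<Sum>j<d. of_int (m j) * F j) + of_int (\<Sum>j<d. m j)" using m by simp
  also have "\<dots> = (\<Sum>j<d. of_int (m j) * (F j + 1))"
    by (simp add: sum.distrib algebra_simps)
  also have "\<dots> = (\<Sum>j<d. of_int (m j) * (rX / (rX - rconst (p * a ^ j))))"
  proof (rule sum.cong)
    fix j
    have "rconst (a powi (- int j)) * rX - rconst p = inverse (rconst (a ^ j)) * (rX - rconst (p * a ^ j))"
      using a by (simp add: power_int_minus rconst_inverse rconst_hom rconst_divide field_simps)
    then have "F j = rconst (p * a ^ j) / (rX - rconst (p * a ^ j))"
      by (simp add: F_def rconst_hom divide_inverse)
    then have "F j + 1 = rX / (rX - rconst (p * a ^ j))" by (simp add: divide_simps) (simp add: algebra_simps)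
    then show "of_int (m j) * (F j + 1) = of_int (m j) * (rX / (rX - rconst (p * a ^ j)))" by simp
  qed simp
  finally show ?thesis .
qed

text \<open>If there is a pole, its orbit is finite. Otherwise compare the coefficients of the Laurent polynomial \<open>\<alpha>\<close>:
  rotation multiplies the coefficient of \<open>t^(i - k)\<close> by \<open>a^(i - k)\<close>, and some coefficient
  with \<open>i \<noteq> k\<close> is nonzero.\<close>

lemma rotation_root_of_unity:
  assumes a: "a \<noteq> 0" and \<alpha>: "\<alpha> \<notin> range rconst"
    and P: "\<And>z. z \<noteq> 0 \<Longrightarrow> a * z \<in> nonzero_poles \<alpha> \<Longrightarrow> z \<in> nonzero_poles \<alpha>"
    and eq: "nonzero_poles \<alpha> = {} \<Longrightarrow> rsubst \<alpha> (rconst a * rX) = \<alpha> + rconst e"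
  shows "\<exists>k>0. a ^ k = 1"
proof -
  have diff: "\<exists>k>0. a ^ k = 1" if "i \<noteq> j" "a ^ i = a ^ j" for i j
  proof -
    have *: "\<exists>k>0. a ^ k = 1" if "i < j" "a ^ i = a ^ j" for i j
    proof -
      have "a ^ i * a ^ (j - i) = a ^ j" using that(1) by (simp flip: power_add)
      then show ?thesis using that a by (intro exI[of _ "j - i"]) simp
    qed
    show ?thesis using *[of i j] *[of j i] that by (metis nat_neq_iff)
  qed
  show ?thesis
  proof (cases "nonzero_poles \<alpha> = {}")
    case False
    then obtain z where z: "z \<in> nonzero_poles \<alpha>" by blast
    then have z0: "z \<noteq> 0" by (auto simp: nonzero_poles_def)
    have "z * inverse a ^ k \<in> nonzero_poles \<alpha>" for k
    proof (induction k)
      case (Suc k)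
      then show ?case using P[of "z * inverse a ^ Suc k"] z0 a by (simp add: field_simps)
    qed (use z in simp)
    then have "range (\<lambda>k. z * inverse a ^ k) \<subseteq> nonzero_poles \<alpha>" by blast
    then have "finite (range (\<lambda>k. z * inverse a ^ k))"
      using finite_nonzero_poles finite_subset by blast
    then have "\<not> inj (\<lambda>k::nat. z * inverse a ^ k)" using range_inj_infinite by blast
    then obtain i j :: nat where "i \<noteq> j" "inverse a ^ i = inverse a ^ j"
      using z0 by (auto simp: inj_on_def)
    then show ?thesis using diff[of i j] by (simp add: power_inverse)
  next
    case True
    have "\<alpha> \<in> laurent_adjoin {}" using A_space_self[of \<alpha>] True by (simp add: A_space_def)
    then obtain p d k where pdk: "\<alpha> = to_fract p / to_fract (monom d k)" "d \<noteq> 0"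
      using laurent_polynomial_quotient by metis
    define q where "q = monom d k"
    have qm: "q = monom d k" and d: "d \<noteq> 0" using pdk by (simp_all add: q_def)
    have pq: "\<alpha> = to_fract p / to_fract q" "q \<noteq> 0" using pdk by (simp_all add: q_def)
    have q: "to_fract q = rconst d * rX ^ k" by (simp add: qm to_fract_monom)
    have "\<exists>i. i \<noteq> k \<and> coeff p i \<noteq> 0"
    proof (rule ccontr)
      assume "\<not> ?thesis"
      then have "p = monom (coeff p k) k" by (intro poly_eqI) auto
      then have "to_fract p = rconst (coeff p k) * rX ^ k" by (metis to_fract_monom)
      then have "\<alpha> = rconst (coeff p k / d)" using d unfolding pq(1) q by (simp add: rconst_divide)
      then show False using \<alpha> by blast
    qed
    then obtain i where i: "i \<noteq> k" "coeff p i \<noteq> 0" by blast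
    note r = rotation_nonconst[OF a]
    have r': "rconst a * rX = to_fract [:0, a:]"
      using to_fract_monom[of a 1] by (simp add: monom_altdef)
    have pcq: "pcompose q [:0, a:] = smult (a ^ k) q"
    proof -
      have "to_fract (pcompose q [:0, a:]) = rconst d * (rconst a * rX) ^ k"
        unfolding peval_to_fract[symmetric] qm r'[symmetric]
        by (simp add: monom_altdef peval_smult peval_power peval_pCons peval_0)
      also have "\<dots> = peval (smult (a ^ k) q) rX"
        by (simp only: peval_smult) (simp only: peval_rX q rconst_power power_mult_distrib mult_ac)
      finally show ?thesis by (simp only: peval_rX to_fract_eq_iff)
    qed
    have "rsubst \<alpha> (rconst a * rX) = to_fract (pcompose p [:0, a:]) / to_fract (pcompose q [:0, a:])"
      using rsubst_quot'[OF r pq(2), of p] unfolding pq(1)[symmetric] r' peval_to_fract .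
    also have "to_fract (pcompose q [:0, a:]) = rconst (a ^ k) * to_fract q"
      unfolding pcq using peval_smult[of "a ^ k" q rX] by (simp add: peval_rX)
    finally have "\<alpha> + rconst e = to_fract (pcompose p [:0, a:]) / (rconst (a ^ k) * to_fract q)"
      unfolding eq[OF True] .
    moreover have "rconst (a ^ k) * to_fract q \<noteq> 0" using pq(2) a by simp
    ultimately have "to_fract (pcompose p [:0, a:]) = (\<alpha> + rconst e) * (rconst (a ^ k) * to_fract q)"
      by (metis nonzero_eq_divide_eq)
    also have "\<dots> = rconst (a ^ k) * (\<alpha> * to_fract q + rconst e * to_fract q)"
      by (simp only: algebra_simps)
    also have "\<alpha> * to_fract q = to_fract p" using pq(1,2) by simp
    finally have "to_fract (pcompose p [:0, a:]) = rconst (a ^ k) * (to_fract p + rconst e * to_fract q)" .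
    also have "\<dots> = to_fract ([:a ^ k:] * (p + [:e:] * q))"
      by (simp only: to_fract_mult to_fract_add rconst_def)
    finally have "pcompose p [:0, a:] = [:a ^ k:] * (p + [:e:] * q)" by (simp only: to_fract_eq_iff)
    then have "coeff (pcompose p [:0, a:]) i = coeff ([:a ^ k:] * (p + [:e:] * q)) i" by simp
    then have "a ^ i * coeff p i = a ^ k * coeff p i"
      using i(1) by (simp add: coeff_pcompose_linear qm)
    then show ?thesis using i diff by auto
  qed
qed

lemma primitive_root_exists:
  assumes "\<exists>k>0. a ^ k = (1::complex)"
  obtains d where "primitive_root_of_unity d a"
proof -
  let ?Q = "\<lambda>k. k > 0 \<and> a ^ k = 1"
  have "?Q (LEAST k. ?Q k)" using assms LeastI_ex[of ?Q] by blast
  moreover have "\<And>k. k < (LEAST k. ?Q k) \<Longrightarrow> \<not> ?Q k" by (rule not_less_Least)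
  ultimately show ?thesis using that unfolding primitive_root_of_unity_def by blast
qed

text \<open>Over the \<open>d\<close> rotations the differences \<open>\<alpha>(a t) - \<alpha>(t)\<close> telescope to 0. What remains is a
  linear relation between partial fractions, whose coefficients are the sums over the orbits.\<close>

lemma rotation_orbit_sums:
  assumes d: "0 < d" "a ^ d = 1" and P: "finite P" "0 \<notin> P" "\<And>z. z \<in> P \<Longrightarrow> z * a \<in> P"
    and eq: "rsubst \<alpha> (rconst a * rX) = \<alpha> + w"
    and w: "w = of_int e + (\<Sum>z\<in>P. of_int (m z) * (rX / (rX - rconst z)))"
  shows "e = 0" and "\<And>z. z \<in> P \<Longrightarrow> (\<Sum>i<d. m (z * a ^ i)) = 0"
proof -
  have a: "a \<noteq> 0" using d by (auto simp: power_0_left)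
  have aj: "rconst (a ^ j) * rX \<notin> range rconst" for j using a by (intro rotation_nonconst) simp
  note r = rotation_nonconst[OF a]
  have iter: "rsubst \<alpha> (rconst (a ^ j) * rX) = \<alpha> + (\<Sum>i<j. rsubst w (rconst (a ^ i) * rX))" for j
  proof (induction j)
    case 0
    then show ?case by (simp add: rsubst_ident)
  next
    case (Suc j)
    have "rsubst \<alpha> (rconst (a ^ Suc j) * rX) = rsubst (rsubst \<alpha> (rconst a * rX)) (rconst (a ^ j) * rX)"
      unfolding rsubst_rsubst[OF r aj] by (simp add: rsubst_hom[OF aj] rconst_hom) (simp add: mult_ac)
    also have "\<dots> = rsubst \<alpha> (rconst (a ^ j) * rX) + rsubst w (rconst (a ^ j) * rX)"
      unfolding eq by (rule rsubst_add[OF aj])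
    finally show ?case using Suc by simp
  qed
  have inP: "z * a ^ i \<in> P" if "z \<in> P" for z i
  proof (induction i)
    case (Suc i)
    then show ?case using P(3)[OF Suc] by (simp add: mult_ac)
  qed (use that in simp)
  have perm: "bij_betw (\<lambda>z. z * a ^ i) P P" for i
  proof -
    have "inj_on (\<lambda>z. z * a ^ i) P" using a by (simp add: inj_on_def)
    moreover have "(\<lambda>z. z * a ^ i) ` P \<subseteq> P" using inP by blast
    ultimately show ?thesis unfolding bij_betw_def using endo_inj_surj[OF P(1)] by blast
  qed
  have wi: "rsubst w (rconst (a ^ i) * rX) =
      of_int e + (\<Sum>z\<in>P. of_int (m (z * a ^ i)) * (rX / (rX - rconst z)))" for i
  proof -
    have ri: "rsubst (of_int k) (rconst (a ^ i) * rX) = of_int k" for k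
      by (simp flip: rconst_of_int)
    have "rsubst w (rconst (a ^ i) * rX) = of_int e +
       (\<Sum>z\<in>P. of_int (m z) * (rconst (a ^ i) * rX / (rconst (a ^ i) * rX - rconst z)))"
      unfolding w by (simp add: rsubst_hom[OF aj] ri)
    also have "(\<Sum>z\<in>P. of_int (m z) * (rconst (a ^ i) * rX / (rconst (a ^ i) * rX - rconst z))) =
       (\<Sum>z\<in>P. of_int (m (z * a ^ i)) * (rconst (a ^ i) * rX / (rconst (a ^ i) * rX - rconst (z * a ^ i))))"
      by (rule sum.reindex_bij_betw[OF perm, symmetric])
    also have "\<dots> = (\<Sum>z\<in>P. of_int (m (z * a ^ i)) * (rX / (rX - rconst z)))"
    proof (rule sum.cong)
      fix z
      have "rconst (a ^ i) * rX - rconst (z * a ^ i) = rconst (a ^ i) * (rX - rconst z)"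
        by (simp add: rconst_hom algebra_simps)
      then show "of_int (m (z * a ^ i)) * (rconst (a ^ i) * rX / (rconst (a ^ i) * rX - rconst (z * a ^ i))) =
         of_int (m (z * a ^ i)) * (rX / (rX - rconst z))" using a by simp
    qed simp
    finally show ?thesis .
  qed
  have "(\<Sum>i<d. rsubst w (rconst (a ^ i) * rX)) = 0"
    using iter[of d] d by (simp add: rsubst_ident)
  then have "of_nat d * of_int e + (\<Sum>z\<in>P. of_int (\<Sum>i<d. m (z * a ^ i)) * (rX / (rX - rconst z))) = 0"
    unfolding wi sum.distrib by (subst (asm) sum.swap) (simp add: sum_distrib_right sum_divide_distrib)
  then have *: "rconst (of_int (int d * e)) + (\<Sum>z\<in>P. rconst (of_int (\<Sum>i<d. m (z * a ^ i))) * (rX / (rX - rconst z))) = 0"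
    unfolding rconst_of_int by simp
  have "complex_of_int (int d * e) = 0" by (rule partial_fractions_independent(2)[OF P(1,2) *])
  then show "e = 0" using d by (simp only: of_int_eq_0_iff) simp
  show "(\<Sum>i<d. m (z * a ^ i)) = 0" if "z \<in> P" for z
  proof -
    have "complex_of_int (\<Sum>i<d. m (z * a ^ i)) = 0"
      using partial_fractions_independent(1)[OF P(1,2) *, OF that] .
    then show ?thesis by (simp only: of_int_eq_0_iff)
  qed
qed

lemma logder_unit:
  assumes "c \<noteq> 0" "finite P"
  shows "logder (rconst c * rX powi e * (\<Prod>z\<in>P. (rX - rconst z) powi m z)) =
    of_int e + (\<Sum>z\<in>P. of_int (m z) * (rX / (rX - rconst z)))"
  using assms by (simp add: logder_mult logder_powi logder_prod logder_rX_minus)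

text \<open>The unit \<open>u\<close> and the particular solution \<open>\<alpha>\<^sub>0\<close> with \<open>\<alpha>\<^sub>0(a t) - \<alpha>\<^sub>0(t) = \<partial>u/u\<close>, for poles
  \<open>p i a^j\<close> and exponents \<open>m i j\<close> that add up to 0 in each orbit.\<close>

definition rotation_unit ::
    "complex \<Rightarrow> complex \<Rightarrow> nat \<Rightarrow> nat \<Rightarrow> (nat \<Rightarrow> complex) \<Rightarrow> (nat \<Rightarrow> nat \<Rightarrow> int) \<Rightarrow> ratfun" where
  "rotation_unit a c d s p m = rconst c * (\<Prod>i=1..s. \<Prod>j<d. (rX - rconst (p i * a ^ j)) powi (m i j))"

definition rotation_particular ::
    "complex \<Rightarrow> nat \<Rightarrow> nat \<Rightarrow> (nat \<Rightarrow> complex) \<Rightarrow> (nat \<Rightarrow> nat \<Rightarrow> int) \<Rightarrow> ratfun" where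
  "rotation_particular a d s p m =
     (\<Sum>i=1..s. \<Sum>j=1..d. rconst (p i * of_int (\<Sum>k<j. m i k)) *
                  inverse (rconst (a powi (- int j)) * rX - rconst (p i)))"

lemma logder_rotation_unit:
  assumes "c \<noteq> 0"
  shows "logder (rotation_unit a c d s p m) =
    (\<Sum>i=1..s. \<Sum>j<d. of_int (m i j) * (rX / (rX - rconst (p i * a ^ j))))"
proof -
  have nz: "(\<Prod>j<d. (rX - rconst (p i * a ^ j)) powi (m i j)) \<noteq> 0" for i by simp
  then have "(\<Prod>i=1..s. \<Prod>j<d. (rX - rconst (p i * a ^ j)) powi (m i j)) \<noteq> 0"
    unfolding prod_zero_iff[OF finite_atLeastAtMost] by blast
  then have "logder (rotation_unit a c d s p m) =
      (\<Sum>i=1..s. logder (\<Prod>j<d. (rX - rconst (p i * a ^ j)) powi (m i j)))"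
    unfolding rotation_unit_def using assms nz by (subst logder_mult) (simp_all add: logder_prod)
  also have "\<dots> = (\<Sum>i=1..s. \<Sum>j<d. of_int (m i j) * (rX / (rX - rconst (p i * a ^ j))))"
    by (rule sum.cong[OF refl], subst logder_prod) (simp_all add: logder_powi logder_rX_minus)
  finally show ?thesis .
qed

lemma logder_rotation_unit_particular:
  assumes d: "0 < d" "a ^ d = 1" and c: "c \<noteq> 0" and m: "\<And>i. i \<in> {1..s} \<Longrightarrow> (\<Sum>j<d. m i j) = 0"
  shows "logder (rotation_unit a c d s p m) =
    rsubst (rotation_particular a d s p m) (rconst a * rX) - rotation_particular a d s p m"
proof -
  have a: "a \<noteq> 0" using d by (auto simp: power_0_left)
  note r = rotation_nonconst[OF a]
  show ?thesis
    unfolding logder_rotation_unit[OF c] rotation_particular_def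
      rsubst_sum[OF r, of _ "{1..s}"] sum_subtractf[symmetric]
    by (rule sum.cong[OF refl], rule orbit_telescope[OF d m, symmetric])
qed

text \<open>The unit \<open>u\<close> dictates the exponents \<open>m i j\<close>, and these determine the particular solution of
  the equation; the rest \<open>h\<close> of \<open>\<alpha>\<close> solves the homogeneous equation.\<close>

lemma rotation_forward:
  fixes a :: complex
  assumes a: "a \<noteq> 0" and \<alpha>: "\<alpha> \<notin> range rconst"
    and u: "u \<noteq> 0" and uA: "\<And>f. f \<in> A_space \<alpha> \<Longrightarrow> rsubst f (rconst a * rX) * u \<in> A_space \<alpha>"
    and eq: "rsubst \<alpha> (rconst a * rX) = \<alpha> + logder u"
  obtains d and s :: nat and p m h c where "primitive_root_of_unity d a"
    and "\<forall>i\<in>{1..s}. p i \<noteq> 0"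
    and "inj_on (\<lambda>(i, j). p i * a ^ j) ({1..s} \<times> {1..d})"
    and "A_space \<alpha> = laurent_adjoin ((\<lambda>(i, j). p i * a ^ j) ` ({1..s} \<times> {1..d}))"
    and "\<forall>i\<in>{1..s}. (\<Sum>j<d. m i j) = 0"
    and "h \<in> A_space \<alpha>" and "rsubst h (rconst a * rX) - h = 0"
    and "\<alpha> = rotation_particular a d s p m + h"
    and "c \<noteq> 0" and "u = rotation_unit a c d s p m"
proof -
  let ?P = "nonzero_poles \<alpha>"
  note r = rotation_nonconst[OF a]
  obtain c e m where P: "\<And>z. z \<noteq> 0 \<Longrightarrow> a * z \<in> ?P \<Longrightarrow> z \<in> ?P"
    and c: "c \<noteq> 0" and u_eq: "u = rconst c * rX powi e * (\<Prod>z\<in>?P. (rX - rconst z) powi m z)"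
    using twist_structure[of 1 a \<alpha> u] a \<alpha> u uA eq by auto
  have ld: "logder u = of_int e + (\<Sum>z\<in>?P. of_int (m z) * (rX / (rX - rconst z)))"
    unfolding u_eq using c finite_nonzero_poles by (rule logder_unit)
  have "\<exists>k>0. a ^ k = 1"
    by (rule rotation_root_of_unity[OF a \<alpha> P, of e]) (use eq ld in \<open>auto simp: rconst_of_int\<close>)
  then obtain d where root: "primitive_root_of_unity d a" using primitive_root_exists by blast
  then have d: "0 < d" "a ^ d = 1" by (auto simp: primitive_root_of_unity_def)
  have bwd: "z * inverse a ^ k \<in> ?P" if "z \<in> ?P" for z k
  proof (induction k)
    case (Suc k)
    have "z \<noteq> 0" using that by (auto simp: nonzero_poles_def)
    then show ?case using P[of "z * inverse a ^ Suc k"] Suc a by (simp add: field_simps)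
  qed (use that in simp)
  \<comment> \<open>The poles are known to be stable under division by \<open>a\<close>; multiplication by \<open>a\<close> is division by \<open>a\<close>
    carried out \<open>d - 1\<close> times.\<close>
  have fwd: "z * a \<in> ?P" if "z \<in> ?P" for z
  proof -
    have "a * a ^ (d - 1) = 1" using d by (simp flip: power_Suc)
    then have "inverse a ^ (d - 1) = a" using a by (simp add: field_simps power_inverse)
    then show ?thesis using bwd[OF that, of "d - 1"] by simp
  qed
  have sums: "e = 0" "\<And>z. z \<in> ?P \<Longrightarrow> (\<Sum>i<d. m (z * a ^ i)) = 0"
    using rotation_orbit_sums[OF d finite_nonzero_poles zero_not_in_nonzero_poles fwd eq ld] by blast+
  obtain s :: nat and p where sp: "inj_on (\<lambda>(i, j). p i * a ^ j) ({1..s} \<times> {1..d})"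
    "(\<lambda>(i, j). p i * a ^ j) ` ({1..s} \<times> {1..d}) = ?P"
    by (rule orbit_representatives[OF root finite_nonzero_poles zero_not_in_nonzero_poles fwd])
  have pP: "p i \<in> ?P" if "i \<in> {1..s}" for i
  proof -
    have "p i * a ^ d \<in> ?P" unfolding sp(2)[symmetric] using that d(1)
      by (intro image_eqI[of _ _ "(i, d)"]) auto
    then show ?thesis using d by simp
  qed
  define M where "M i j = m (p i * a ^ j)" for i j
  have M: "(\<Sum>j<d. M i j) = 0" if "i \<in> {1..s}" for i
    unfolding M_def using sums(2)[OF pP[OF that]] .
  define \<alpha>0 where "\<alpha>0 = rotation_particular a d s p M"
  have cyc: "(\<Prod>j=1..d. g j) = (\<Prod>j<d. g j)" if "g d = g 0" for g :: "nat \<Rightarrow> ratfun"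
  proof -
    obtain k where k: "d = Suc k" using d(1) by (cases d) auto
    have "(\<Prod>j=1..d. g j) = (\<Prod>j<k. g (Suc j)) * g (Suc k)"
      unfolding k by (simp add: prod.atLeast1_atMost_eq)
    then show ?thesis using that by (simp add: k prod.lessThan_Suc_shift mult.commute del: prod.lessThan_Suc)
  qed
  have "(\<Prod>z\<in>?P. (rX - rconst z) powi m z) =
      (\<Prod>(i, j)\<in>{1..s} \<times> {1..d}. (rX - rconst (p i * a ^ j)) powi M i j)"
    unfolding sp(2)[symmetric] by (subst prod.reindex[OF sp(1)]) (simp add: M_def case_prod_beta)
  also have "\<dots> = (\<Prod>i=1..s. \<Prod>j=1..d. (rX - rconst (p i * a ^ j)) powi M i j)"
    by (simp add: prod.cartesian_product)
  also have "\<dots> = (\<Prod>i=1..s. \<Prod>j<d. (rX - rconst (p i * a ^ j)) powi M i j)"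
    by (intro prod.cong cyc) (simp_all add: M_def d)
  finally have u': "u = rotation_unit a c d s p M"
    unfolding u_eq sums(1) rotation_unit_def by simp
  have ld': "logder u = rsubst \<alpha>0 (rconst a * rX) - \<alpha>0"
    unfolding u' \<alpha>0_def using d c M by (rule logder_rotation_unit_particular)
  have \<alpha>0A: "\<alpha>0 \<in> A_space \<alpha>"
    unfolding \<alpha>0_def rotation_particular_def A_space_def
  proof (intro laurent_adjoin_sum laurent_adjoin_mult laurent_adjoin_const)
    fix i j assume ij: "i \<in> {1..s}" "j \<in> {1..d}"
    have "p i * a ^ j \<in> ?P" unfolding sp(2)[symmetric] using ij by (intro image_eqI[of _ _ "(i, j)"]) auto
    then have "rconst (a ^ j) * inverse (rX - rconst (p i * a ^ j)) \<in> laurent_adjoin ?P"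
      by (intro laurent_adjoin_mult laurent_adjoin_inverse_minus) auto
    also have "rconst (a ^ j) * inverse (rX - rconst (p i * a ^ j)) =
        inverse (inverse (rconst (a ^ j)) * (rX - rconst (p i * a ^ j)))" by simp
    also have "inverse (rconst (a ^ j)) * (rX - rconst (p i * a ^ j)) = rconst (a powi (- int j)) * rX - rconst (p i)"
      using a by (simp add: power_int_minus rconst_inverse rconst_hom rconst_divide field_simps)
    finally show "inverse (rconst (a powi (- int j)) * rX - rconst (p i)) \<in> laurent_adjoin ?P" .
  qed
  have "\<alpha> - \<alpha>0 \<in> A_space \<alpha>"
    using A_space_self[of \<alpha>] \<alpha>0A by (simp add: A_space_def laurent_adjoin_diff)
  moreover have "rsubst (\<alpha> - \<alpha>0) (rconst a * rX) - (\<alpha> - \<alpha>0) = 0"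
    using eq ld' by (simp add: rsubst_hom[OF r])
  ultimately show ?thesis
    using that[of d s p M "\<alpha> - \<alpha>0" c] root sp M c u' pP
    by (auto simp: \<alpha>0_def A_space_def nonzero_poles_def)
qed

lemma rotation_backward:
  assumes root: "primitive_root_of_unity d a" and c: "c \<noteq> 0"
    and m: "\<And>i. i \<in> {1..s} \<Longrightarrow> (\<Sum>j<d. m i j) = 0"
    and h: "rsubst h (rconst a * rX) - h = 0"
    and \<alpha>: "\<alpha> = rotation_particular a d s p m + h"
  shows "rsubst \<alpha> (rconst a * rX) = \<alpha> + logder (rotation_unit a c d s p m)"
proof -
  have d: "0 < d" "a ^ d = 1" using root by (auto simp: primitive_root_of_unity_def)
  then have "a \<noteq> 0" by (auto simp: power_0_left)
  note r = rotation_nonconst[OF this]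
  have "logder (rotation_unit a c d s p m) =
      rsubst (rotation_particular a d s p m) (rconst a * rX) - rotation_particular a d s p m"
    using d c m by (rule logder_rotation_unit_particular)
  then show ?thesis using h unfolding \<alpha> by (simp add: rsubst_hom[OF r])
qed

section \<open>The case of an inversion\<close>

lemma inversion_nonconst: "a \<noteq> 0 \<Longrightarrow> rconst a * inverse rX \<notin> range rconst"
  using monomial_nonconst[of a "-1"] by (simp add: power_int_minus)

text \<open>The involution \<open>t \<mapsto> a/t\<close> exchanges the poles \<open>z\<close> and \<open>a/z\<close>, and at the same time the
  points 0 and infinity, which accounts for the constant.\<close>

lemma inversion_partial_fraction:
  assumes a: "a \<noteq> 0" and z: "z \<noteq> 0"
  shows "rsubst (rX / (rX - rconst z)) (rconst a * inverse rX) = 1 - rX / (rX - rconst (inverse z * a))"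
proof -
  note r = inversion_nonconst[OF a]
  have "rX - rconst (inverse z * a) \<noteq> 0" by (rule rX_minus_nonzero)
  moreover have zx: "rconst z * (rX - rconst (inverse z * a)) = rconst z * rX - rconst a"
    using z by (simp add: rconst_hom rconst_inverse algebra_simps)
  ultimately have nz: "rconst z * rX - rconst a \<noteq> 0" using z by (metis mult_eq_0_iff rconst_eq_0_iff)
  have "rsubst (rX / (rX - rconst z)) (rconst a * inverse rX) =
      rconst a * inverse rX / (rconst a * inverse rX - rconst z)"
    by (simp add: rsubst_hom[OF r])
  also have "\<dots> = rconst a / (rconst a - rconst z * rX)"
  proof -
    have "rconst a * inverse rX - rconst z = (rconst a - rconst z * rX) * inverse rX"
      by (simp add: left_diff_distrib mult.assoc)
    then show ?thesis by simp
  qed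
  also have "\<dots> = - rconst a / (rconst z * rX - rconst a)"
    by (metis minus_diff_eq minus_divide_divide)
  also have "\<dots> = 1 - rconst z * rX / (rconst z * rX - rconst a)"
    using nz by (simp add: diff_divide_eq_iff field_simps)
  also have "rconst z * rX / (rconst z * rX - rconst a) = rX / (rX - rconst (inverse z * a))"
    unfolding zx[symmetric] using z by simp
  finally show ?thesis .
qed

lemma inversion_involution:
  assumes a: "a \<noteq> 0"
  shows "rsubst (rsubst f (rconst a * inverse rX)) (rconst a * inverse rX) = f"
proof -
  note r = inversion_nonconst[OF a]
  have "rsubst (rconst a * inverse rX) (rconst a * inverse rX) = rX"
    using a by (simp add: rsubst_hom[OF r])
  then show ?thesis unfolding rsubst_rsubst[OF r r] by (simp add: rsubst_ident)
qed

subsection \<open>A particular solution\<close>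

text \<open>The unit \<open>u\<close> and the particular solution \<open>\<alpha>\<^sub>0\<close> with \<open>\<alpha>\<^sub>0(t) + \<alpha>\<^sub>0(a/t) = - \<partial>u/u\<close>.\<close>

definition inversion_unit :: "complex \<Rightarrow> complex \<Rightarrow> nat \<Rightarrow> (nat \<Rightarrow> complex) \<Rightarrow> (nat \<Rightarrow> int) \<Rightarrow> ratfun" where
  "inversion_unit a c s p m = rconst c * rX powi (m 0) *
     (\<Prod>i=1..s. (rX - rconst (p i)) powi (m i) * (rX - rconst (inverse (p i) * a)) powi (- m i))"

definition inversion_particular :: "complex \<Rightarrow> nat \<Rightarrow> (nat \<Rightarrow> complex) \<Rightarrow> (nat \<Rightarrow> int) \<Rightarrow> ratfun" where
  "inversion_particular a s p m = - rconst (of_int (m 0) / 2)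
                - (\<Sum>i=1..s. rconst (of_int (m i) / 2) *
                    ((rconst ((p i)\<^sup>2 - a) * rX) /
                      ((rX - rconst (p i)) * (rconst (p i) * rX - rconst a))))"

lemma inversion_unit_nonzero: "c \<noteq> 0 \<Longrightarrow> inversion_unit a c s p m \<noteq> 0"
  by (simp add: inversion_unit_def)

lemma logder_inversion_unit:
  assumes c: "c \<noteq> 0"
  shows "logder (inversion_unit a c s p m) = of_int (m 0) +
     (\<Sum>i=1..s. of_int (m i) * (rX / (rX - rconst (p i)) - rX / (rX - rconst (inverse (p i) * a))))"
proof -
  have nz: "(rX - rconst (p i)) powi (m i) * (rX - rconst (inverse (p i) * a)) powi (- m i) \<noteq> 0" for i
    by simp
  have "logder (inversion_unit a c s p m) = of_int (m 0) +
      (\<Sum>i=1..s. logder ((rX - rconst (p i)) powi (m i) * (rX - rconst (inverse (p i) * a)) powi (- m i)))"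
    unfolding inversion_unit_def using c nz
    by (subst logder_mult; simp add: logder_mult logder_powi logder_prod)
  also have "\<dots> = of_int (m 0) +
     (\<Sum>i=1..s. of_int (m i) * (rX / (rX - rconst (p i)) - rX / (rX - rconst (inverse (p i) * a))))"
    by (simp add: logder_mult logder_powi logder_rX_minus algebra_simps)
  finally show ?thesis .
qed

lemma rsubst_logder_inversion_unit:
  assumes a: "a \<noteq> 0" and c: "c \<noteq> 0" and p: "\<And>i. i \<in> {1..s} \<Longrightarrow> p i \<noteq> 0"
  shows "rsubst (logder (inversion_unit a c s p m)) (rconst a * inverse rX) = logder (inversion_unit a c s p m)"
proof -
  note r = inversion_nonconst[OF a]
  have ri: "rsubst (of_int k) (rconst a * inverse rX) = of_int k" for k
    by (simp flip: rconst_of_int)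
  have "rsubst (logder (inversion_unit a c s p m)) (rconst a * inverse rX) = of_int (m 0) +
     (\<Sum>i=1..s. of_int (m i) * (rsubst (rX / (rX - rconst (p i))) (rconst a * inverse rX)
        - rsubst (rX / (rX - rconst (inverse (p i) * a))) (rconst a * inverse rX)))"
    unfolding logder_inversion_unit[OF c]
    by (simp only: rsubst_add[OF r] rsubst_sum[OF r] rsubst_mult[OF r] rsubst_diff[OF r] ri)
  also have "\<dots> = logder (inversion_unit a c s p m)"
    unfolding logder_inversion_unit[OF c]
  proof (intro arg_cong2[of _ _ _ _ "(+)"] refl sum.cong)
    fix i assume "i \<in> {1..s}"
    then have pi: "p i \<noteq> 0" "inverse (p i) * a \<noteq> 0" using p a by auto
    have "inverse (inverse (p i) * a) * a = p i" using pi a by (simp add: field_simps)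
    then show "of_int (m i) * (rsubst (rX / (rX - rconst (p i))) (rconst a * inverse rX)
        - rsubst (rX / (rX - rconst (inverse (p i) * a))) (rconst a * inverse rX)) =
       of_int (m i) * (rX / (rX - rconst (p i)) - rX / (rX - rconst (inverse (p i) * a)))"
      unfolding inversion_partial_fraction[OF a pi(1)] inversion_partial_fraction[OF a pi(2)] by simp
  qed
  finally show ?thesis .
qed

text \<open>Since the logarithmic derivative of the unit is invariant under the involution, minus its half solves
  \<open>\<alpha>(t) + \<alpha>(a/t) = - \<partial>u/u\<close>.\<close>

lemma inversion_particular_eq:
  assumes c: "c \<noteq> 0" and p: "\<And>i. i \<in> {1..s} \<Longrightarrow> p i \<noteq> 0"
  shows "inversion_particular a s p m = rconst (- 1 / 2) * logder (inversion_unit a c s p m)"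
proof -
  have pf: "(rconst ((p i)\<^sup>2 - a) * rX) / ((rX - rconst (p i)) * (rconst (p i) * rX - rconst a)) =
     rX / (rX - rconst (p i)) - rX / (rX - rconst (inverse (p i) * a))" if "i \<in> {1..s}" for i
  proof -
    let ?p = "p i"
    have pi: "?p \<noteq> 0" using p that by blast
    have zx: "rconst ?p * (rX - rconst (inverse ?p * a)) = rconst ?p * rX - rconst a"
      using pi by (simp add: rconst_hom rconst_inverse algebra_simps)
    have nz: "rconst ?p * rX - rconst a \<noteq> 0" "rX - rconst ?p \<noteq> 0"
      unfolding zx[symmetric] using pi rX_minus_nonzero[of "inverse ?p * a"] by auto
    have eq: "rX / (rX - rconst (inverse ?p * a)) = rconst ?p * rX / (rconst ?p * rX - rconst a)"
      unfolding zx[symmetric] using pi by simp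
    have "rX / (rX - rconst ?p) - rX / (rX - rconst (inverse ?p * a)) =
       (rX * (rconst ?p * rX - rconst a) - rconst ?p * rX * (rX - rconst ?p)) /
         ((rX - rconst ?p) * (rconst ?p * rX - rconst a))"
      unfolding eq by (rule diff_frac_eq[OF nz(2,1)])
    also have "rX * (rconst ?p * rX - rconst a) - rconst ?p * rX * (rX - rconst ?p) = rconst (?p\<^sup>2 - a) * rX"
      by (simp add: rconst_hom rconst_hom' power2_eq_square algebra_simps)
    finally show ?thesis ..
  qed
  have "inversion_particular a s p m = - rconst (of_int (m 0) / 2)
                - (\<Sum>i=1..s. rconst (of_int (m i) / 2) *
                    (rX / (rX - rconst (p i)) - rX / (rX - rconst (inverse (p i) * a))))"
    unfolding inversion_particular_def by (simp only: pf cong: sum.cong)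
  also have "\<dots> = rconst (- 1 / 2) * logder (inversion_unit a c s p m)"
    unfolding logder_inversion_unit[OF c]
    by (simp add: rconst_divide rconst_hom' rconst_of_int distrib_left sum_distrib_left sum_negf[symmetric])
  finally show ?thesis .
qed

subsection \<open>Antisymmetric functions\<close>

text \<open>The shape of the antisymmetric part of \<open>\<alpha>\<close>. The numbers of factors are parameters because
  both can be enlarged by a cancelling pair, which is needed to make them positive.\<close>

definition antisym_form :: "complex \<Rightarrow> complex set \<Rightarrow> nat \<Rightarrow> nat \<Rightarrow> ratfun \<Rightarrow> bool" where
  "antisym_form a P l r h \<longleftrightarrow> (\<exists>(b :: complex) (k :: int) (lam :: nat \<Rightarrow> complex) (mu :: nat \<Rightarrow> complex).
     int r = int l + k + 1 \<and> (\<forall>i\<in>{1..l}. lam i \<noteq> 0) \<and> (\<forall>i\<in>{1..r}. mu i \<in> P) \<and>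
     h = rconst b * (rX powi k * (rX\<^sup>2 - rconst a) *
                    (\<Prod>i=1..l. (rX - rconst (lam i)) * (rconst (lam i) * rX - rconst a)) /
                    (\<Prod>i=1..r. (rX - rconst (mu i)) * (rconst (mu i) * rX - rconst a))))"

text \<open>Up to the factor \<open>z\<close> this is \<open>w - (z + a/z)\<close> for the invariant \<open>w = t + a/t\<close>.\<close>

definition sym_factor :: "complex \<Rightarrow> complex \<Rightarrow> ratfun" where
  "sym_factor a z = (rX - rconst z) * (rconst z * rX - rconst a) / rX"

lemma antisym_form_base: "antisym_form a P 0 0 (rconst b * (rX - rconst a * inverse rX))"
  unfolding antisym_form_def
  by (rule exI[of _ b], rule exI[of _ "-1"])
    (simp add: power_int_minus power2_eq_square field_simps)

lemma antisym_form_mult: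
  assumes "antisym_form a P l r h" "z \<noteq> 0"
  shows "antisym_form a P (Suc l) r (h * sym_factor a z)"
proof -
  obtain b k lam mu where *: "int r = int l + k + 1" "\<forall>i\<in>{1..l}. lam i \<noteq> 0" "\<forall>i\<in>{1..r}. mu i \<in> P"
     "h = rconst b * (rX powi k * (rX\<^sup>2 - rconst a) *
                    (\<Prod>i=1..l. (rX - rconst (lam i)) * (rconst (lam i) * rX - rconst a)) /
                    (\<Prod>i=1..r. (rX - rconst (mu i)) * (rconst (mu i) * rX - rconst a)))"
    using assms(1) unfolding antisym_form_def by blast
  show ?thesis unfolding antisym_form_def
  proof (intro exI conjI)
    show "int r = int (Suc l) + (k - 1) + 1" using *(1) by simp
    show "\<forall>i\<in>{1..Suc l}. (lam(Suc l := z)) i \<noteq> 0" using *(2) assms(2) by auto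
    have "(\<Prod>i=1..l. (rX - rconst ((lam(Suc l := z)) i)) * (rconst ((lam(Suc l := z)) i) * rX - rconst a)) =
      (\<Prod>i=1..l. (rX - rconst (lam i)) * (rconst (lam i) * rX - rconst a))"
      by (rule prod.cong) auto
    then have Suc: "(\<Prod>i=1..Suc l. (rX - rconst ((lam(Suc l := z)) i)) * (rconst ((lam(Suc l := z)) i) * rX - rconst a)) =
      (\<Prod>i=1..l. (rX - rconst (lam i)) * (rconst (lam i) * rX - rconst a)) * ((rX - rconst z) * (rconst z * rX - rconst a))"
      by (simp add: prod.cl_ivl_Suc)
    show "h * sym_factor a z = rconst b * (rX powi (k - 1) * (rX\<^sup>2 - rconst a) *
        (\<Prod>i=1..Suc l. (rX - rconst ((lam(Suc l := z)) i)) * (rconst ((lam(Suc l := z)) i) * rX - rconst a)) /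
        (\<Prod>i=1..r. (rX - rconst (mu i)) * (rconst (mu i) * rX - rconst a)))"
      unfolding *(4) Suc sym_factor_def by (simp add: power_int_diff mult_ac)
  qed (use *(3) in simp)
qed

lemma antisym_form_divide:
  assumes "antisym_form a P l r h" "z \<in> P"
  shows "antisym_form a P l (Suc r) (h / sym_factor a z)"
proof -
  obtain b k lam mu where *: "int r = int l + k + 1" "\<forall>i\<in>{1..l}. lam i \<noteq> 0" "\<forall>i\<in>{1..r}. mu i \<in> P"
     "h = rconst b * (rX powi k * (rX\<^sup>2 - rconst a) *
                    (\<Prod>i=1..l. (rX - rconst (lam i)) * (rconst (lam i) * rX - rconst a)) /
                    (\<Prod>i=1..r. (rX - rconst (mu i)) * (rconst (mu i) * rX - rconst a)))"
    using assms(1) unfolding antisym_form_def by blast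
  show ?thesis unfolding antisym_form_def
  proof (intro exI conjI)
    show "int (Suc r) = int l + (k + 1) + 1" using *(1) by simp
    show "\<forall>i\<in>{1..Suc r}. (mu(Suc r := z)) i \<in> P" using *(3) assms(2) by auto
    have "(\<Prod>i=1..r. (rX - rconst ((mu(Suc r := z)) i)) * (rconst ((mu(Suc r := z)) i) * rX - rconst a)) =
      (\<Prod>i=1..r. (rX - rconst (mu i)) * (rconst (mu i) * rX - rconst a))"
      by (rule prod.cong) auto
    then have Suc: "(\<Prod>i=1..Suc r. (rX - rconst ((mu(Suc r := z)) i)) * (rconst ((mu(Suc r := z)) i) * rX - rconst a)) =
      (\<Prod>i=1..r. (rX - rconst (mu i)) * (rconst (mu i) * rX - rconst a)) * ((rX - rconst z) * (rconst z * rX - rconst a))"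
      by (simp add: prod.cl_ivl_Suc)
    show "h / sym_factor a z = rconst b * (rX powi (k + 1) * (rX\<^sup>2 - rconst a) *
        (\<Prod>i=1..l. (rX - rconst (lam i)) * (rconst (lam i) * rX - rconst a)) /
        (\<Prod>i=1..Suc r. (rX - rconst ((mu(Suc r := z)) i)) * (rconst ((mu(Suc r := z)) i) * rX - rconst a)))"
      unfolding *(4) Suc sym_factor_def by (simp add: power_int_add mult_ac)
  qed (use *(2) in simp)
qed

lemma sym_factor_invariant:
  assumes a: "a \<noteq> 0"
  shows "rsubst (sym_factor a z) (rconst a * inverse rX) = sym_factor a z"
proof -
  note r = inversion_nonconst[OF a]
  have "rsubst (sym_factor a z) (rconst a * inverse rX) =
    (rconst a * inverse rX - rconst z) * (rconst z * (rconst a * inverse rX) - rconst a) / (rconst a * inverse rX)"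
    by (simp add: sym_factor_def rsubst_hom[OF r])
  also have "\<dots> = sym_factor a z"
    using a by (simp add: sym_factor_def divide_simps) (simp add: algebra_simps)
  finally show ?thesis .
qed

lemma sym_factor_nonzero: 
  assumes "a \<noteq> 0"
  shows "sym_factor a z \<noteq> 0"
proof -
  have "rconst z * rX \<noteq> rconst a"
  proof (cases "z = 0")
    case False
    then show ?thesis using rotation_nonconst by blast
  qed (use assms in simp)
  then show ?thesis by (simp add: sym_factor_def)
qed

text \<open>Thanks to the relation between \<open>k\<close>, \<open>l\<close> and \<open>r\<close>, all powers of \<open>t\<close> can be distributed over the
  factors in such a way that \<open>t - a/t\<close> is multiplied by invariant functions only.\<close>

lemma antisym_form_antisymmetric:
  assumes a: "a \<noteq> 0" and h: "antisym_form a P l r h"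
  shows "rsubst h (rconst a * inverse rX) = - h"
proof -
  obtain b k lam mu where *: "int r = int l + k + 1"
     "h = rconst b * (rX powi k * (rX\<^sup>2 - rconst a) *
                    (\<Prod>i=1..l. (rX - rconst (lam i)) * (rconst (lam i) * rX - rconst a)) /
                    (\<Prod>i=1..r. (rX - rconst (mu i)) * (rconst (mu i) * rX - rconst a)))"
    using h unfolding antisym_form_def by blast
  note nc = inversion_nonconst[OF a]
  have prod: "(\<Prod>i=1..l. (rX - rconst (f i)) * (rconst (f i) * rX - rconst a)) =
     rX ^ l * (\<Prod>i=1..l. sym_factor a (f i))" for f :: "nat \<Rightarrow> complex" and l
    by (simp add: sym_factor_def prod_dividef)
  have h_eq: "h = rconst b * (rX - rconst a * inverse rX) * (\<Prod>i=1..l. sym_factor a (lam i)) / (\<Prod>i=1..r. sym_factor a (mu i))"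
  proof -
    have "k = int r - int l - 1" using *(1) by simp
    then have "rX powi k = rX ^ r / rX ^ l / rX" by (simp add: power_int_diff)
    then show ?thesis unfolding *(2) prod by (simp add: divide_simps power2_eq_square)
  qed
  have anti: "rsubst (rX - rconst a * inverse rX) (rconst a * inverse rX) = - (rX - rconst a * inverse rX)"
    using a by (simp add: rsubst_hom[OF nc])
  show ?thesis
    unfolding h_eq
    by (simp only: rsubst_mult[OF nc] rsubst_divide[OF nc] rsubst_prod[OF nc] rsubst_rconst anti
        sym_factor_invariant[OF a] mult_minus_left mult_minus_right minus_divide_left)
qed

lemma laurent_polynomial_cases:
  assumes "f \<in> laurent_adjoin {}"
  obtains p k where "f = rX powi k * to_fract p"
proof -
  obtain p d k where f: "f = to_fract p / to_fract (monom d k)" "d \<noteq> 0"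
    using laurent_polynomial_quotient[OF assms] by metis
  have "to_fract (smult c p) = rconst c * to_fract p" for c
    using peval_smult[of c p rX] by (simp only: peval_rX)
  then have "f = rX powi (- int k) * to_fract (smult (inverse d) p)"
    unfolding f(1) to_fract_monom by (simp add: rconst_inverse power_int_minus divide_inverse mult_ac)
  then show ?thesis using that by blast
qed

text \<open>Recursion for \<open>X^k - Y^k\<close> in terms of \<open>X + Y\<close> and \<open>X Y = a\<close>; negative exponents reduce to positive ones.\<close>

lemma antisym_monomial:
  fixes k :: int
  assumes a: "a \<noteq> 0"
  defines "Y \<equiv> rconst a * inverse rX"
  shows "\<exists>Q. rX powi k - Y powi k = (rX - Y) * peval Q (rX + Y)"
proof -
  have XY: "rX * Y = rconst a" by (simp add: Y_def)
  have nat: "\<exists>Q. rX ^ j - Y ^ j = (rX - Y) * peval Q (rX + Y)" for j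
  proof (induction j rule: less_induct)
    case (less j)
    consider "j = 0" | "j = 1" | i where "j = Suc (Suc i)" by (cases j; cases "j - 1") auto
    then show ?case
    proof cases
      case 1
      then show ?thesis by (intro exI[of _ 0]) (simp add: peval_0)
    next
      case 2
      then show ?thesis by (intro exI[of _ 1]) simp
    next
      case (3 i)
      obtain Q where Q: "rX ^ Suc i - Y ^ Suc i = (rX - Y) * peval Q (rX + Y)"
        using less[of "Suc i"] 3 by auto
      obtain R where R: "rX ^ i - Y ^ i = (rX - Y) * peval R (rX + Y)"
        using less[of i] 3 by auto
      have "rX ^ j - Y ^ j = (rX + Y) * (rX ^ Suc i - Y ^ Suc i) - (rX * Y) * (rX ^ i - Y ^ i)"
        unfolding 3 by (simp add: algebra_simps)
      also have "\<dots> = (rX - Y) * peval (pCons 0 Q - smult a R) (rX + Y)"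
        unfolding Q R XY by (simp add: peval_pCons peval_diff peval_smult algebra_simps)
      finally show ?thesis by blast
    qed
  qed
  show ?thesis
  proof (cases "k \<ge> 0")
    case True
    then show ?thesis using nat[of "nat k"] by (simp add: power_int_def)
  next
    case False
    define j where "j = nat (- k)"
    obtain Q where Q: "rX ^ j - Y ^ j = (rX - Y) * peval Q (rX + Y)" using nat by blast
    have nz: "rX \<noteq> 0" "Y \<noteq> 0" using a by (auto simp: Y_def)
    have "rX powi k - Y powi k = inverse (rX ^ j) - inverse (Y ^ j)"
      using False by (simp add: power_int_def j_def power_inverse)
    also have "\<dots> = - (inverse ((rX * Y) ^ j) * (rX ^ j - Y ^ j))"
      using nz by (simp add: power_mult_distrib field_simps)
    also have "\<dots> = (rX - Y) * peval (smult (- inverse (a ^ j)) Q) (rX + Y)"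
      unfolding Q XY by (simp add: peval_smult peval_uminus rconst_inverse rconst_power)
    finally show ?thesis by blast
  qed
qed

text \<open>The antisymmetrization of a Laurent polynomial is \<open>t - a/t\<close> times a polynomial in the invariant
  \<open>t + a/t\<close>, by linearity from the case of monomials.\<close>

lemma antisym_laurent_polynomial:
  assumes a: "a \<noteq> 0" and f: "f \<in> laurent_adjoin {}"
  defines "Y \<equiv> rconst a * inverse rX"
  shows "\<exists>Q. f - rsubst f Y = (rX - Y) * peval Q (rX + Y)"
proof -
  note nc = inversion_nonconst[OF a, folded Y_def]
  have "\<exists>Q. rX powi k * to_fract p - rsubst (rX powi k * to_fract p) Y = (rX - Y) * peval Q (rX + Y)" for p k
  proof (induction p arbitrary: k)
    case 0
    show ?case by (intro exI[of _ 0]) (simp add: peval_0)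
  next
    case (pCons c p)
    obtain Q where Q: "rX powi (k + 1) * to_fract p - rsubst (rX powi (k + 1) * to_fract p) Y = (rX - Y) * peval Q (rX + Y)"
      using pCons.IH by blast
    obtain R where R: "rX powi k - Y powi k = (rX - Y) * peval R (rX + Y)"
      using antisym_monomial[OF a] unfolding Y_def by blast
    have split: "rX powi k * to_fract (pCons c p) = rconst c * rX powi k + rX powi (k + 1) * to_fract p"
      using peval_pCons[of c p rX] by (simp add: peval_rX power_int_add algebra_simps)
    have "rX powi k * to_fract (pCons c p) - rsubst (rX powi k * to_fract (pCons c p)) Y =
       rconst c * (rX powi k - Y powi k) + (rX powi (k + 1) * to_fract p - rsubst (rX powi (k + 1) * to_fract p) Y)"
      unfolding split rsubst_add[OF nc]
      by (simp add: rsubst_mult[OF nc, of "rconst c"] rsubst_powi[OF nc] right_diff_distrib)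
    also have "\<dots> = (rX - Y) * peval (smult c R + Q) (rX + Y)"
      unfolding Q R by (simp add: peval_add peval_smult algebra_simps)
    finally show ?case by blast
  qed
  moreover obtain p k where "f = rX powi k * to_fract p" using f by (rule laurent_polynomial_cases)
  ultimately show ?thesis by metis
qed

lemma sym_factor_root:
  assumes a: "a \<noteq> 0"
  obtains z where "z \<noteq> 0" "rX + rconst a * inverse rX - rconst \<rho> = rconst (inverse z) * sym_factor a z"
proof -
  \<comment> \<open>A root of \<open>z\<^sup>2 - \<rho> z + a\<close>, so that \<open>z + a/z = \<rho>\<close>.\<close>
  define z where "z = (\<rho> + csqrt (\<rho>\<^sup>2 - 4 * a)) / 2"
  have "(2 * z - \<rho>)\<^sup>2 = \<rho>\<^sup>2 - 4 * a" by (simp add: z_def)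
  then have "4 * (z\<^sup>2 + a) = 4 * (\<rho> * z)" by (simp add: power2_eq_square algebra_simps)
  then have z: "z\<^sup>2 + a = \<rho> * z" by (simp only: mult_cancel_left) simp
  have z0: "z \<noteq> 0"
  proof
    assume "z = 0"
    then show False using z a by simp
  qed
  have "\<rho> = (z\<^sup>2 + a) / z" unfolding z using z0 by simp
  also have "\<dots> = z + a / z" using z0 by (simp add: add_divide_distrib power2_eq_square)
  finally have "rconst \<rho> = rconst z + rconst a / rconst z" by (simp only: rconst_hom rconst_divide)
  moreover have "rX + rconst a * inverse rX - (rconst z + rconst a / rconst z) = rconst (inverse z) * sym_factor a z"
    unfolding sym_factor_def using z0
    by (simp add: rconst_inverse rconst_divide divide_simps) (simp add: algebra_simps)
  ultimately have "rX + rconst a * inverse rX - rconst \<rho> = rconst (inverse z) * sym_factor a z"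
    by (simp only:)
  then show ?thesis using that z0 by blast
qed

text \<open>Multiplying by a high power of the product of the invariant factors removes all nonzero poles without
  affecting antisymmetry. The statement is about all large exponents so that it passes to sums and products.\<close>

lemma clear_denominators:
  assumes P: "finite P" and h: "h \<in> laurent_adjoin P"
  shows "\<exists>N. \<forall>M\<ge>N. h * (\<Prod>z\<in>P. sym_factor a z) ^ M \<in> laurent_adjoin {}"
proof -
  let ?W = "\<Prod>z\<in>P. sym_factor a z"
  have fac: "sym_factor a z \<in> laurent_adjoin {}" for z
    unfolding sym_factor_def divide_inverse
    by (intro laurent_adjoin_mult laurent_adjoin_diff laurent_adjoin_const laurent_adjoin_rX laurent_adjoin_inverse_rX)
  then have W: "?W ^ M \<in> laurent_adjoin {}" for M
    by (intro laurent_adjoin_power laurent_adjoin_prod)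
  from h show ?thesis unfolding laurent_adjoin_def[of P]
  proof induction
    case (const c)
    then show ?case using W by (auto intro!: exI[of _ 0] laurent_adjoin_mult)
  next
    case (gen f)
    then consider "f = rX" | "f = inverse rX" | z where "z \<in> P" "f = inverse (rX - rconst z)"
      by blast
    then show ?case
    proof cases
      case (3 z)
      have "f * ?W ^ M \<in> laurent_adjoin {}" if M1: "M \<ge> 1" for M
      proof -
        obtain M' where M: "M = Suc M'" using M1 by (cases M) auto
        have "f * ?W = (rconst z * rX - rconst a) * inverse rX * (\<Prod>y\<in>P-{z}. sym_factor a y)"
          unfolding 3 prod.remove[OF P 3(1)] sym_factor_def[of a z] by (simp add: divide_inverse)
        also have "\<dots> \<in> laurent_adjoin {}"
          by (intro laurent_adjoin_mult laurent_adjoin_diff laurent_adjoin_prod fac) auto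
        finally have "f * ?W * ?W ^ M' \<in> laurent_adjoin {}" by (rule laurent_adjoin_mult[OF _ W])
        then show ?thesis by (simp add: M mult.assoc)
      qed
      then show ?thesis by blast
    qed (use W in \<open>auto intro!: exI[of _ 0] laurent_adjoin_mult\<close>)
  next
    case (add f g)
    then obtain N1 N2 where N: "\<And>M. M \<ge> N1 \<Longrightarrow> f * ?W ^ M \<in> laurent_adjoin {}"
      "\<And>M. M \<ge> N2 \<Longrightarrow> g * ?W ^ M \<in> laurent_adjoin {}" by blast
    show ?case
      by (rule exI[of _ "max N1 N2"]) (use N in \<open>auto simp: distrib_right intro!: laurent_adjoin_add\<close>)
  next
    case (mult f g)
    then obtain N1 N2 where N: "\<And>M. M \<ge> N1 \<Longrightarrow> f * ?W ^ M \<in> laurent_adjoin {}"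
      "\<And>M. M \<ge> N2 \<Longrightarrow> g * ?W ^ M \<in> laurent_adjoin {}" by blast
    have "f * g * ?W ^ M \<in> laurent_adjoin {}" if "M \<ge> N1 + N2" for M
    proof -
      have "?W ^ M = ?W ^ N1 * ?W ^ (M - N1)" using that by (simp flip: power_add)
      then have "f * g * ?W ^ M = (f * ?W ^ N1) * (g * ?W ^ (M - N1))" by (simp add: mult_ac)
      also have "\<dots> \<in> laurent_adjoin {}"
        using that by (intro laurent_adjoin_mult[OF N(1) N(2)]) auto
      finally show ?thesis .
    qed
    then show ?case by blast
  qed
qed

text \<open>After the denominators are cleared by invariant factors, \<open>h\<close> is \<open>t - a/t\<close> times a
  polynomial in \<open>t + a/t\<close>, which splits into linear factors over the complex numbers.\<close>

lemma antisym_form_exists: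
  assumes a: "a \<noteq> 0" and P: "finite P" "0 \<notin> P" and h: "h \<in> laurent_adjoin P"
    and anti: "rsubst h (rconst a * inverse rX) = - h"
  obtains l r where "antisym_form a P l r h" "P \<noteq> {} \<longrightarrow> 0 < l \<and> 0 < r"
proof -
  define Y where "Y = rconst a * inverse rX"
  note nc = inversion_nonconst[OF a, folded Y_def]
  define W where "W = (\<Prod>z\<in>P. sym_factor a z)"
  have W0: "W \<noteq> 0" using P(1) sym_factor_nonzero[OF a] by (simp add: W_def)
  obtain M where M: "h * W ^ M \<in> laurent_adjoin {}" using clear_denominators[OF P(1) h, of a] by (auto simp: W_def)
  have "rsubst W Y = W" by (simp add: W_def rsubst_prod[OF nc]) (simp add: Y_def sym_factor_invariant[OF a])
  then have "rsubst (h * W ^ M) Y = - (h * W ^ M)"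
    unfolding rsubst_mult[OF nc] rsubst_power[OF nc] anti[folded Y_def] by simp
  moreover obtain Q where "h * W ^ M - rsubst (h * W ^ M) Y = (rX - Y) * peval Q (rX + Y)"
    using antisym_laurent_polynomial[OF a M] unfolding Y_def by blast
  ultimately have Q: "rconst 2 * (h * W ^ M) = (rX - Y) * peval Q (rX + Y)"
    by (simp only: rconst_numeral diff_minus_eq_add mult_2)
  obtain root where root: "\<And>r. peval Q r = rconst (lead_coeff Q) * (\<Prod>i<degree Q. (r - rconst (root i)))"
    using peval_split[of Q] by metis
  have "\<exists>z. z \<noteq> 0 \<and> rX + Y - rconst \<rho> = rconst (inverse z) * sym_factor a z" for \<rho>
    using sym_factor_root[OF a, of \<rho>] unfolding Y_def by metis
  then obtain lam where lam: "\<And>\<rho>. lam \<rho> \<noteq> 0" "\<And>\<rho>. rX + Y - rconst \<rho> = rconst (inverse (lam \<rho>)) * sym_factor a (lam \<rho>)"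
    by metis
  have num: "antisym_form a P j 0 (rconst b * (rX - Y) * (\<Prod>i<j. sym_factor a (lam (root i))))" for b j
  proof (induction j)
    case 0
    then show ?case using antisym_form_base by (simp add: Y_def)
  next
    case (Suc j)
    then show ?case using antisym_form_mult[OF Suc lam(1)] by (simp add: mult.assoc)
  qed
  define b where "b = lead_coeff Q / 2 * (\<Prod>i<degree Q. inverse (lam (root i)))"
  have "h * W ^ M = rconst (1 / 2) * ((rX - Y) * peval Q (rX + Y))"
    unfolding Q[symmetric] by (simp add: rconst_divide)
  also have "\<dots> = rconst b * (rX - Y) * (\<Prod>i<degree Q. sym_factor a (lam (root i)))"
  proof -
    have c: "rconst (\<Prod>i\<in>A. g i) = (\<Prod>i\<in>A. rconst (g i))" for g :: "nat \<Rightarrow> complex" and A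
      by (induction A rule: infinite_finite_induct) (auto simp: rconst_hom)
    show ?thesis
      unfolding root lam(2) b_def by (simp add: c rconst_hom rconst_divide prod.distrib mult_ac)
  qed
  finally have "antisym_form a P (degree Q) 0 (h * W ^ M)" using num by simp
  moreover have div: "\<exists>r. antisym_form a P l r (g / W ^ j)" if "antisym_form a P l 0 g" for l g j
  proof -
    have one: "\<exists>r'. antisym_form a P l r' (g / (\<Prod>z\<in>S. sym_factor a z))"
      if "finite S" "S \<subseteq> P" "antisym_form a P l r g" for S l r g
      using that
    proof (induction S rule: finite_induct)
      case empty
      then show ?case by auto
    next
      case (insert z S)
      then obtain r' where "antisym_form a P l r' (g / (\<Prod>z\<in>S. sym_factor a z))" by auto
      then have "antisym_form a P l (Suc r') (g / (\<Prod>z\<in>S. sym_factor a z) / sym_factor a z)"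
        using insert.prems by (intro antisym_form_divide) auto
      then show ?case using insert.hyps by (auto simp: mult.commute)
    qed
    show ?thesis
    proof (induction j)
      case 0
      then show ?case using that by auto
    next
      case (Suc j)
      then obtain r where "antisym_form a P l r (g / W ^ j)" by blast
      from one[OF P(1) subset_refl this] show ?case by (simp add: W_def mult.commute)
    qed
  qed
  ultimately obtain l r where lr: "antisym_form a P l r h"
    using div[of "degree Q" "h * W ^ M" M] W0 by auto
  \<comment> \<open>If there is a pole \<open>z\<close>, a cancelling pair of factors makes both numbers positive.\<close>
  show ?thesis
  proof (cases "P = {}")
    case True
    then show ?thesis using lr that by blast
  next
    case False
    then obtain z where z: "z \<in> P" by blast
    then have "z \<noteq> 0" using P by auto
    then have "antisym_form a P (Suc l) (Suc r) (h * sym_factor a z / sym_factor a z)"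
      by (intro antisym_form_divide antisym_form_mult lr z)
    then show ?thesis using that[of "Suc l" "Suc r"] sym_factor_nonzero[OF a] by simp
  qed
qed

subsection \<open>Solution of the functional equation\<close>

lemma minus_half: "w = - (rconst (- 1 / 2) * w + rconst (- 1 / 2) * w)"
proof -
  have "rconst (- 1 / 2) * w + rconst (- 1 / 2) * w = rconst (- 1 / 2 + - 1 / 2) * w"
    by (simp only: rconst_hom distrib_right)
  then show ?thesis by (simp add: rconst_hom')
qed

lemma inversion_backward:
  assumes a: "a \<noteq> 0" and c: "c \<noteq> 0" and p: "\<And>i. i \<in> {1..s} \<Longrightarrow> p i \<noteq> 0"
    and h: "antisym_form a P l r h" and \<alpha>: "\<alpha> = inversion_particular a s p m + h"
  shows "- rsubst \<alpha> (rconst a * inverse rX) = \<alpha> + logder (inversion_unit a c s p m)"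
proof -
  note nc = inversion_nonconst[OF a]
  have "- (x + - h) = x + h + w" if "w = - (x + x)" for x w using that by simp
  note half = this[OF minus_half]
  have part: "inversion_particular a s p m = rconst (- 1 / 2) * logder (inversion_unit a c s p m)"
    by (rule inversion_particular_eq[OF c p])
  have sym: "rsubst (logder (inversion_unit a c s p m)) (rconst a * inverse rX) = logder (inversion_unit a c s p m)"
    by (rule rsubst_logder_inversion_unit[OF a c p])
  show ?thesis
    unfolding \<alpha> part rsubst_add[OF nc] rsubst_mult[OF nc] rsubst_rconst sym
      antisym_form_antisymmetric[OF a h] by (rule half)
qed

text \<open>Applying the involution twice shows that the logarithmic derivative \<open>w\<close> is invariant; compare its
  coefficients at \<open>z\<close> and at \<open>a/z\<close>.\<close>

lemma inversion_exponents:
  assumes a: "a \<noteq> 0" and P: "finite P" "0 \<notin> P" "\<And>z. z \<in> P \<Longrightarrow> inverse z * a \<in> P"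
    and eq: "- rsubst \<alpha> (rconst a * inverse rX) = \<alpha> + w"
    and w: "w = of_int e + (\<Sum>z\<in>P. of_int (m z) * (rX / (rX - rconst z)))"
    and z: "z \<in> P"
  shows "m (inverse z * a) = - m z"
proof -
  let ?Y = "rconst a * inverse rX"
  note nc = inversion_nonconst[OF a]
  have ri: "rsubst (of_int k) ?Y = of_int k" for k by (simp flip: rconst_of_int)
  have "rsubst \<alpha> ?Y = - (\<alpha> + w)" unfolding eq[symmetric] by simp
  then have "rsubst \<alpha> ?Y = - \<alpha> - w" by simp
  then have "rsubst (rsubst \<alpha> ?Y) ?Y = - rsubst \<alpha> ?Y - rsubst w ?Y" by (simp add: rsubst_hom[OF nc])
  then have "\<alpha> = \<alpha> + w - rsubst w ?Y" unfolding inversion_involution[OF a] eq .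
  then have inv: "rsubst w ?Y = w" by simp
  have nz: "y \<noteq> 0" if "y \<in> P" for y using that P by auto
  have invol: "inverse (inverse y * a) * a = y" if "y \<in> P" for y using nz[OF that] a by (simp add: field_simps)
  have bij: "bij_betw (\<lambda>y. inverse y * a) P P"
    by (rule bij_betw_byWitness[where f' = "\<lambda>y. inverse y * a"]) (use invol P in auto)
  have "rsubst w ?Y = of_int e + (\<Sum>y\<in>P. of_int (m y) * (1 - rX / (rX - rconst (inverse y * a))))"
    unfolding w rsubst_add[OF nc] rsubst_sum[OF nc] rsubst_mult[OF nc] ri
    by (simp add: inversion_partial_fraction[OF a nz] cong: sum.cong)
  also have "(\<Sum>y\<in>P. of_int (m y) * (1 - rX / (rX - rconst (inverse y * a)))) =
      (\<Sum>y\<in>P. of_int (m (inverse y * a)) * (1 - rX / (rX - rconst (inverse (inverse y * a) * a))))"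
    by (rule sum.reindex_bij_betw[OF bij, symmetric])
  also have "\<dots> = (\<Sum>y\<in>P. of_int (m (inverse y * a)) * (1 - rX / (rX - rconst y)))"
    by (rule sum.cong) (simp_all only: invol)
  finally have "of_int e + (\<Sum>y\<in>P. of_int (m (inverse y * a)) * (1 - rX / (rX - rconst y))) = w"
    using inv by simp
  then have "rconst (of_int (- (\<Sum>y\<in>P. m (inverse y * a)))) +
      (\<Sum>y\<in>P. rconst (of_int (m y + m (inverse y * a))) * (rX / (rX - rconst y))) = 0"
    unfolding rconst_of_int by (simp add: w algebra_simps sum.distrib sum_subtractf)
  then have "complex_of_int (m z + m (inverse z * a)) = 0"
    by (rule partial_fractions_independent(1)[OF P(1,2) _ z])
  then have "m z + m (inverse z * a) = 0" by (simp only: of_int_eq_0_iff)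
  then show ?thesis by simp
qed

text \<open>The family \<open>p\<close> runs through all nonzero poles rather than through representatives of the orbits. The exponent
  of \<open>t - z\<close> in \<open>u\<close> is \<open>m z\<close> with \<open>m (a/z) = - m z\<close>, and it is recovered as
  \<open>max (m z) 0 - max (m (a/z)) 0\<close> when \<open>max (m z) 0\<close> is attached to \<open>z\<close>.\<close>

lemma inversion_forward:
  assumes a: "a \<noteq> 0" and \<alpha>: "\<alpha> \<notin> range rconst"
    and u: "u \<noteq> 0" and uA: "\<And>f. f \<in> A_space \<alpha> \<Longrightarrow> rsubst f (rconst a * inverse rX) * u \<in> A_space \<alpha>"
    and eq: "- rsubst \<alpha> (rconst a * inverse rX) = \<alpha> + logder u"
  obtains s :: nat and p m h c l r where "bij_betw p {1..s} (nonzero_poles \<alpha>)"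
    and "\<forall>z\<in>nonzero_poles \<alpha>. inverse z * a \<in> nonzero_poles \<alpha>"
    and "h \<in> A_space \<alpha>" and "antisym_form a (nonzero_poles \<alpha>) l r h"
    and "nonzero_poles \<alpha> \<noteq> {} \<longrightarrow> 0 < l \<and> 0 < r"
    and "\<alpha> = inversion_particular a s p m + h"
    and "c \<noteq> 0" and "u = inversion_unit a c s p m"
proof -
  let ?P = "nonzero_poles \<alpha>"
  note nc = inversion_nonconst[OF a]
  note fin = finite_nonzero_poles[of \<alpha>] and z0 = zero_not_in_nonzero_poles[of \<alpha>]
  have Y: "rconst a * rX powi - 1 = rconst a * inverse rX" by (simp add: power_int_minus)
  obtain c e m where P: "\<And>z. z \<noteq> 0 \<Longrightarrow> a * z powi - 1 \<in> ?P \<Longrightarrow> z \<in> ?P"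
    and c: "c \<noteq> 0" and u_eq: "u = rconst c * rX powi e * (\<Prod>z\<in>?P. (rX - rconst z) powi m z)"
    by (rule twist_structure[of "- 1" a \<alpha> u])
      (use a \<alpha> u uA eq in \<open>simp_all add: Y rconst_hom'\<close>)
  have closed: "inverse z * a \<in> ?P" if "z \<in> ?P" for z
  proof -
    have "z \<noteq> 0" using that z0 by metis
    then show ?thesis using P[of "inverse z * a"] a that by (simp add: power_int_minus field_simps)
  qed
  have ld: "logder u = of_int e + (\<Sum>z\<in>?P. of_int (m z) * (rX / (rX - rconst z)))"
    unfolding u_eq using c fin by (rule logder_unit)
  have m: "m (inverse z * a) = - m z" if "z \<in> ?P" for z
    by (rule inversion_exponents[OF a fin z0 closed eq ld that])
  define s where "s = card ?P"
  obtain p where p: "bij_betw p {1..s} ?P"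
    using ex_bij_betw_nat_finite_1[OF fin] unfolding s_def by blast
  then have pP: "p i \<in> ?P" if "i \<in> {1..s}" for i using that by (auto simp: bij_betw_def)
  then have p0: "p i \<noteq> 0" if "i \<in> {1..s}" for i using that z0 by metis
  define M where "M i = (if i = 0 then e else max (m (p i)) 0)" for i
  have invol: "inverse (inverse y * a) * a = y" if "y \<in> ?P" for y
    using that z0 a by (cases "y = 0") (simp_all add: field_simps)
  have bij: "bij_betw (\<lambda>y. inverse y * a) ?P ?P"
    by (rule bij_betw_byWitness[where f' = "\<lambda>y. inverse y * a"]) (use invol closed in auto)
  have "(\<Prod>i=1..s. (rX - rconst (p i)) powi M i * (rX - rconst (inverse (p i) * a)) powi (- M i)) =
      (\<Prod>i=1..s. (rX - rconst (p i)) powi max (m (p i)) 0 * (rX - rconst (inverse (p i) * a)) powi (- max (m (p i)) 0))"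
    by (rule prod.cong) (auto simp: M_def)
  then have "inversion_unit a c s p M = rconst c * rX powi e *
      (\<Prod>i=1..s. (rX - rconst (p i)) powi max (m (p i)) 0 * (rX - rconst (inverse (p i) * a)) powi (- max (m (p i)) 0))"
    unfolding inversion_unit_def by (simp add: M_def)
  also have "(\<Prod>i=1..s. (rX - rconst (p i)) powi max (m (p i)) 0 * (rX - rconst (inverse (p i) * a)) powi (- max (m (p i)) 0))
     = (\<Prod>z\<in>?P. (rX - rconst z) powi max (m z) 0 * (rX - rconst (inverse z * a)) powi (- max (m z) 0))"
    by (rule prod.reindex_bij_betw[OF p])
  also have "\<dots> = (\<Prod>z\<in>?P. (rX - rconst z) powi max (m z) 0) *
      (\<Prod>z\<in>?P. (rX - rconst (inverse z * a)) powi (- max (m z) 0))"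
    by (rule prod.distrib)
  also have "(\<Prod>z\<in>?P. (rX - rconst (inverse z * a)) powi (- max (m z) 0)) =
      (\<Prod>z\<in>?P. (rX - rconst (inverse (inverse z * a) * a)) powi (- max (m (inverse z * a)) 0))"
    by (rule prod.reindex_bij_betw[OF bij, symmetric])
  also have "\<dots> = (\<Prod>z\<in>?P. (rX - rconst z) powi (- max (- m z) 0))"
    by (rule prod.cong) (simp_all only: m invol)
  also have "(\<Prod>z\<in>?P. (rX - rconst z) powi max (m z) 0) * \<dots> = (\<Prod>z\<in>?P. (rX - rconst z) powi m z)"
    unfolding prod.distrib[symmetric]
    by (rule prod.cong) (simp_all add: max_def flip: power_int_add)
  finally have u': "u = inversion_unit a c s p M" unfolding u_eq ..
  define h where "h = \<alpha> - inversion_particular a s p M"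
  have part: "inversion_particular a s p M = rconst (- 1 / 2) * logder u"
    unfolding u' by (rule inversion_particular_eq[OF c p0])
  have "logder u \<in> laurent_adjoin ?P"
    unfolding ld divide_inverse
    by (intro laurent_adjoin_add laurent_adjoin_sum laurent_adjoin_mult laurent_adjoin_inverse_minus)
      (auto simp flip: rconst_of_int)
  then have hA: "h \<in> laurent_adjoin ?P"
    unfolding h_def part using A_space_self[of \<alpha>]
    by (intro laurent_adjoin_diff laurent_adjoin_mult) (auto simp: A_space_def)
  have "rsubst (logder u) (rconst a * inverse rX) = logder u"
    unfolding u' by (rule rsubst_logder_inversion_unit[OF a c p0])
  moreover have "rsubst \<alpha> (rconst a * inverse rX) = - (\<alpha> + logder u)"
    unfolding eq[symmetric] by simp
  moreover have "- (\<alpha> + w) - x = - (\<alpha> - x)" if "w = - (x + x)" for x w using that by simp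
  note this[OF minus_half, of "logder u"]
  ultimately have "rsubst h (rconst a * inverse rX) = - h"
    unfolding h_def part rsubst_diff[OF nc] rsubst_mult[OF nc] rsubst_rconst by simp
  then obtain l r where lr: "antisym_form a ?P l r h" "?P \<noteq> {} \<longrightarrow> 0 < l \<and> 0 < r"
    using antisym_form_exists[OF a fin z0 hA] by blast
  show ?thesis
    by (rule that[OF p _ _ lr, of M c]) (use closed hA c u' in \<open>simp_all add: A_space_def h_def\<close>)
qed

section \<open>The classification\<close>


theorem theorem3p12:
  fixes n :: int and a \<beta> :: complex and \<alpha> :: ratfun and \<delta> :: "ratfun \<Rightarrow> ratfun"
  assumes "n \<noteq> 0" and "a \<noteq> 0" and "\<alpha> \<notin> range rconst"
    and "linear_endo_on rscale (A_space \<alpha>) \<delta>"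
  shows
    "one_differential_module vir_scale vir_bracket (vir_d n a)
        rscale (A_space \<alpha>) (A_act \<alpha> \<beta>) \<delta>
      \<and> (\<exists>f\<in>A_space \<alpha>. \<delta> f \<noteq> - f)
    \<longleftrightarrow>
     (n = 1 \<and>
      (\<exists>d. primitive_root_of_unity d a \<and>
       (\<exists>(s::nat) (p :: nat \<Rightarrow> complex) (m :: nat \<Rightarrow> nat \<Rightarrow> int) (h :: ratfun) (c :: complex).
          (\<forall>i\<in>{1..s}. p i \<noteq> 0) \<and>
          inj_on (\<lambda>(i, j). p i * a ^ j) ({1..s} \<times> {1..d}) \<and>
          A_space \<alpha> = laurent_adjoin ((\<lambda>(i, j). p i * a ^ j) ` ({1..s} \<times> {1..d})) \<and>
          (\<forall>i\<in>{1..s}. (\<Sum>j<d. m i j) = 0) \<and>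
          h \<in> A_space \<alpha> \<and> rsubst h (rconst a * rX) - h = 0 \<and>
          \<alpha> = (\<Sum>i=1..s. \<Sum>j=1..d. rconst (p i * of_int (\<Sum>k<j. m i k)) *
                  inverse (rconst (a powi (- int j)) * rX - rconst (p i))) + h \<and>
          c \<noteq> 0 \<and>
          (\<forall>f\<in>A_space \<alpha>. \<delta> f =
              rconst c * rsubst f (rconst a * rX) *
                (\<Prod>i=1..s. \<Prod>j<d. (rX - rconst (p i * a ^ j)) powi (m i j)) - f))))
     \<or>
     (n = - 1 \<and>
      (\<exists>(s::nat) (p :: nat \<Rightarrow> complex) (m :: nat \<Rightarrow> int) (h :: ratfun) (c :: complex).
          (\<forall>i\<in>{1..s}. p i \<noteq> 0) \<and>
          inj_on p {1..s} \<and>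
          A_space \<alpha> = laurent_adjoin (p ` {1..s} \<union> (\<lambda>i. inverse (p i) * a) ` {1..s}) \<and>
          h \<in> A_space \<alpha> \<and>
          (\<exists>(b :: complex) (k :: int) (l :: nat) (r :: nat)
              (lam :: nat \<Rightarrow> complex) (mu :: nat \<Rightarrow> complex).
             int r = int l + k + 1 \<and>
             (0 < s \<longrightarrow> 0 < l \<and> 0 < r) \<and>
             (\<forall>i\<in>{1..l}. lam i \<noteq> 0) \<and>
             (\<forall>i\<in>{1..r}. mu i \<noteq> 0 \<and> (\<exists>j\<in>{1..s}. mu i = p j \<or> mu i = inverse (p j) * a)) \<and>
             h = rconst b *
                 (rX powi k * (rX\<^sup>2 - rconst a) *
                    (\<Prod>i=1..l. (rX - rconst (lam i)) * (rconst (lam i) * rX - rconst a)) /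
                    (\<Prod>i=1..r. (rX - rconst (mu i)) * (rconst (mu i) * rX - rconst a)))) \<and>
          \<alpha> = - rconst (of_int (m 0) / 2)
                - (\<Sum>i=1..s. rconst (of_int (m i) / 2) *
                    ((rconst ((p i)\<^sup>2 - a) * rX) /
                      ((rX - rconst (p i)) * (rconst (p i) * rX - rconst a)))) + h \<and>
          c \<noteq> 0 \<and>
          (\<forall>f\<in>A_space \<alpha>. \<delta> f =
              rconst c * rsubst f (rconst a * inverse rX) * rX powi (m 0) *
                (\<Prod>i=1..s. (rX - rconst (p i)) powi (m i) *
                   (rX - rconst (inverse (p i) * a)) powi (- m i)) - f)))"
    (is "?M \<longleftrightarrow> ?R1 \<or> ?R2")
proof
  assume ?M
  then obtain u where u: "u \<noteq> 0" "\<And>f. f \<in> A_space \<alpha> \<Longrightarrow> \<delta> f = rsubst f (rconst a * rX powi n) * u - f"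
    "rconst (of_int n) * rsubst \<alpha> (rconst a * rX powi n) = \<alpha> + logder u"
    unfolding one_differential_module_iff_twist[OF assms(1,2,4)] by blast
  have uA: "rsubst f (rconst a * rX powi n) * u \<in> A_space \<alpha>" if f: "f \<in> A_space \<alpha>" for f
  proof -
    have "\<delta> f \<in> A_space \<alpha>" using assms(4) f by (simp add: linear_endo_on_def)
    then have "\<delta> f + f \<in> A_space \<alpha>" using f by (simp add: A_space_def laurent_adjoin_add)
    then show ?thesis using u(2)[OF f] by simp
  qed
  have "n = 1 \<or> n = - 1"
    by (rule twist_structure[OF assms(1-3) u(1) uA u(3)])
  then show "?R1 \<or> ?R2"
  proof
    assume n: "n = 1"
    have uA1: "rsubst f (rconst a * rX) * u \<in> A_space \<alpha>" if "f \<in> A_space \<alpha>" for f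
      using uA[OF that] by (simp add: n)
    have eq1: "rsubst \<alpha> (rconst a * rX) = \<alpha> + logder u"
      using u(3) by (simp add: n)
    obtain d and s :: nat and p m h c where root: "primitive_root_of_unity d a" and *: "\<forall>i\<in>{1..s}. p i \<noteq> 0"
      "inj_on (\<lambda>(i, j). p i * a ^ j) ({1..s} \<times> {1..d})"
      "A_space \<alpha> = laurent_adjoin ((\<lambda>(i, j). p i * a ^ j) ` ({1..s} \<times> {1..d}))"
      "\<forall>i\<in>{1..s}. (\<Sum>j<d. m i j) = 0"
      "h \<in> A_space \<alpha>" "rsubst h (rconst a * rX) - h = 0"
      "\<alpha> = rotation_particular a d s p m + h"
      "c \<noteq> 0" "u = rotation_unit a c d s p m"
      by (rule rotation_forward[OF assms(2,3) u(1) uA1 eq1])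
    have "\<forall>f\<in>A_space \<alpha>. \<delta> f = rconst c * rsubst f (rconst a * rX) *
                (\<Prod>i=1..s. \<Prod>j<d. (rX - rconst (p i * a ^ j)) powi (m i j)) - f"
      using u(2) unfolding *(9) n rotation_unit_def by (simp add: mult_ac)
    with n root *(1-6) *(7)[unfolded rotation_particular_def] *(8) have ?R1
      by (intro conjI exI[of _ d] exI[of _ s] exI[of _ p] exI[of _ m] exI[of _ h] exI[of _ c])
    then show ?thesis ..
  next
    assume n: "n = - 1"
    have Y: "rconst a * rX powi n = rconst a * inverse rX" by (simp add: n power_int_minus)
    have eq: "- rsubst \<alpha> (rconst a * inverse rX) = \<alpha> + logder u"
      using u(3) unfolding Y by (simp add: n rconst_hom')
    obtain s :: nat and p m h c l r where *: "bij_betw p {1..s} (nonzero_poles \<alpha>)"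
      "\<forall>z\<in>nonzero_poles \<alpha>. inverse z * a \<in> nonzero_poles \<alpha>"
      "h \<in> A_space \<alpha>" "antisym_form a (nonzero_poles \<alpha>) l r h"
      "nonzero_poles \<alpha> \<noteq> {} \<longrightarrow> 0 < l \<and> 0 < r"
      "\<alpha> = inversion_particular a s p m + h"
      "c \<noteq> 0" "u = inversion_unit a c s p m"
      by (rule inversion_forward[OF assms(2,3) u(1) uA[unfolded Y] eq])
    have img: "p ` {1..s} = nonzero_poles \<alpha>" and inj: "inj_on p {1..s}"
      using *(1) by (auto simp: bij_betw_def)
    have p0: "\<forall>i\<in>{1..s}. p i \<noteq> 0" using img zero_not_in_nonzero_poles by (metis imageI)
    have "(\<lambda>i. inverse (p i) * a) ` {1..s} \<subseteq> nonzero_poles \<alpha>" using img *(2) by blast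
    then have A: "A_space \<alpha> = laurent_adjoin (p ` {1..s} \<union> (\<lambda>i. inverse (p i) * a) ` {1..s})"
      unfolding A_space_def img by (simp add: Un_absorb2)
    obtain b k lam mu where **: "int r = int l + k + 1" "\<forall>i\<in>{1..l}. lam i \<noteq> 0"
      "\<forall>i\<in>{1..r}. mu i \<in> nonzero_poles \<alpha>"
      "h = rconst b * (rX powi k * (rX\<^sup>2 - rconst a) *
                    (\<Prod>i=1..l. (rX - rconst (lam i)) * (rconst (lam i) * rX - rconst a)) /
                    (\<Prod>i=1..r. (rX - rconst (mu i)) * (rconst (mu i) * rX - rconst a)))"
      using *(4) unfolding antisym_form_def by blast
    have pos: "0 < s \<longrightarrow> 0 < l \<and> 0 < r"
    proof
      assume "0 < s"
      then have "nonzero_poles \<alpha> \<noteq> {}" unfolding img[symmetric] by simp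
      then show "0 < l \<and> 0 < r" using *(5) by blast
    qed
    have mu: "\<forall>i\<in>{1..r}. mu i \<noteq> 0 \<and> (\<exists>j\<in>{1..s}. mu i = p j \<or> mu i = inverse (p j) * a)"
    proof
      fix i assume "i \<in> {1..r}"
      then obtain j where "j \<in> {1..s}" "mu i = p j" using **(3) unfolding img[symmetric] by blast
      then show "mu i \<noteq> 0 \<and> (\<exists>j\<in>{1..s}. mu i = p j \<or> mu i = inverse (p j) * a)"
        using p0 by auto
    qed
    have \<delta>: "\<forall>f\<in>A_space \<alpha>. \<delta> f = rconst c * rsubst f (rconst a * inverse rX) * rX powi (m 0) *
                (\<Prod>i=1..s. (rX - rconst (p i)) powi (m i) *
                   (rX - rconst (inverse (p i) * a)) powi (- m i)) - f"
      using u(2) unfolding *(8) Y inversion_unit_def by (simp add: mult_ac)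
    have ?R2
      using n p0 inj A *(3) **(1,2) pos mu **(4) *(6)[unfolded inversion_particular_def] *(7) \<delta>
      by (intro conjI exI[of _ s] exI[of _ p] exI[of _ m] exI[of _ h] exI[of _ c]
          exI[of _ b] exI[of _ k] exI[of _ l] exI[of _ r] exI[of _ lam] exI[of _ mu])
    then show ?thesis ..
  qed
next
  assume "?R1 \<or> ?R2"
  then show ?M
  proof
    assume ?R1
    then obtain d and s :: nat and p m h c where n: "n = 1" and root: "primitive_root_of_unity d a"
      and m: "\<forall>i\<in>{1..s}. (\<Sum>j<d. m i j) = 0" and h: "rsubst h (rconst a * rX) - h = 0"
      and \<alpha>: "\<alpha> = (\<Sum>i=1..s. \<Sum>j=1..d. rconst (p i * of_int (\<Sum>k<j. m i k)) *
                  inverse (rconst (a powi (- int j)) * rX - rconst (p i))) + h"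
      and c: "c \<noteq> 0"
      and \<delta>: "\<forall>f\<in>A_space \<alpha>. \<delta> f = rconst c * rsubst f (rconst a * rX) *
                (\<Prod>i=1..s. \<Prod>j<d. (rX - rconst (p i * a ^ j)) powi (m i j)) - f"
      by blast
    define u where "u = rotation_unit a c d s p m"
    have "u \<noteq> 0" using c by (simp add: u_def rotation_unit_def)
    moreover have "rsubst \<alpha> (rconst a * rX) = \<alpha> + logder u"
      unfolding u_def using root c m h \<alpha> by (intro rotation_backward) (auto simp: rotation_particular_def)
    moreover have "\<forall>f\<in>A_space \<alpha>. \<delta> f = rsubst f (rconst a * rX) * u - f"
      using \<delta> by (simp add: u_def rotation_unit_def mult_ac)
    ultimately show ?M
      unfolding one_differential_module_iff_twist[OF assms(1,2,4)] by (intro exI[of _ u]) (simp add: n)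
  next
    assume ?R2
    then obtain s :: nat and p m h c and b k l r lam mu where n: "n = - 1"
      and p: "\<forall>i\<in>{1..s}. p i \<noteq> 0"
      and lr: "int r = int l + k + 1" and lam: "\<forall>i\<in>{1..l}. lam i \<noteq> 0"
      and h: "h = rconst b *
                 (rX powi k * (rX\<^sup>2 - rconst a) *
                    (\<Prod>i=1..l. (rX - rconst (lam i)) * (rconst (lam i) * rX - rconst a)) /
                    (\<Prod>i=1..r. (rX - rconst (mu i)) * (rconst (mu i) * rX - rconst a)))"
      and \<alpha>: "\<alpha> = - rconst (of_int (m 0) / 2)
                - (\<Sum>i=1..s. rconst (of_int (m i) / 2) *
                    ((rconst ((p i)\<^sup>2 - a) * rX) /
                      ((rX - rconst (p i)) * (rconst (p i) * rX - rconst a)))) + h"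
      and c: "c \<noteq> 0"
      and \<delta>: "\<forall>f\<in>A_space \<alpha>. \<delta> f =
              rconst c * rsubst f (rconst a * inverse rX) * rX powi (m 0) *
                (\<Prod>i=1..s. (rX - rconst (p i)) powi (m i) *
                   (rX - rconst (inverse (p i) * a)) powi (- m i)) - f"
      by blast
    have Y: "rconst a * rX powi n = rconst a * inverse rX" by (simp add: n power_int_minus)
    define u where "u = inversion_unit a c s p m"
    have "u \<noteq> 0" unfolding u_def using c by (rule inversion_unit_nonzero)
    moreover have "antisym_form a UNIV l r h"
      unfolding antisym_form_def using lr lam h by blast
    then have "- rsubst \<alpha> (rconst a * inverse rX) = \<alpha> + logder u"
      unfolding u_def using assms(2) c p \<alpha>
      by (intro inversion_backward) (auto simp: inversion_particular_def)
    moreover have "\<forall>f\<in>A_space \<alpha>. \<delta> f = rsubst f (rconst a * inverse rX) * u - f"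
      using \<delta> by (simp add: u_def inversion_unit_def mult_ac)
    ultimately show ?M
      unfolding one_differential_module_iff_twist[OF assms(1,2,4)] Y
      by (intro exI[of _ u]) (simp add: n rconst_hom')
  qed
qed

end
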